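(* Let $(G,F_\theta)$ be a bounded irreducible local Siegel disk with Siegel point $w_0$, and let $\varphi\colon \mathbb{D}\to G$ be the Riemann map of the conjugation. Then exactly one of the following two properties holds: (1) the inverse $\varphi^{-1}\colon G\to\mathbb{D}$ extends continuously to a map $\psi\colon \partial G\to \partial\mathbb{D}=S^1$ (that is, there is a continuous map $\overline{G}\to\overline{\mathbb{D}}$ that agrees with $\varphi^{-1}$ on $G$ and whose restriction to $\partial G$ is a map $\psi\colon\partial G\to S^1$); (2) $\partial G$ is an indecomposable continuum.
   Context: $\mathbb{D}$ denotes the open unit disk in $\mathbb{C}$, and $S^1=\partial\mathbb{D}$ the unit circle. A bounded local Siegel disk is a pair $(G,F_\theta)$, where $G$ is a bounded simply connected domain in $\mathbb{C}$ and $F_\theta\colon G\to G$ is a conformal map that is complex analytically conjugate to a rotation through the irrational angle $\theta$, and such that $F_\theta$ extends continuously to the boundary of $G$. Thus there is a conformal isomorphism $\varphi\colon\mathbb{D}\to G$ (the Riemann map of the conjugation) with $F_\theta(\varphi(z))=\varphi(e^{2\pi i\theta}z)$ for all $z\in\mathbb{D}$, with $\theta$ irrational. The fixed point $w_0=\varphi(0)$ of $F_\theta$ in $G$ is called the Siegel point. A bounded local Siegel disk $(G,F_\theta)$ is irreducible if $\partial G$ separates the Siegel point $w_0$ from $\infty$ (in the Riemann sphere), but no proper closed subset of $\partial G$ separates $w_0$ from $\infty$. An indecomposable continuum is a compact connected space $X$ that cannot be written as a union $A\cup B$ with $A$ and $B$ connected closed proper subsets of $X$. *)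

theory Defs
  imports "HOL-Complex_Analysis.Complex_Analysis"
begin

definition conformal_iso :: "(complex \<Rightarrow> complex) \<Rightarrow> complex set \<Rightarrow> complex set \<Rightarrow> bool" where
  "conformal_iso f S T \<longleftrightarrow> f holomorphic_on S \<and> bij_betw f S T"

definition simply_connected_domain :: "complex set \<Rightarrow> bool" where
  "simply_connected_domain G \<longleftrightarrow> G \<noteq> {} \<and> open G \<and> connected G \<and> simply_connected G"

definition conjugation_map ::
  "(complex \<Rightarrow> complex) \<Rightarrow> complex set \<Rightarrow> (complex \<Rightarrow> complex) \<Rightarrow> real \<Rightarrow> bool" where
  "conjugation_map \<phi> G F \<theta> \<longleftrightarrow>
     conformal_iso \<phi> (ball 0 1) G \<and>
     (\<forall>z \<in> ball 0 1. F (\<phi> z) = \<phi> (cis (2 * pi * \<theta>) * z))"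

text \<open>The map of the disk is the restriction of \<open>F\<close> to \<open>G\<close>; the values of the total function
  \<open>F\<close> elsewhere play no role, and its continuous extension to the closure is a separate map.\<close>

definition bounded_local_siegel_disk ::
  "complex set \<Rightarrow> (complex \<Rightarrow> complex) \<Rightarrow> real \<Rightarrow> bool" where
  "bounded_local_siegel_disk G F \<theta> \<longleftrightarrow>
     bounded G \<and> simply_connected_domain G \<and>
     F \<in> G \<rightarrow> G \<and> F holomorphic_on G \<and> inj_on F G \<and>
     \<theta> \<notin> \<rat> \<and> (\<exists>\<phi>. conjugation_map \<phi> G F \<theta>) \<and>
     (\<exists>Fc. continuous_on (closure G) Fc \<and> (\<forall>z\<in>G. Fc z = F z))"

definition siegel_point :: "complex set \<Rightarrow> (complex \<Rightarrow> complex) \<Rightarrow> complex \<Rightarrow> bool" where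
  "siegel_point G F w \<longleftrightarrow> w \<in> G \<and> F w = w"

text \<open>An irrational rotation fixes only the centre of the disk, so the Siegel point is unique and
  is the image of the centre under every conjugation map.\<close>

lemma siegel_point_iff:
  assumes "conjugation_map \<phi> G F \<theta>" "\<theta> \<notin> \<rat>"
  shows "siegel_point G F w \<longleftrightarrow> w = \<phi> 0"
proof
  assume w: "siegel_point G F w"
  have bij: "bij_betw \<phi> (ball 0 1) G"
    and conj: "\<And>z. z \<in> ball 0 1 \<Longrightarrow> F (\<phi> z) = \<phi> (cis (2 * pi * \<theta>) * z)"
    using assms(1) by (auto simp: conjugation_map_def conformal_iso_def)
  obtain z where z: "z \<in> ball 0 1" "w = \<phi> z"
    using w bij by (auto simp: siegel_point_def bij_betw_def)
  have "\<phi> (cis (2 * pi * \<theta>) * z) = \<phi> z"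
    using conj[OF z(1)] w z(2) by (simp add: siegel_point_def)
  moreover have "cis (2 * pi * \<theta>) * z \<in> ball 0 1"
    using z(1) by (simp add: norm_mult)
  ultimately have "cis (2 * pi * \<theta>) * z = z"
    using bij z(1) by (meson bij_betw_def inj_onD)
  moreover have "cis (2 * pi * \<theta>) \<noteq> 1"
  proof
    assume "cis (2 * pi * \<theta>) = 1"
    then have "cos (2 * pi * \<theta>) = 1"
      by (simp add: complex_eq_iff)
    then obtain n :: int where "2 * pi * \<theta> = of_int n * 2 * pi"
      by (auto simp: cos_one_2pi_int)
    then have "\<theta> = of_int n"
      by simp
    then show False
      using assms(2) by simp
  qed
  ultimately have "z = 0"
    by simp
  then show "w = \<phi> 0"
    using z(2) by simp
next
  assume "w = \<phi> 0"
  then show "siegel_point G F w"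
    using assms(1) by (force simp: siegel_point_def conjugation_map_def conformal_iso_def bij_betw_def)
qed

text \<open>The Riemann sphere is the one-point compactification of the plane, with \<open>None\<close> as the point
  at infinity.\<close>

abbreviation riemann_sphere :: "complex option topology" where
  "riemann_sphere \<equiv> Alexandroff_compactification euclidean"

definition separates_in :: "'a topology \<Rightarrow> 'a set \<Rightarrow> 'a \<Rightarrow> 'a \<Rightarrow> bool" where
  "separates_in X C p q \<longleftrightarrow>
     p \<in> topspace X - C \<and> q \<in> topspace X - C \<and>
     \<not> connected_component_of (subtopology X (topspace X - C)) p q"

definition separates_from_infinity :: "complex set \<Rightarrow> complex \<Rightarrow> bool" where
  "separates_from_infinity C w \<longleftrightarrow> separates_in riemann_sphere (Some ` C) (Some w) None"

definition irreducible_local_siegel_disk ::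
  "complex set \<Rightarrow> (complex \<Rightarrow> complex) \<Rightarrow> real \<Rightarrow> complex \<Rightarrow> bool" where
  "irreducible_local_siegel_disk G F \<theta> w\<^sub>0 \<longleftrightarrow>
     bounded_local_siegel_disk G F \<theta> \<and> siegel_point G F w\<^sub>0 \<and>
     separates_from_infinity (frontier G) w\<^sub>0 \<and>
     (\<forall>C. closed C \<and> C \<subset> frontier G \<longrightarrow> \<not> separates_from_infinity C w\<^sub>0)"

definition inverse_extends_to_boundary :: "(complex \<Rightarrow> complex) \<Rightarrow> complex set \<Rightarrow> bool" where
  "inverse_extends_to_boundary \<phi> G \<longleftrightarrow>
     (\<exists>\<Psi>. continuous_on (closure G) \<Psi> \<and> \<Psi> \<in> closure G \<rightarrow> cball 0 1 \<and>
        (\<forall>w\<in>G. \<Psi> w = inv_into (ball 0 1) \<phi> w) \<and> \<Psi> \<in> frontier G \<rightarrow> sphere 0 1)"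

definition indecomposable_continuum :: "'a::topological_space set \<Rightarrow> bool" where
  "indecomposable_continuum X \<longleftrightarrow>
     compact X \<and> connected X \<and>
     \<not> (\<exists>A B. closedin (top_of_set X) A \<and> connected A \<and> A \<noteq> X \<and>
            closedin (top_of_set X) B \<and> connected B \<and> B \<noteq> X \<and> X = A \<union> B)"

end

theory Submission
  imports Defs
begin

text \<open>
  Write \<open>X\<close> for the frontier of \<open>G\<close>.  The impression \<open>I t\<close> of the angle \<open>t\<close> is the set of all
  limits of \<open>\<phi>\<close> along sequences in the disk that tend to \<open>cis t\<close>, and \<open>M a b\<close> is the union of
  \<open>I t\<close> for \<open>a \<le> t \<le> b\<close> (\<open>arc_impression\<close>).  These sets are continua, \<open>X = M a (a + 2 * pi)\<close>, and
  \<open>F\<close> acts on them as the rotation.  Irrational rotations are dense, so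
  equalities and inclusions between such sets that hold at one position hold at every
  position, up to semicontinuity.  The inverse of \<open>\<phi>\<close> extends to the frontier precisely when distinct
  points of the circle have disjoint impressions.  In that case the impressions of two half circles
  decompose \<open>X\<close>, so the two alternatives exclude each other.

  For the converse let \<open>X = A \<union> B\<close> with proper subcontinua.  Three facts carry the proof.

  \<^item> By Janiszewski's theorem and irreducibility, two proper subcontinua with union \<open>X\<close> have a
    disconnected intersection (\<open>Int_not_connected\<close>), and the complement in \<open>X\<close> of a subcontinuum
    is connected (\<open>connected_frontier_Diff\<close>).

  \<^item> If a proper subcontinuum \<open>K\<close> contains \<open>I c\<close> and \<open>I c'\<close>, then it contains \<open>M c c'\<close> or
    \<open>M c' (c + 2 * pi)\<close> (\<open>arc_dichotomy\<close>).  Indeed \<open>K\<close> and the images of the two radii form a barrier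
    that a loop through a point of \<open>X - K\<close> cannot cross exactly once; this is a computation of
    winding numbers.

  \<^item> A subcontinuum with interior points in \<open>X\<close> contains some \<open>I t\<close>
    (\<open>impressions_in_neighborhood\<close>).  Around an interior point a small circle contains a crosscut of
    \<open>G\<close> with both ends in the continuum.  By winding numbers again one side of the crosscut
    accumulates only inside the continuum, and Koebe's lemma on asymptotic paths together with a
    maximum principle shows that this side contains the image of a neighbourhood of a point of the
    circle.

  These facts exclude that \<open>M a b = X\<close> for an arc shorter than the circle
  (\<open>arc_impressions_proper\<close>).  At the least length \<open>L\<close> of such an arc, a slightly shorter arc misses a
  piece of \<open>X\<close> that lies in the impressions of two short arcs at distance \<open>L\<close>.  This piece
  contains an impression, at a position far from one of the two short arcs.  The dichotomy and the rotation then propagate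
  the inclusion around the circle, and the impression of a short arc would be all of \<open>X\<close>.

  Finally suppose that \<open>I c\<close> and \<open>I c'\<close> meet.  Their union \<open>K\<close> is a continuum, and by the dichotomy
  \<open>M c c'\<close> and \<open>M c' (c + 2 * pi)\<close> intersect in \<open>K\<close>.  These are proper subcontinua with union \<open>X\<close>
  and connected intersection, which is impossible (\<open>impressions_disjoint\<close>).
\<close>

section \<open>Frontiers that separate irreducibly\<close>

text \<open>
  The component \<open>V\<close> of \<open>w\<close> in the complement of \<open>C\<close> is bounded unless it contains all
  distant points.  A bounded \<open>V\<close> is open and closed in the sphere minus \<open>C\<close>, because
  \<open>V \<union> C\<close> is compact, so it would separate \<open>w\<close> from infinity.
\<close>

lemma connected_component_of_not_separates_from_infinity:
  fixes C :: "complex set"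
  assumes C: "closed C" "C \<subseteq> cball 0 R" and w: "w \<notin> C" and b: "R < norm b"
    and nsep: "\<not> separates_from_infinity C w"
  shows "connected_component (- C) w b"
proof (rule ccontr)
  assume neg: "\<not> connected_component (- C) w b"
  define V where "V = connected_component_set (- C) w"
  have "open V" unfolding V_def using C by (intro open_connected_component) auto
  have wV: "w \<in> V" unfolding V_def using w by simp
  have conn: "connected (- cball (0::complex) R)"
    by (rule connected_complement_bounded_convex) auto
  have VR: "V \<subseteq> cball 0 R"
  proof (rule ccontr)
    assume "\<not> V \<subseteq> cball 0 R"
    then obtain v where v: "v \<in> V" "v \<in> - cball 0 R" by blast
    have "connected_component (- C) v b"
      unfolding connected_component_def using conn v b C
      by (intro exI[of _ "- cball 0 R"]) auto
    then have "connected_component (- C) w b"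
      using v(1) connected_component_trans[of "- C" w v b] by (simp add: V_def)
    with neg show False by simp
  qed
  have VC: "V \<inter> C = {}" unfolding V_def using connected_component_subset[of "- C" w] by auto
  have clVC: "closure V \<subseteq> V \<union> C"
  proof
    fix x assume x: "x \<in> closure V"
    show "x \<in> V \<union> C"
    proof (cases "x \<in> C")
      case False
      then have "x \<in> - C" by simp
      have "closedin (top_of_set (- C)) V"
        unfolding V_def by (rule closedin_connected_component)
      then obtain T where T: "closed T" "V = - C \<inter> T"
        unfolding closedin_closed by blast
      then have "closure V \<subseteq> T" by (intro closure_minimal) auto
      with x \<open>x \<in> - C\<close> T show ?thesis by blast
    qed simp
  qed
  have closedVC: "closed (V \<union> C)"
  proof -
    have "closure (V \<union> C) \<subseteq> V \<union> C" using clVC C by (simp add: closure_Un)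
    then show ?thesis by (metis closure_subset closure_closed closed_closure subset_antisym)
  qed
  have compVC: "compact (V \<union> C)"
    using closedVC VR C bounded_subset[OF bounded_cball, of "V \<union> C" 0 R] by (simp add: compact_eq_bounded_closed)
  let ?Y = "subtopology riemann_sphere (topspace riemann_sphere - Some ` C)"
  have o1: "openin ?Y (Some ` V)"
    using \<open>open V\<close> VC by (auto simp: openin_subtopology intro!: exI[of _ "Some ` V"])
  have o2: "openin ?Y (insert None (Some ` (- (V \<union> C))))"
  proof -
    have "openin riemann_sphere (insert None (Some ` (- (V \<union> C))))"
      unfolding openin_Alexandroff_compactification
      using compVC closedVC by (intro disjI2 exI[of _ "V \<union> C"]) (auto simp: Compl_eq_Diff_UNIV)
    then show ?thesis
      by (auto simp: openin_subtopology intro!: exI[of _ "insert None (Some ` (- (V \<union> C)))"])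
  qed
  have o3: "topspace ?Y \<subseteq> Some ` V \<union> insert None (Some ` (- (V \<union> C)))" by auto
  have o4: "Some ` V \<inter> insert None (Some ` (- (V \<union> C))) = {}" by auto
  obtain T where T: "connectedin ?Y T" "Some w \<in> T" "None \<in> T"
  proof -
    have "connected_component_of ?Y (Some w) None"
      using nsep w unfolding separates_from_infinity_def separates_in_def by auto
    then show thesis using that unfolding connected_component_of_def by blast
  qed
  have "T \<subseteq> Some ` V \<union> insert None (Some ` (- (V \<union> C)))"
    using connectedin_subset_topspace[OF T(1)] o3 by (rule subset_trans)
  moreover have "Some ` V \<inter> insert None (Some ` (- (V \<union> C))) \<inter> T = {}"
    using o4 by simp
  moreover have "Some ` V \<inter> T \<noteq> {}" "insert None (Some ` (- (V \<union> C))) \<inter> T \<noteq> {}"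
    using wV T by blast+
  ultimately show False
    using T(1) o1 o2 unfolding connectedin by metis
qed

text \<open>
  The point \<open>b\<close> stands in for infinity, which keeps the separation arguments inside the plane.
\<close>

locale irreducible_frontier =
  fixes G :: "complex set" and w0 b :: complex
  assumes open_G: "open G" and connected_G: "connected G" and bounded_G: "bounded G"
    and w0: "w0 \<in> G" and b: "b \<notin> closure G"
    and irreducible: "\<And>C. closed C \<Longrightarrow> C \<subset> frontier G \<Longrightarrow> connected_component (- C) w0 b"
begin

lemma compact_frontier: "compact (frontier G)"
  using bounded_G by (simp add: compact_frontier_bounded)

lemma frontier_Int: "frontier G \<inter> G = {}"
  using open_G by (simp add: frontier_disjoint_eq)

lemma frontier_separates: "\<not> connected_component (- frontier G) w0 b"
proof
  assume "connected_component (- frontier G) w0 b"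
  then obtain T where T: "connected T" "T \<subseteq> - frontier G" "w0 \<in> T" "b \<in> T"
    unfolding connected_component_def by blast
  have "T \<inter> frontier G \<noteq> {}"
    using w0 b T closure_subset[of G] by (intro connected_Int_frontier) auto
  with T show False by auto
qed

text \<open>
  This is Janiszewski's theorem read backwards: neither \<open>A\<close> nor \<open>B\<close> separates \<open>w0\<close> from
  \<open>b\<close>, but their union does.
\<close>

lemma Int_not_connected:
  assumes "closed A" "closed B" "A \<subset> frontier G" "B \<subset> frontier G" "A \<union> B = frontier G"
  shows "\<not> connected (A \<inter> B)"
proof
  assume "connected (A \<inter> B)"
  moreover have "compact A"
    using assms compact_frontier by (metis compact_Int_closed inf.absorb_iff2 psubset_imp_subset)
  ultimately have "connected_component (- (A \<union> B)) w0 b"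
    using assms irreducible by (intro Janiszewski) auto
  then show False using frontier_separates assms by simp
qed

text \<open>
  A separation of the complement of \<open>B\<close> into \<open>P\<close> and \<open>Q\<close> would write the frontier as the union
  of \<open>B \<union> P\<close> and \<open>B \<union> Q\<close>, whose intersection \<open>B\<close> is connected.
\<close>

lemma connected_frontier_Diff:
  assumes B: "closed B" "connected B" "B \<subseteq> frontier G"
  shows "connected (frontier G - B)"
proof (rule ccontr)
  assume "\<not> connected (frontier G - B)"
  then obtain P Q where PQ: "closed P" "closed Q" "frontier G - B \<subseteq> P \<union> Q"
      "P \<inter> Q \<inter> (frontier G - B) = {}" "P \<inter> (frontier G - B) \<noteq> {}" "Q \<inter> (frontier G - B) \<noteq> {}"
    unfolding connected_closed by blast
  let ?P = "B \<union> (frontier G \<inter> P)" and ?Q = "B \<union> (frontier G \<inter> Q)"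
  have "?P \<inter> ?Q = B" using PQ B by auto
  moreover have "\<not> connected (?P \<inter> ?Q)"
    using PQ B by (intro Int_not_connected) (auto simp: closed_Int)
  ultimately show False using B by simp
qed

text \<open>
  The frontier of the component of \<open>b\<close> already separates \<open>w0\<close> from \<open>b\<close>, so by irreducibility
  it is everything.
\<close>

lemma frontier_outer_component:
  "frontier (connected_component_set (- frontier G) b) = frontier G"
proof (rule ccontr)
  let ?U = "connected_component_set (- frontier G) b"
  assume neq: "frontier ?U \<noteq> frontier G"
  have U: "open ?U" by (intro open_connected_component) auto
  have "frontier ?U \<subseteq> frontier (- frontier G)"
    by (rule Path_Connected.frontier_of_connected_component_subset)
  also have "\<dots> \<subseteq> frontier G"
    using frontier_subset_closed[of "frontier G"] by (simp add: frontier_complement)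
  finally have "frontier ?U \<subset> frontier G" using neq by auto
  then have "connected_component (- frontier ?U) w0 b"
    by (intro irreducible) auto
  then obtain T where T: "connected T" "T \<subseteq> - frontier ?U" "w0 \<in> T" "b \<in> T"
    unfolding connected_component_def by blast
  have "b \<notin> frontier G"
    using b by (auto simp: frontier_def)
  then have "b \<in> T \<inter> ?U" using T by simp
  moreover have "w0 \<notin> ?U"
    using frontier_separates connected_component_sym by auto
  ultimately have "T \<inter> frontier ?U \<noteq> {}"
    using T by (intro connected_Int_frontier) auto
  with T show False by auto
qed

text \<open>
  Every frontier point is a limit both of \<open>G\<close> and of the component of \<open>b\<close>, and both of these are
  connected sets that leave the disk.
\<close>

lemma small_circle_meets_both_sides:
  assumes x: "x \<in> frontier G" and r: "0 < r" "r < dist x w0" "r < dist x b"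
  shows "G \<inter> sphere x r \<noteq> {}" "sphere x r - closure G \<noteq> {}"
proof -
  let ?U = "connected_component_set (- frontier G) b"
  have "x \<in> closure G" using x by (simp add: frontier_def)
  then obtain g where g: "g \<in> G" "dist g x < r"
    using r closure_approachable by blast
  have "G \<inter> frontier (ball x r) \<noteq> {}"
    using connected_G g w0 r by (intro connected_Int_frontier) (auto simp: dist_commute)
  then show "G \<inter> sphere x r \<noteq> {}" using r by simp
  have "x \<in> closure ?U"
    using x frontier_outer_component by (metis Diff_iff frontier_def)
  then obtain u where u: "u \<in> ?U" "dist u x < r"
    using r closure_approachable by blast
  have bU: "b \<in> ?U" using b by (simp add: frontier_def)
  have "b \<notin> ball x r" using r by (simp add: dist_commute)
  with bU have "?U - ball x r \<noteq> {}" by blast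
  moreover have "u \<in> ball x r" using u by (simp add: dist_commute)
  with u have "?U \<inter> ball x r \<noteq> {}" by blast
  ultimately have "?U \<inter> frontier (ball x r) \<noteq> {}"
    by (intro connected_Int_frontier connected_connected_component)
  then obtain q where q: "q \<in> ?U" "q \<in> sphere x r"
    unfolding frontier_ball[OF r(1)] by blast
  have "?U \<inter> G = {}"
  proof (rule ccontr)
    assume "?U \<inter> G \<noteq> {}"
    then obtain z where z: "z \<in> ?U" "z \<in> G" by auto
    have "connected_component (- frontier G) w0 z"
      unfolding connected_component_def using connected_G w0 z(2) frontier_Int
      by (intro exI[of _ G]) auto
    moreover have "connected_component (- frontier G) z b"
      using z(1) by (simp add: connected_component_sym)
    ultimately show False
      using frontier_separates connected_component_trans by blast
  qed
  then have "?U \<inter> closure G = {}"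
    using open_Int_closure_eq_empty[of ?U G] open_connected_component[of "- frontier G" b] frontier_closed[of G]
    by (simp add: open_Compl)
  with q show "sphere x r - closure G \<noteq> {}" by blast
qed

end

section \<open>Winding numbers along detours\<close>

lemma winding_number_continuous_log:
  assumes "path p" and l: "continuous_on {0..1} l"
    and pl: "\<And>t. t \<in> {0..1} \<Longrightarrow> p t = z + exp (l t)"
  shows "winding_number p z = (l 1 - l 0) / (2 * of_real pi * \<i>)"
proof -
  have "z \<notin> path_image p"
    using pl by (auto simp: path_image_def)
  then obtain q where q: "path q"
      "pathfinish q - pathstart q = 2 * of_real pi * \<i> * winding_number p z"
      "\<And>t. t \<in> {0..1} \<Longrightarrow> p t = z + exp (q t)"
    using winding_number_as_continuous_log[OF \<open>path p\<close>] by metis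
  have *: "\<exists>n. q t - l t = of_real (2 * of_int n * pi) * \<i>" if "t \<in> {0..1}" for t
  proof -
    have "exp (q t) = exp (l t)"
      using q(3)[OF that] pl[OF that] by simp
    then obtain n where "q t = l t + of_real (2 * of_int n * pi) * \<i>"
      by (auto simp: exp_eq)
    then show ?thesis by auto
  qed
  have "(\<lambda>t. q t - l t) constant_on {0..1}"
  proof (rule continuous_discrete_range_constant)
    show "continuous_on {0..1} (\<lambda>t. q t - l t)"
      using q(1) l by (intro continuous_intros) (auto simp: path_def)
  next
    fix x :: real assume x: "x \<in> {0..1}"
    have "1 \<le> norm ((q y - l y) - (q x - l x))"
      if y: "y \<in> {0..1}" "q y - l y \<noteq> q x - l x" for y
    proof -
      obtain m n where mn: "q y - l y = of_real (2 * of_int m * pi) * \<i>"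
          "q x - l x = of_real (2 * of_int n * pi) * \<i>"
        using * x y(1) by meson
      then have "m \<noteq> n" using y(2) by auto
      have "(q y - l y) - (q x - l x) = of_real (2 * pi * of_int (m - n)) * \<i>"
        unfolding mn by (simp add: algebra_simps)
      then have "norm ((q y - l y) - (q x - l x)) = 2 * pi * \<bar>of_int (m - n)\<bar>"
        by (simp only: norm_mult norm_of_real abs_mult norm_ii) simp
      also have "\<dots> \<ge> 2 * pi * 1"
        using \<open>m \<noteq> n\<close> by (intro mult_left_mono) auto
      finally show ?thesis using pi_gt3 by linarith
    qed
    then show "\<exists>e>0. \<forall>y. y \<in> {0..1} \<and> q y - l y \<noteq> q x - l x \<longrightarrow> e \<le> norm ((q y - l y) - (q x - l x))"
      using zero_less_one by blast
  qed auto
  then have "q 1 - l 1 = q 0 - l 0"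
    unfolding constant_on_def by (metis atLeastAtMost_iff order_refl zero_le_one)
  then have "l 1 - l 0 = 2 * of_real pi * \<i> * winding_number p z"
    using q(2) by (simp add: pathfinish_def pathstart_def algebra_simps)
  then show ?thesis by simp
qed

text \<open>
  The loops \<open>g +++ c1\<close> and \<open>g +++ c2\<close> differ by a closed curve that does not wind around the
  points of \<open>K\<close>.  The first loop avoids \<open>N1\<close> and \<open>K\<close>, so its winding numbers about \<open>q\<close> and about
  points of \<open>K\<close> agree; the second loop avoids \<open>N2\<close> and \<open>K\<close>.  Hence the curve does not
  wind around \<open>q\<close> either.  In the applications it visibly winds once around \<open>q\<close>, so the lemma
  refutes that \<open>g\<close> closes up without meeting the barrier \<open>N1 \<union> K \<union> N2\<close>.
\<close>

lemma winding_number_detours_agree: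
  fixes K N1 N2 :: "complex set"
  assumes g: "path g" "pathstart g = u" "pathfinish g = v"
    and c1: "path c1" "pathstart c1 = v" "pathfinish c1 = u"
    and c2: "path c2" "pathstart c2 = v" "pathfinish c2 = u"
    and K: "connected K" "K \<inter> (path_image g \<union> path_image c1 \<union> path_image c2) = {}"
    and N1: "connected N1" "q \<in> N1" "closure N1 \<inter> K \<noteq> {}"
            "N1 \<inter> (path_image g \<union> path_image c1) = {}"
    and N2: "connected N2" "q \<in> N2" "closure N2 \<inter> K \<noteq> {}"
            "N2 \<inter> (path_image g \<union> path_image c2) = {}"
    and eq: "\<And>k. k \<in> K \<Longrightarrow> winding_number c1 k = winding_number c2 k"
  shows "winding_number c1 q = winding_number c2 q"
proof -
  have pg: "path (g +++ c)" "pathfinish (g +++ c) = pathstart (g +++ c)"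
      "path_image (g +++ c) = path_image g \<union> path_image c"
    if "path c" "pathstart c = v" "pathfinish c = u" for c
    using that g by (simp_all add: path_image_join)
  have loop: "winding_number (g +++ c) x = winding_number (g +++ c) y"
    if "path c" "pathstart c = v" "pathfinish c = u" "connected S" "x \<in> S" "y \<in> S"
       "S \<inter> (path_image g \<union> path_image c) = {}" for c S x y
    using winding_number_eq[OF pg(1,2)[OF that(1-3)] that(5,6,4)] pg(3)[OF that(1-3)] that(7) by simp
  have split: "winding_number (g +++ c) x = winding_number g x + winding_number c x"
    if "path c" "pathstart c = v" "pathfinish c = u" "x \<notin> path_image g" "x \<notin> path_image c" for c x
    using winding_number_join[OF g(1) that(4,1,5)] g(3) that(2) by simp
  have ins: "connected (insert k N)" if "connected N" "k \<in> closure N" for k :: complex and N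
    by (rule connected_intermediate_closure[OF that(1)]) (use that(2) closure_subset[of N] in auto)
  obtain k1 where k1: "k1 \<in> K" "k1 \<in> closure N1" using N1 by auto
  obtain k2 where k2: "k2 \<in> K" "k2 \<in> closure N2" using N2 by auto
  have q: "q \<notin> path_image g" "q \<notin> path_image c1" "q \<notin> path_image c2"
    using N1(2,4) N2(2,4) by blast+
  have kk: "k2 \<notin> path_image g" "k2 \<notin> path_image c1" "k2 \<notin> path_image c2"
    using k2 K(2) by blast+
  have i1: "insert k1 N1 \<inter> (path_image g \<union> path_image c1) = {}"
    using k1(1) N1(4) K(2) by blast
  have i2: "insert k2 N2 \<inter> (path_image g \<union> path_image c2) = {}"
    using k2(1) N2(4) K(2) by blast
  have i3: "K \<inter> (path_image g \<union> path_image c1) = {}"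
    using K(2) by blast
  have "winding_number g q + winding_number c1 q = winding_number (g +++ c1) q"
    using split[OF c1 q(1,2)] by simp
  also have "\<dots> = winding_number (g +++ c1) k1"
    by (rule loop[OF c1 ins[OF N1(1) k1(2)] _ _ i1]) (use N1(2) in simp_all)
  also have "\<dots> = winding_number (g +++ c1) k2"
    by (rule loop[OF c1 K(1) k1(1) k2(1) i3])
  also have "\<dots> = winding_number (g +++ c2) k2"
    using split[OF c1 kk(1,2)] split[OF c2 kk(1,3)] eq[OF k2(1)] by simp
  also have "\<dots> = winding_number (g +++ c2) q"
    by (rule loop[OF c2 ins[OF N2(1) k2(2)] _ _ i2]) (use N2(2) in simp_all)
  also have "\<dots> = winding_number g q + winding_number c2 q"
    using split[OF c2 q(1,3)] by simp
  finally show ?thesis by simp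
qed

section \<open>Impressions of boundary points of the disk\<close>

text \<open>
  A separation of the image splits no fibre, so it induces a separation of \<open>S\<close>; compactness of
  \<open>R\<close> makes the two parts of \<open>S\<close> closed.
\<close>

lemma connected_Image_of_connected_fibres:
  fixes R :: "('a::heine_borel \<times> 'b::heine_borel) set"
  assumes R: "compact R" and S: "closed S" "connected S"
    and fib: "\<And>s. s \<in> S \<Longrightarrow> connected (R `` {s})" "\<And>s. s \<in> S \<Longrightarrow> R `` {s} \<noteq> {}"
  shows "connected (R `` S)"
proof (rule ccontr)
  assume "\<not> connected (R `` S)"
  then obtain P Q where PQ: "closed P" "closed Q" "R `` S \<subseteq> P \<union> Q" "P \<inter> Q \<inter> R `` S = {}"
      "P \<inter> R `` S \<noteq> {}" "Q \<inter> R `` S \<noteq> {}"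
    unfolding connected_closed by blast
  define U where "U = fst ` (R \<inter> S \<times> P)"
  define V where "V = fst ` (R \<inter> S \<times> Q)"
  have "compact (R \<inter> S \<times> P)" "compact (R \<inter> S \<times> Q)"
    using R S PQ by (auto intro!: compact_Int_closed closed_Times)
  then have "closed U" "closed V" unfolding U_def V_def
    by (auto intro!: compact_imp_closed compact_continuous_image continuous_intros)
  moreover have "S \<subseteq> U \<union> V"
  proof
    fix s assume s: "s \<in> S"
    with fib obtain x where "(s, x) \<in> R" by blast
    with s PQ(3) show "s \<in> U \<union> V" by (force simp: U_def V_def)
  qed
  moreover have "U \<inter> S \<noteq> {}" "V \<inter> S \<noteq> {}" using PQ(5,6) by (force simp: U_def V_def)+
  moreover have "U \<inter> V \<inter> S = {}"
  proof (rule ccontr)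
    assume "U \<inter> V \<inter> S \<noteq> {}"
    then obtain s x y where s: "s \<in> S" "(s, x) \<in> R" "x \<in> P" "(s, y) \<in> R" "y \<in> Q"
      by (auto simp: U_def V_def)
    have "R `` {s} \<subseteq> P \<union> Q" "P \<inter> Q \<inter> R `` {s} = {}" using PQ s by blast+
    moreover have "P \<inter> R `` {s} \<noteq> {}" "Q \<inter> R `` {s} \<noteq> {}" using s by blast+
    ultimately show False
      using fib(1)[OF s(1)] PQ(1,2) unfolding connected_closed by blast
  qed
  ultimately show False
    using S(2) unfolding connected_closed by blast
qed

text \<open>
  The closure of the graph of \<open>\<phi>\<close> consists of the graph and of the pairs \<open>(\<zeta>, x)\<close> with
  \<open>x\<close> in the impression of the prime end at \<open>\<zeta>\<close>.  Semicontinuity of impressions becomes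
  compactness of this one set.
\<close>

definition boundary_graph :: "(complex \<Rightarrow> complex) \<Rightarrow> (complex \<times> complex) set" where
  "boundary_graph \<phi> = closure ((\<lambda>z. (z, \<phi> z)) ` ball 0 1)"

abbreviation impression :: "(complex \<Rightarrow> complex) \<Rightarrow> complex set \<Rightarrow> complex set" where
  "impression \<phi> S \<equiv> boundary_graph \<phi> `` S"

lemma boundary_graph_sequential:
  "(\<zeta>, x) \<in> boundary_graph \<phi> \<longleftrightarrow>
     (\<exists>z. (\<forall>n. z n \<in> ball 0 1) \<and> z \<longlonglongrightarrow> \<zeta> \<and> (\<lambda>n. \<phi> (z n)) \<longlonglongrightarrow> x)"
proof
  assume "(\<zeta>, x) \<in> boundary_graph \<phi>"
  then obtain p where p: "\<And>n. p n \<in> (\<lambda>z. (z, \<phi> z)) ` ball 0 1" "p \<longlonglongrightarrow> (\<zeta>, x)"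
    unfolding boundary_graph_def closure_sequential by blast
  have "\<And>n. fst (p n) \<in> ball 0 1 \<and> snd (p n) = \<phi> (fst (p n))"
  proof
    fix n show "fst (p n) \<in> ball 0 1" "snd (p n) = \<phi> (fst (p n))" using p(1)[of n] by auto
  qed
  moreover have "(\<lambda>n. fst (p n)) \<longlonglongrightarrow> \<zeta>" "(\<lambda>n. snd (p n)) \<longlonglongrightarrow> x"
    using tendsto_fst[OF p(2)] tendsto_snd[OF p(2)] by simp_all
  ultimately show "\<exists>z. (\<forall>n. z n \<in> ball 0 1) \<and> z \<longlonglongrightarrow> \<zeta> \<and> (\<lambda>n. \<phi> (z n)) \<longlonglongrightarrow> x"
    by (intro exI[of _ "\<lambda>n. fst (p n)"]) auto
next
  assume "\<exists>z. (\<forall>n. z n \<in> ball 0 1) \<and> z \<longlonglongrightarrow> \<zeta> \<and> (\<lambda>n. \<phi> (z n)) \<longlonglongrightarrow> x"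
  then obtain z where "\<forall>n. z n \<in> ball 0 1" "z \<longlonglongrightarrow> \<zeta>" "(\<lambda>n. \<phi> (z n)) \<longlonglongrightarrow> x" by blast
  then show "(\<zeta>, x) \<in> boundary_graph \<phi>"
    unfolding boundary_graph_def closure_sequential
    by (intro exI[of _ "\<lambda>n. (z n, \<phi> (z n))"]) (auto intro: tendsto_Pair)
qed

lemma boundary_graph_sequentialE:
  assumes "(\<zeta>, x) \<in> boundary_graph \<phi>"
  obtains z where "\<forall>n. z n \<in> ball 0 1" "z \<longlonglongrightarrow> \<zeta>" "(\<lambda>n. \<phi> (z n)) \<longlonglongrightarrow> x"
  using assms boundary_graph_sequential by blast

lemma boundary_graph_approachable_iff:
  "(\<zeta>, x) \<in> boundary_graph \<phi> \<longleftrightarrow>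
     (\<forall>e>0. \<exists>z\<in>ball 0 1. dist z \<zeta> < e \<and> dist (\<phi> z) x < e)"
proof
  assume "(\<zeta>, x) \<in> boundary_graph \<phi>"
  then have *: "\<forall>e>0. \<exists>z\<in>ball 0 1. dist (z, \<phi> z) (\<zeta>, x) < e"
    by (simp add: boundary_graph_def closure_approachable)
  show "\<forall>e>0. \<exists>z\<in>ball 0 1. dist z \<zeta> < e \<and> dist (\<phi> z) x < e"
    using * dist_fst_le[of "(_, _)" "(\<zeta>, x)"] dist_snd_le[of "(_, _)" "(\<zeta>, x)"]
    by (metis fst_conv snd_conv le_less_trans)
next
  assume *: "\<forall>e>0. \<exists>z\<in>ball 0 1. dist z \<zeta> < e \<and> dist (\<phi> z) x < e"
  have "\<exists>z\<in>ball 0 1. dist (z, \<phi> z) (\<zeta>, x) < e" if "0 < e" for e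
  proof -
    have "0 < e / 2" using that by simp
    then obtain z where z: "z \<in> ball 0 1" "dist z \<zeta> < e / 2" "dist (\<phi> z) x < e / 2"
      using * by blast
    have "dist (z, \<phi> z) (\<zeta>, x) \<le> dist z \<zeta> + dist (\<phi> z) x"
      unfolding dist_Pair_Pair by (rule sqrt_sum_squares_le_sum) auto
    then show ?thesis using z by (intro bexI[of _ z]) auto
  qed
  then show "(\<zeta>, x) \<in> boundary_graph \<phi>"
    by (simp add: boundary_graph_def closure_approachable)
qed

lemma boundary_graph_approachable:
  assumes "(\<zeta>, x) \<in> boundary_graph \<phi>" "0 < e"
  obtains z where "z \<in> ball 0 1" "dist z \<zeta> < e" "dist (\<phi> z) x < e"
  using assms boundary_graph_approachable_iff by blast

locale disk_chart =
  fixes \<phi> :: "complex \<Rightarrow> complex" and G :: "complex set"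
  assumes holo: "\<phi> holomorphic_on ball 0 1"
    and bij: "bij_betw \<phi> (ball 0 1) G"
    and bounded: "bounded G"
begin

lemma inj: "inj_on \<phi> (ball 0 1)" and image: "\<phi> ` ball 0 1 = G"
  using bij by (auto simp: bij_betw_def)

lemma cont: "continuous_on (ball 0 1) \<phi>"
  using holo by (rule holomorphic_on_imp_continuous_on)

lemma open_G: "open G"
  using open_mapping_thm3[OF holo open_ball inj] image by simp

lemma connected_G: "connected G"
  using connected_continuous_image[OF cont] image by auto

definition inv_chart :: "complex \<Rightarrow> complex" where
  "inv_chart = inv_into (ball 0 1) \<phi>"

lemma inv_chart_in: "w \<in> G \<Longrightarrow> inv_chart w \<in> ball 0 1"
  unfolding inv_chart_def image[symmetric] by (rule inv_into_into)

lemma chart_inv: "w \<in> G \<Longrightarrow> \<phi> (inv_chart w) = w"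
  unfolding inv_chart_def image[symmetric] by (rule f_inv_into_f)

lemma inv_chart: "z \<in> ball 0 1 \<Longrightarrow> inv_chart (\<phi> z) = z"
  unfolding inv_chart_def by (rule inv_into_f_f[OF inj])

lemma inv_chart_holomorphic: "inv_chart holomorphic_on G"
proof -
  obtain g where g: "g holomorphic_on (\<phi> ` ball 0 1)" "\<And>z. z \<in> ball 0 1 \<Longrightarrow> g (\<phi> z) = z"
    using holomorphic_has_inverse[OF holo open_ball inj] by metis
  have "g w = inv_chart w" if "w \<in> G" for w
    using g(2)[OF inv_chart_in[OF that]] chart_inv[OF that] by simp
  with g(1)[unfolded image] show ?thesis by (rule holomorphic_transform)
qed

lemma inv_chart_cont: "continuous_on G inv_chart"
  using inv_chart_holomorphic by (rule holomorphic_on_imp_continuous_on)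

lemma compact_boundary_graph: "compact (boundary_graph \<phi>)"
proof -
  have "(\<lambda>z. (z, \<phi> z)) ` ball 0 1 \<subseteq> ball 0 1 \<times> G" using image by auto
  then have "bounded ((\<lambda>z. (z, \<phi> z)) ` ball 0 1)"
    using bounded_subset[OF bounded_Times[OF bounded_ball bounded]] by blast
  then show ?thesis unfolding boundary_graph_def by (simp add: compact_closure)
qed

lemma closed_boundary_graph: "closed (boundary_graph \<phi>)"
  using compact_boundary_graph by (rule compact_imp_closed)

lemma graph_subset: "z \<in> ball 0 1 \<Longrightarrow> (z, \<phi> z) \<in> boundary_graph \<phi>"
  unfolding boundary_graph_def by (rule closure_subset[THEN subsetD, OF imageI])

lemma boundary_graph_domain: "(\<zeta>, x) \<in> boundary_graph \<phi> \<Longrightarrow> \<zeta> \<in> cball 0 1 \<and> x \<in> closure G"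
proof -
  assume "(\<zeta>, x) \<in> boundary_graph \<phi>"
  moreover have "boundary_graph \<phi> \<subseteq> closure (ball 0 1 \<times> G)"
    unfolding boundary_graph_def using image by (intro closure_mono) auto
  ultimately show ?thesis by (auto simp: closure_Times)
qed

text \<open>
  Over the open disk the closure adds nothing to the graph, since both \<open>\<phi>\<close> and its inverse
  are continuous.
\<close>

lemma boundary_graph_interior:
  assumes "(\<zeta>, x) \<in> boundary_graph \<phi>"
  shows "\<zeta> \<in> ball 0 1 \<longleftrightarrow> x \<in> G" "\<zeta> \<in> ball 0 1 \<Longrightarrow> x = \<phi> \<zeta>"
proof -
  obtain z where z: "\<forall>n. z n \<in> ball 0 1" "z \<longlonglongrightarrow> \<zeta>" "(\<lambda>n. \<phi> (z n)) \<longlonglongrightarrow> x"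
    by (rule boundary_graph_sequentialE[OF assms])
  show 1: "x = \<phi> \<zeta>" if "\<zeta> \<in> ball 0 1"
  proof -
    have "(\<lambda>n. \<phi> (z n)) \<longlonglongrightarrow> \<phi> \<zeta>"
      using z that cont by (intro continuous_on_tendsto_compose[OF cont]) auto
    then show ?thesis using z(3) LIMSEQ_unique by blast
  qed
  have "\<zeta> \<in> ball 0 1" if "x \<in> G"
  proof -
    have "\<forall>n. \<phi> (z n) \<in> G" using z(1) image by blast
    then have "(\<lambda>n. inv_chart (\<phi> (z n))) \<longlonglongrightarrow> inv_chart x"
      using z(3) that by (intro continuous_on_tendsto_compose[OF inv_chart_cont]) auto
    then have "z \<longlonglongrightarrow> inv_chart x" using z(1) inv_chart by simp
    then have "\<zeta> = inv_chart x" using z(2) LIMSEQ_unique by blast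
    then show ?thesis using inv_chart_in[OF that] by simp
  qed
  with 1 image show "\<zeta> \<in> ball 0 1 \<longleftrightarrow> x \<in> G" by blast
qed

lemma boundary_graph_frontier:
  assumes "(\<zeta>, x) \<in> boundary_graph \<phi>" "norm \<zeta> = 1"
  shows "x \<in> frontier G"
  using boundary_graph_domain[OF assms(1)] boundary_graph_interior[OF assms(1)] assms(2) open_G
  by (auto simp: frontier_def interior_open)

lemma boundary_graph_projections:
  "fst ` boundary_graph \<phi> = cball 0 1" "snd ` boundary_graph \<phi> = closure G"
proof -
  have "closed (fst ` boundary_graph \<phi>)" "closed (snd ` boundary_graph \<phi>)"
    by (intro compact_imp_closed compact_continuous_image compact_boundary_graph continuous_intros)+
  moreover have "ball 0 1 \<subseteq> fst ` boundary_graph \<phi>" "G \<subseteq> snd ` boundary_graph \<phi>"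
    using graph_subset image by force+
  ultimately have "closure (ball 0 1) \<subseteq> fst ` boundary_graph \<phi>" "closure G \<subseteq> snd ` boundary_graph \<phi>"
    by (simp_all only: closure_minimal)
  moreover have "fst ` boundary_graph \<phi> \<subseteq> cball 0 1" "snd ` boundary_graph \<phi> \<subseteq> closure G"
    using boundary_graph_domain by fastforce+
  ultimately show "fst ` boundary_graph \<phi> = cball 0 1" "snd ` boundary_graph \<phi> = closure G"
    by auto
qed

lemma boundary_graph_onto:
  assumes "x \<in> frontier G"
  obtains \<zeta> where "norm \<zeta> = 1" "(\<zeta>, x) \<in> boundary_graph \<phi>"
proof -
  have "x \<in> closure G" "x \<notin> G" using assms open_G by (auto simp: frontier_def interior_open)
  then obtain \<zeta> where z: "(\<zeta>, x) \<in> boundary_graph \<phi>"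
    unfolding boundary_graph_projections(2)[symmetric] by auto
  have "\<zeta> \<in> cball 0 1" "\<zeta> \<notin> ball 0 1"
    using boundary_graph_domain[OF z] boundary_graph_interior(1)[OF z] \<open>x \<notin> G\<close> by blast+
  then have "norm \<zeta> = 1" by auto
  with z that show thesis by blast
qed

lemma impression_subset: "S \<subseteq> sphere 0 1 \<Longrightarrow> impression \<phi> S \<subseteq> frontier G"
  using boundary_graph_frontier by auto

lemma impression_sphere: "impression \<phi> (sphere 0 1) = frontier G"
proof
  show "frontier G \<subseteq> impression \<phi> (sphere 0 1)"
  proof
    fix x assume "x \<in> frontier G"
    then show "x \<in> impression \<phi> (sphere 0 1)"
      by (rule boundary_graph_onto) auto
  qed
qed (simp add: impression_subset)

lemma closed_impression:
  assumes "closed S"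
  shows "closed (impression \<phi> S)"
proof -
  have "impression \<phi> S = snd ` (boundary_graph \<phi> \<inter> S \<times> UNIV)" by force
  moreover have "compact (boundary_graph \<phi> \<inter> S \<times> UNIV)"
    using assms compact_boundary_graph by (auto intro!: compact_Int_closed closed_Times)
  ultimately show ?thesis
    by (auto intro!: compact_imp_closed compact_continuous_image continuous_intros)
qed

lemma impression_nonempty: "\<zeta> \<in> cball 0 1 \<Longrightarrow> impression \<phi> {\<zeta>} \<noteq> {}"
  unfolding boundary_graph_projections(1)[symmetric] by auto

text \<open>
  The impression is the intersection of the decreasing sequence of continua
  \<open>closure (\<phi> ` (ball 0 1 \<inter> ball \<zeta> (1/n)))\<close>.
\<close>

lemma connected_impression_point: "connected (impression \<phi> {\<zeta>})"
proof -
  define C where "C n = closure (\<phi> ` (ball 0 1 \<inter> ball \<zeta> (inverse (real (Suc n)))))" for n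
  have "impression \<phi> {\<zeta>} = \<Inter> (range C)"
  proof (intro subset_antisym subsetI)
    fix x assume "x \<in> impression \<phi> {\<zeta>}"
    then have *: "(\<zeta>, x) \<in> boundary_graph \<phi>" by simp
    have "x \<in> C n" for n
      unfolding C_def closure_approachable
    proof (intro allI impI)
      fix e :: real assume "e > 0"
      then have "0 < min e (inverse (real (Suc n)))" by simp
      then obtain z where "z \<in> ball 0 1" "dist z \<zeta> < min e (inverse (real (Suc n)))"
          "dist (\<phi> z) x < min e (inverse (real (Suc n)))"
        using boundary_graph_approachable[OF *] by blast
      then show "\<exists>y\<in>\<phi> ` (ball 0 1 \<inter> ball \<zeta> (inverse (real (Suc n)))). dist y x < e"
        by (intro bexI[of _ "\<phi> z"]) (auto simp: dist_commute)
    qed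
    then show "x \<in> \<Inter> (range C)" by blast
  next
    fix x assume x: "x \<in> \<Inter> (range C)"
    have "\<exists>z\<in>ball 0 1. dist z \<zeta> < e \<and> dist (\<phi> z) x < e" if e: "0 < e" for e
    proof -
      obtain n where n: "inverse (real (Suc n)) < e" using reals_Archimedean[OF e] by blast
      have "x \<in> C n" using x by blast
      then obtain y where "y \<in> \<phi> ` (ball 0 1 \<inter> ball \<zeta> (inverse (real (Suc n))))" "dist y x < e"
        unfolding C_def closure_approachable using e by blast
      then show ?thesis using n by (force simp: dist_commute)
    qed
    then show "x \<in> impression \<phi> {\<zeta>}" by (simp add: boundary_graph_approachable_iff)
  qed
  moreover have "connected (\<Inter> (range C))"
  proof (rule connected_nest)
    fix n
    have sub: "\<phi> ` (ball 0 1 \<inter> ball \<zeta> (inverse (real (Suc n)))) \<subseteq> G" using image by blast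
    show "compact (C n)" unfolding C_def
      using bounded_subset[OF bounded sub] by (simp add: compact_closure)
    show "connected (C n)" unfolding C_def
      by (intro connected_imp_connected_closure connected_continuous_image
            continuous_on_subset[OF cont] convex_connected convex_Int convex_ball) auto
  next
    fix m n :: nat assume "m \<le> n"
    then have "inverse (real (Suc n)) \<le> inverse (real (Suc m))" by (intro le_imp_inverse_le) auto
    then show "C n \<subseteq> C m" unfolding C_def
      by (intro closure_mono image_mono Int_mono subset_ball order_refl)
  qed
  ultimately show ?thesis by simp
qed

lemma connected_impression:
  assumes "closed S" "connected S" "S \<subseteq> cball 0 1"
  shows "connected (impression \<phi> S)"
  by (rule connected_Image_of_connected_fibres[OF compact_boundary_graph assms(1,2)
        connected_impression_point impression_nonempty]) (use assms(3) in blast)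

end

section \<open>Transport of impressions by the rotation\<close>

lemma rotate_arc: "(*) (cis t) ` (cis ` {a..b}) = cis ` {a + t..b + t}"
proof -
  have "(*) (cis t) ` (cis ` {a..b}) = cis ` ((\<lambda>x. x + t) ` {a..b})"
    unfolding image_image cis_mult by (simp only: add.commute)
  also have "(\<lambda>x. x + t) ` {a..b} = {a + t..b + t}"
    using image_add_atLeastAtMost'[of t a b] by (simp add: add.commute)
  finally show ?thesis .
qed

text \<open>
  Kronecker's theorem, stated so that the approximating angles converge as real numbers and not
  only modulo a full turn.
\<close>

lemma irrational_rotation_dense:
  assumes "\<theta> \<notin> \<rat>"
  obtains \<alpha> :: "nat \<Rightarrow> real" where "\<alpha> \<longlonglongrightarrow> t" "\<And>j. \<exists>n::nat. cis (\<alpha> j) = cis (2 * pi * \<theta>) ^ n"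
proof -
  define f where "f = frac (t / (2 * pi))"
  have f: "0 \<le> f" "f \<le> 1" unfolding f_def by (simp_all add: less_imp_le frac_lt_1)
  have "\<exists>k. \<bar>frac (real k * \<theta>) - f\<bar> < inverse (real (Suc j))" for j
    using Kronecker_approx_1_explicit[OF assms f, of "inverse (real (Suc j))"] by (metis inverse_positive_iff_positive of_nat_0_less_iff zero_less_Suc)
  then obtain k where k: "\<And>j. \<bar>frac (real (k j) * \<theta>) - f\<bar> < inverse (real (Suc j))" by metis
  define \<alpha> where "\<alpha> j = 2 * pi * (frac (real (k j) * \<theta>) + of_int \<lfloor>t / (2 * pi)\<rfloor>)" for j
  have "(\<lambda>j. frac (real (k j) * \<theta>)) \<longlonglongrightarrow> f"
    unfolding tendsto_dist_iff[of _ f]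
    by (rule tendsto_sandwich[OF _ _ tendsto_const LIMSEQ_inverse_real_of_nat])
       (use k in \<open>auto simp: dist_real_def intro!: always_eventually less_imp_le\<close>)
  then have "\<alpha> \<longlonglongrightarrow> 2 * pi * (f + of_int \<lfloor>t / (2 * pi)\<rfloor>)"
    unfolding \<alpha>_def by (intro tendsto_intros)
  also have "2 * pi * (f + of_int \<lfloor>t / (2 * pi)\<rfloor>) = t"
    by (simp add: f_def frac_def)
  finally have "\<alpha> \<longlonglongrightarrow> t" .
  moreover have "cis (\<alpha> j) = cis (2 * pi * \<theta>) ^ k j" for j
  proof -
    have "\<alpha> j = real (k j) * (2 * pi * \<theta>) + 2 * pi * of_int (\<lfloor>t / (2 * pi)\<rfloor> - \<lfloor>real (k j) * \<theta>\<rfloor>)"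
      by (simp add: \<alpha>_def frac_def algebra_simps)
    then have "cis (\<alpha> j) = cis (real (k j) * (2 * pi * \<theta>)) * cis (2 * pi * of_int (\<lfloor>t / (2 * pi)\<rfloor> - \<lfloor>real (k j) * \<theta>\<rfloor>))"
      by (simp only: cis_mult)
    also have "cis (2 * pi * of_int (\<lfloor>t / (2 * pi)\<rfloor> - \<lfloor>real (k j) * \<theta>\<rfloor>)) = 1"
      by (rule cis_multiple_2pi) auto
    also have "cis (real (k j) * (2 * pi * \<theta>)) * 1 = cis (2 * pi * \<theta>) ^ k j"
      unfolding mult_1_right by (rule Complex.DeMoivre[symmetric])
    finally show ?thesis .
  qed
  ultimately show thesis by (intro that) auto
qed

context disk_chart begin

text \<open>
  This is the upper semicontinuity of impressions, for arcs with moving end points.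
\<close>

lemma impression_arc_limit:
  assumes "\<And>j. x \<in> impression \<phi> (cis ` {a j..b j})" and a: "a \<longlonglongrightarrow> a'" and b: "b \<longlonglongrightarrow> b'"
  shows "x \<in> impression \<phi> (cis ` {a'..b'})"
proof -
  have "\<forall>j. \<exists>s. a j \<le> s \<and> s \<le> b j \<and> (cis s, x) \<in> boundary_graph \<phi>" using assms(1) by force
  then obtain s where s: "\<And>j. a j \<le> s j" "\<And>j. s j \<le> b j" "\<And>j. (cis (s j), x) \<in> boundary_graph \<phi>" by metis
  have "bounded (range a)" "bounded (range b)" using a b by (simp_all add: convergent_imp_bounded)
  then obtain A B where "\<And>j. \<bar>a j\<bar> \<le> A" "\<And>j. \<bar>b j\<bar> \<le> B"
    unfolding bounded_iff by (auto simp: real_norm_def)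
  then have "\<forall>j. s j \<in> {-A..B}" using s by (smt (verit) atLeastAtMost_iff)
  then obtain l r where r: "strict_mono r" "(s \<circ> r) \<longlonglongrightarrow> l"
    using compact_Icc[of "-A" B] unfolding compact_def by blast
  have "a' \<le> l"
    by (rule LIMSEQ_le[OF LIMSEQ_subseq_LIMSEQ[OF a r(1)] r(2)]) (use s in auto)
  moreover have "l \<le> b'"
    by (rule LIMSEQ_le[OF r(2) LIMSEQ_subseq_LIMSEQ[OF b r(1)]]) (use s in auto)
  moreover have "(cis l, x) \<in> boundary_graph \<phi>"
  proof (rule closed_sequentially[OF closed_boundary_graph])
    have "continuous_on UNIV cis" by (intro continuous_intros)
    then have "(\<lambda>j. cis ((s \<circ> r) j)) \<longlonglongrightarrow> cis l"
      by (rule continuous_on_tendsto_compose[OF _ r(2)]) auto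
    then show "(\<lambda>j. (cis ((s \<circ> r) j), x)) \<longlonglongrightarrow> (cis l, x)" by (rule tendsto_Pair[OF _ tendsto_const])
  qed (use s in auto)
  ultimately show ?thesis by auto
qed

end

locale rotating_chart = disk_chart +
  fixes F :: "complex \<Rightarrow> complex" and \<theta> :: real
  assumes contF: "continuous_on (closure G) F"
    and conj: "\<And>z. z \<in> ball 0 1 \<Longrightarrow> F (\<phi> z) = \<phi> (cis (2 * pi * \<theta>) * z)"
    and irrational: "\<theta> \<notin> \<rat>"
begin

text \<open>
  One inclusion is continuity of \<open>F\<close>; for the other a subsequence of the rotated-back points has
  convergent images by compactness of \<open>closure G\<close>.
\<close>

lemma impression_rotate: "impression \<phi> ((*) (cis (2 * pi * \<theta>)) ` S) = F ` impression \<phi> S"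
proof -
  let ?c = "cis (2 * pi * \<theta>)"
  have c: "?c * z \<in> ball 0 1" if "z \<in> ball 0 1" for z
    using that by (simp add: norm_mult)
  have 1: "(?c * \<zeta>, F x) \<in> boundary_graph \<phi>" if zx: "(\<zeta>, x) \<in> boundary_graph \<phi>" for \<zeta> x
  proof -
    obtain z where z: "\<forall>n. z n \<in> ball 0 1" "z \<longlonglongrightarrow> \<zeta>" "(\<lambda>n. \<phi> (z n)) \<longlonglongrightarrow> x"
      by (rule boundary_graph_sequentialE[OF zx])
    have "x \<in> closure G" using boundary_graph_domain[OF zx] by simp
    moreover have "\<forall>n. \<phi> (z n) \<in> closure G" using z(1) image closure_subset by blast
    ultimately have "(\<lambda>n. F (\<phi> (z n))) \<longlonglongrightarrow> F x"
      using z(3) by (intro continuous_on_tendsto_compose[OF contF]) auto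
    then have "(\<lambda>n. \<phi> (?c * z n)) \<longlonglongrightarrow> F x" using conj z(1) by simp
    moreover have "(\<lambda>n. ?c * z n) \<longlonglongrightarrow> ?c * \<zeta>" using z(2) by (intro tendsto_intros)
    ultimately show ?thesis
      unfolding boundary_graph_sequential using z(1) c by (intro exI[of _ "\<lambda>n. ?c * z n"]) simp
  qed
  have 2: "\<exists>x. (\<zeta>, x) \<in> boundary_graph \<phi> \<and> y = F x" if zy: "(?c * \<zeta>, y) \<in> boundary_graph \<phi>" for \<zeta> y
  proof -
    obtain z where z: "\<forall>n. z n \<in> ball 0 1" "z \<longlonglongrightarrow> ?c * \<zeta>" "(\<lambda>n. \<phi> (z n)) \<longlonglongrightarrow> y"
      by (rule boundary_graph_sequentialE[OF zy])
    define w where "w n = inverse ?c * z n" for n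
    have wb: "w n \<in> ball 0 1" for n using z(1) by (simp add: w_def norm_mult norm_inverse)
    have cw: "?c * w n = z n" for n by (simp add: w_def cis_mult)
    have "w \<longlonglongrightarrow> inverse ?c * (?c * \<zeta>)" unfolding w_def using z(2) by (intro tendsto_intros)
    then have wl: "w \<longlonglongrightarrow> \<zeta>" by (simp add: mult.assoc[symmetric] cis_mult)
    have "compact (closure G)" using bounded by (simp add: compact_closure)
    moreover have wG: "\<phi> (w n) \<in> closure G" for n using wb image closure_subset by blast
    ultimately obtain x r where r: "x \<in> closure G" "strict_mono r" "((\<lambda>n. \<phi> (w n)) \<circ> r) \<longlonglongrightarrow> x"
      unfolding compact_def by (metis (no_types, lifting))
    have "(\<lambda>n. F (((\<lambda>n. \<phi> (w n)) \<circ> r) n)) \<longlonglongrightarrow> F x"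
      by (rule continuous_on_tendsto_compose[OF contF r(3,1)]) (use wG in auto)
    moreover have "F (((\<lambda>n. \<phi> (w n)) \<circ> r) n) = ((\<lambda>n. \<phi> (z n)) \<circ> r) n" for n
      using conj[OF wb] cw by simp
    ultimately have "((\<lambda>n. \<phi> (z n)) \<circ> r) \<longlonglongrightarrow> F x"
      by (simp only:)
    with LIMSEQ_subseq_LIMSEQ[OF z(3) r(2)] have "y = F x"
      by (rule LIMSEQ_unique)
    moreover have "(\<zeta>, x) \<in> boundary_graph \<phi>"
      unfolding boundary_graph_sequential using wb r(3) LIMSEQ_subseq_LIMSEQ[OF wl r(2)]
      by (intro exI[of _ "w \<circ> r"]) (auto simp: o_def)
    ultimately show ?thesis by blast
  qed
  show ?thesis
  proof (intro subset_antisym subsetI)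
    fix y assume "y \<in> impression \<phi> ((*) ?c ` S)"
    then obtain \<zeta> where "\<zeta> \<in> S" "(?c * \<zeta>, y) \<in> boundary_graph \<phi>" by auto
    with 2 show "y \<in> F ` impression \<phi> S" by blast
  next
    fix y assume "y \<in> F ` impression \<phi> S"
    with 1 show "y \<in> impression \<phi> ((*) ?c ` S)" by blast
  qed
qed

lemma impression_rotate_power:
  "impression \<phi> ((*) (cis (2 * pi * \<theta>) ^ n) ` S) = (F ^^ n) ` impression \<phi> S"
proof (induction n)
  case (Suc n)
  have "(*) (cis (2 * pi * \<theta>) ^ Suc n) ` S = (*) (cis (2 * pi * \<theta>)) ` ((*) (cis (2 * pi * \<theta>) ^ n) ` S)"
    by (simp add: image_image mult.assoc)
  then show ?case
    using Suc.IH impression_rotate[of "(*) (cis (2 * pi * \<theta>) ^ n) ` S"] by (simp add: image_image)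
qed simp

text \<open>
  Every angle \<open>t\<close> is a limit of translations that some iterate of \<open>F\<close> realises on all arcs
  simultaneously.
\<close>

lemma impression_translates:
  obtains \<alpha> :: "nat \<Rightarrow> real" and n :: "nat \<Rightarrow> nat"
  where "\<alpha> \<longlonglongrightarrow> t" "\<And>j a b. impression \<phi> (cis ` {a + \<alpha> j..b + \<alpha> j}) = (F ^^ n j) ` impression \<phi> (cis ` {a..b})"
proof -
  obtain \<alpha> :: "nat \<Rightarrow> real" where \<alpha>: "\<alpha> \<longlonglongrightarrow> t" "\<And>j. \<exists>n::nat. cis (\<alpha> j) = cis (2 * pi * \<theta>) ^ n"
    using irrational_rotation_dense[OF irrational] by blast
  then obtain n :: "nat \<Rightarrow> nat" where n: "\<And>j. cis (\<alpha> j) = cis (2 * pi * \<theta>) ^ n j" by metis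
  have "impression \<phi> (cis ` {a + \<alpha> j..b + \<alpha> j}) = (F ^^ n j) ` impression \<phi> (cis ` {a..b})" for j a b
    using impression_rotate_power[of "n j" "cis ` {a..b}"] rotate_arc[of "\<alpha> j" a b] n[of j] by simp
  with \<alpha>(1) show thesis by (rule that)
qed

lemma funpow_frontier: "(F ^^ n) ` frontier G = frontier G"
proof -
  have "(*) (cis (2 * pi * \<theta>) ^ n) ` sphere 0 1 = sphere 0 1" (is "(*) ?c ` _ = _")
  proof -
    have c: "norm ?c = 1" by (simp add: norm_power)
    have "z \<in> (*) ?c ` sphere 0 1" if "z \<in> sphere 0 1" for z
    proof (rule image_eqI)
      have "?c \<noteq> 0" by simp
      then show "z = ?c * (inverse ?c * z)" by (simp add: mult.assoc[symmetric])
      show "inverse ?c * z \<in> sphere 0 1" using that c by (simp add: norm_mult norm_inverse)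
    qed
    then show ?thesis using c by (auto simp: norm_mult)
  qed
  then show ?thesis
    using impression_rotate_power[of n "sphere 0 1"] impression_sphere by simp
qed

text \<open>
  An iterate of \<open>F\<close> maps the frontier onto itself, so the equality holds for a dense set of
  translates, and then for all of them by semicontinuity.
\<close>

lemma full_arc_translate:
  assumes "impression \<phi> (cis ` {a..b}) = frontier G"
  shows "impression \<phi> (cis ` {a + t..b + t}) = frontier G"
proof
  show "impression \<phi> (cis ` {a + t..b + t}) \<subseteq> frontier G"
    by (rule impression_subset) auto
  show "frontier G \<subseteq> impression \<phi> (cis ` {a + t..b + t})"
  proof
    fix x assume x: "x \<in> frontier G"
    obtain \<alpha> :: "nat \<Rightarrow> real" and n :: "nat \<Rightarrow> nat" where \<alpha>: "\<alpha> \<longlonglongrightarrow> t"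
       "\<And>j a b. impression \<phi> (cis ` {a + \<alpha> j..b + \<alpha> j}) = (F ^^ n j) ` impression \<phi> (cis ` {a..b})"
      using impression_translates by blast
    have "x \<in> impression \<phi> (cis ` {a + \<alpha> j..b + \<alpha> j})" for j
      using \<alpha>(2)[of a j b] assms funpow_frontier x by simp
    then show "x \<in> impression \<phi> (cis ` {a + t..b + t})"
      by (rule impression_arc_limit) (use \<alpha>(1) in \<open>auto intro!: tendsto_intros\<close>)
  qed
qed

text \<open>
  Semicontinuity controls only the right-hand side of the inclusion.  The open interval of
  admissible \<open>s\<close> compensates for this: the iterates can be chosen to hit \<open>s + t\<close> exactly while
  the arc on the right converges.
\<close>

lemma inclusion_translate:
  assumes sub: "\<And>s. u < s \<Longrightarrow> s < v \<Longrightarrow> impression \<phi> {cis s} \<subseteq> impression \<phi> (cis ` {a..b})"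
    and s: "u < s" "s < v"
  shows "impression \<phi> {cis (s + t)} \<subseteq> impression \<phi> (cis ` {a + t..b + t})"
proof
  fix x assume x: "x \<in> impression \<phi> {cis (s + t)}"
  obtain \<alpha> :: "nat \<Rightarrow> real" and n :: "nat \<Rightarrow> nat" where \<alpha>: "\<alpha> \<longlonglongrightarrow> t"
     "\<And>j a b. impression \<phi> (cis ` {a + \<alpha> j..b + \<alpha> j}) = (F ^^ n j) ` impression \<phi> (cis ` {a..b})"
    using impression_translates by blast
  have lim: "(\<lambda>j. s + t - \<alpha> j) \<longlonglongrightarrow> s + t - t" using \<alpha>(1) by (intro tendsto_intros)
  have "eventually (\<lambda>j. u < s + t - \<alpha> j \<and> s + t - \<alpha> j < v) sequentially"
    using order_tendstoD[OF lim] s by (auto intro: eventually_conj)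
  then obtain N where N: "\<And>j. N \<le> j \<Longrightarrow> u < s + t - \<alpha> j \<and> s + t - \<alpha> j < v"
    unfolding eventually_sequentially by blast
  have "x \<in> impression \<phi> (cis ` {a + \<alpha> (j + N)..b + \<alpha> (j + N)})" for j
  proof -
    let ?s = "s + t - \<alpha> (j + N)"
    have "impression \<phi> {cis (s + t)} = (F ^^ n (j + N)) ` impression \<phi> {cis ?s}"
      using \<alpha>(2)[of ?s "j + N" ?s] by simp
    also have "\<dots> \<subseteq> (F ^^ n (j + N)) ` impression \<phi> (cis ` {a..b})"
      using sub[of ?s] N[of "j + N"] by (intro image_mono) auto
    also have "\<dots> = impression \<phi> (cis ` {a + \<alpha> (j + N)..b + \<alpha> (j + N)})"
      using \<alpha>(2) by simp
    finally show ?thesis using x by blast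
  qed
  then show "x \<in> impression \<phi> (cis ` {a + t..b + t})"
    by (rule impression_arc_limit) (use LIMSEQ_ignore_initial_segment[OF \<alpha>(1), of N] in \<open>auto intro!: tendsto_intros\<close>)
qed

end

section \<open>Rays as barriers\<close>

lemma cis_eqD:
  assumes "cis a = cis b" "\<bar>a - b\<bar> < 2 * pi"
  shows "a = b"
proof -
  have "cis (a - b) = 1" using assms(1) by (simp add: cis_divide[symmetric])
  then have "cos (a - b) = 1" by (simp add: complex_eq_iff)
  then obtain n :: int where n: "a - b = of_int n * 2 * pi" by (auto simp: cos_one_2pi_int)
  then have "\<bar>of_int n\<bar> * (2 * pi) < 1 * (2 * pi)" using assms(2) by (simp add: abs_mult mult.assoc)
  then have "\<bar>of_int n :: real\<bar> < 1" by (simp only: mult_less_cancel_right) (use pi_gt_zero in linarith)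
  then have "n = 0" by linarith
  then show ?thesis using n by simp
qed

lemma rays_disjoint:
  assumes "of_real r * cis a = of_real s * cis b" "0 < s" "0 \<le> r" "\<bar>a - b\<bar> < 2 * pi"
  shows "a = b"
proof -
  have "norm (of_real r * cis a) = norm (of_real s * cis b)" using assms(1) by simp
  then have "r = s" using assms(2,3) by (simp add: norm_mult)
  then have "cis a = cis b" using assms(1,2) by simp
  then show ?thesis using assms(4) by (rule cis_eqD)
qed

lemma radius_between:
  fixes r s t :: real
  assumes "0 < r" "r < 1" "0 < s" "s < 1" "t \<in> {0..1}"
  shows "0 < r + (s - r) * t \<and> r + (s - r) * t < 1"
  using convexD[OF convex_real_interval(8)[of 0 1], of r s "1 - t" t] assms by (simp add: algebra_simps)

lemma sector_contains_ball:
  assumes "c < e" "e < c'"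
  obtains d where "0 < d"
    "\<And>v. dist v (cis e) < d \<Longrightarrow> \<exists>r s. 0 < r \<and> c < s \<and> s < c' \<and> v = of_real r * cis s"
proof -
  have "isCont Arg 1" by (rule continuous_at_Arg) auto
  then obtain d where d: "0 < d" "\<And>u. dist u 1 < d \<Longrightarrow> dist (Arg u) (Arg 1) < min (e - c) (c' - e)"
    using assms unfolding continuous_at_eps_delta by (metis diff_gt_0_iff_gt min_less_iff_conj)
  show thesis
  proof (rule that[of "min d 1"])
    show "0 < min d 1" using d(1) by simp
    fix v assume v: "dist v (cis e) < min d 1"
    define u where "u = v * cis (- e)"
    have vu: "v = u * cis e" by (simp add: u_def mult.assoc cis_mult)
    have "dist u 1 = norm ((v - cis e) * cis (- e))"
      by (simp add: u_def dist_norm algebra_simps cis_mult)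
    also have "\<dots> = dist v (cis e)" by (simp add: norm_mult dist_norm)
    finally have "dist u 1 < min d 1" using v by simp
    then have u: "dist u 1 < d" "u \<noteq> 0" by (auto simp: dist_norm)
    have "\<bar>Arg u\<bar> < min (e - c) (c' - e)" using d(2)[OF u(1)] by (simp add: dist_norm)
    moreover have "v = of_real (norm u) * cis (e + Arg u)"
    proof -
      have "u = of_real (norm u) * cis (Arg u)" using rcis_cmod_Arg[of u] by (simp add: rcis_def)
      then have "v = of_real (norm u) * cis (Arg u) * cis e" using vu by simp
      then show ?thesis by (simp add: mult.assoc cis_mult add.commute)
    qed
    ultimately show "\<exists>r s. 0 < r \<and> c < s \<and> s < c' \<and> v = of_real r * cis s"
      using u(2) by (intro exI[of _ "norm u"] exI[of _ "e + Arg u"]) auto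
  qed
qed

context disk_chart begin

definition ray :: "real \<Rightarrow> complex set" where
  "ray c = (\<lambda>s. \<phi> (of_real s * cis c)) ` {0..<1}"

lemma ray_in: "of_real s * cis c \<in> ball 0 1" if "0 \<le> s" "s < 1"
  using that by (simp add: norm_mult)

lemma ray_subset: "ray c \<subseteq> G"
  unfolding ray_def image[symmetric] by (rule image_subsetI, rule imageI, rule ray_in) auto

lemma connected_ray: "connected (ray c)"
  unfolding ray_def
proof (rule connected_continuous_image)
  show "continuous_on {0..<1} (\<lambda>s. \<phi> (of_real s * cis c))"
    by (rule continuous_on_compose2[OF cont]) (auto intro!: continuous_intros simp: norm_mult)
qed auto

lemma center_in_ray: "\<phi> 0 \<in> ray c"
  unfolding ray_def by (rule image_eqI[of _ _ 0]) auto

lemma closure_ray_subset: "closure (ray c) \<subseteq> ray c \<union> impression \<phi> {cis c}"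
proof -
  let ?S = "(\<lambda>s. of_real s * cis c) ` {0..1}"
  have "closed (impression \<phi> ?S)"
    by (intro closed_impression compact_imp_closed compact_continuous_image continuous_intros) auto
  moreover have "ray c \<subseteq> impression \<phi> ?S"
  proof
    fix x assume "x \<in> ray c"
    then obtain s where s: "s \<in> {0..<1}" "x = \<phi> (of_real s * cis c)" unfolding ray_def by blast
    have "(of_real s * cis c, x) \<in> boundary_graph \<phi>"
      unfolding s(2) using s(1) by (intro graph_subset ray_in) auto
    then show "x \<in> impression \<phi> ?S" using s(1) by force
  qed
  ultimately have "closure (ray c) \<subseteq> impression \<phi> ?S" by (simp add: closure_minimal)
  also have "\<dots> \<subseteq> ray c \<union> impression \<phi> {cis c}"
  proof
    fix x assume "x \<in> impression \<phi> ?S"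
    then obtain s where s: "s \<in> {0..1}" "(of_real s * cis c, x) \<in> boundary_graph \<phi>" by auto
    show "x \<in> ray c \<union> impression \<phi> {cis c}"
    proof (cases "s < 1")
      case True
      then have "of_real s * cis c \<in> ball 0 1" using s(1) by (intro ray_in) auto
      then have "x = \<phi> (of_real s * cis c)" by (rule boundary_graph_interior(2)[OF s(2)])
      then show ?thesis using True s(1) unfolding ray_def by auto
    next
      case False
      then show ?thesis using s by simp
    qed
  qed
  finally show ?thesis .
qed

text \<open>
  A ray that stayed away from the impression would be compact, and so would its preimage, which is
  a radius without its end point.
\<close>

lemma closure_ray_meets: "closure (ray c) \<inter> impression \<phi> {cis c} \<noteq> {}"
proof
  assume "closure (ray c) \<inter> impression \<phi> {cis c} = {}"
  then have "closure (ray c) = ray c" using closure_ray_subset[of c] closure_subset by blast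
  moreover have "compact (closure (ray c))"
    using bounded_subset[OF bounded ray_subset] by (simp add: compact_closure)
  ultimately have "compact (inv_chart ` ray c)"
    using continuous_on_subset[OF inv_chart_cont ray_subset] by (intro compact_continuous_image) auto
  also have "inv_chart ` ray c = (\<lambda>s. of_real s * cis c) ` {0..<1}"
    unfolding ray_def image_image by (intro image_cong refl inv_chart ray_in) auto
  finally have "closed ((\<lambda>s. of_real s * cis c) ` {0..<1})" by (rule compact_imp_closed)
  then have "(\<lambda>s. of_real s * cis c) ` closure {0..<1} \<subseteq> (\<lambda>s. of_real s * cis c) ` {0..<1}"
    by (intro image_closure_subset continuous_intros order_refl)
  then have "of_real 1 * cis c \<in> (\<lambda>s. of_real s * cis c) ` {0..<1}" by auto
  then show False by auto
qed

text \<open>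
  Radius and angle of the path in the disk run linearly from \<open>(r, a)\<close> to \<open>(s, b)\<close>.  Outside
  \<open>G\<close> a holomorphic logarithm of \<open>\<phi> - x\<close> makes the winding number depend on the end points
  only; around \<open>\<phi> 0\<close> the quotient \<open>(\<phi> z - \<phi> 0) / z\<close> has a logarithm, and a further turn
  adds one.
\<close>

lemma winding_number_chart_arc:
  assumes rs: "0 < r" "r < 1" "0 < s" "s < 1"
  defines "p a b \<equiv> (\<lambda>t::real. \<phi> (of_real (r + (s - r) * t) * cis (a + (b - a) * t)))"
  shows path_chart_arc: "path (p a b)"
    and winding_number_chart_arc_outside:
      "x \<notin> G \<Longrightarrow> winding_number (p a b) x = winding_number (p a (b + 2 * pi)) x"
    and winding_number_chart_arc_center:
      "winding_number (p a b) (\<phi> 0) \<noteq> winding_number (p a (b + 2 * pi)) (\<phi> 0)"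
proof -
  let ?\<rho> = "\<lambda>t. r + (s - r) * t" and ?\<theta> = "\<lambda>a b t. a + (b - a) * t"
  let ?z = "\<lambda>a b t. of_real (?\<rho> t) * cis (?\<theta> a b t)"
  have \<rho>: "0 < ?\<rho> t \<and> ?\<rho> t < 1" if "t \<in> {0..1}" for t by (rule radius_between[OF rs that])
  have inb: "?z a b t \<in> ball 0 1" if "t \<in> {0..1}" for a b t
    using \<rho>[OF that] by (intro ray_in) auto
  have ca: "continuous_on {0..1} (?z a b)" for a b by (intro continuous_intros)
  have pathp: "path (p a b)" for a b
    unfolding path_def p_def by (rule continuous_on_compose2[OF cont ca]) (use inb in auto)
  then show "path (p a b)" .
  have contractible: "contractible (ball (0::complex) 1)" by (intro convex_imp_contractible convex_ball)
  show "winding_number (p a b) x = winding_number (p a (b + 2 * pi)) x" if "x \<notin> G"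
  proof -
    have "\<And>z. z \<in> ball 0 1 \<Longrightarrow> \<phi> z - x \<noteq> 0" using that image by auto
    then obtain k where k: "k holomorphic_on ball 0 1" "\<And>z. z \<in> ball 0 1 \<Longrightarrow> \<phi> z - x = exp (k z)"
      using contractible_imp_holomorphic_log[OF holomorphic_on_diff[OF holo holomorphic_on_const] contractible]
      by metis
    have "winding_number (p a b) x = (k (?z a b 1) - k (?z a b 0)) / (2 * of_real pi * \<i>)" for a b
    proof (rule winding_number_continuous_log[OF pathp])
      show "continuous_on {0..1} (\<lambda>t. k (?z a b t))"
        by (rule continuous_on_compose2[OF holomorphic_on_imp_continuous_on[OF k(1)] ca]) (use inb in auto)
      fix t :: real assume "t \<in> {0..1}"
      then show "p a b t = x + exp (k (?z a b t))"
        using k(2)[OF inb[of t a b]] by (simp add: p_def algebra_simps)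
    qed
    then show ?thesis by (simp add: cis_mult[symmetric])
  qed
  show "winding_number (p a b) (\<phi> 0) \<noteq> winding_number (p a (b + 2 * pi)) (\<phi> 0)"
  proof -
    define h where "h z = (if z = 0 then deriv \<phi> 0 else (\<phi> z - \<phi> 0) / (z - 0))" for z
    have h: "h holomorphic_on ball 0 1"
      unfolding h_def by (rule pole_lemma[OF holo]) simp
    have "deriv \<phi> 0 \<noteq> 0"
      by (rule holomorphic_injective_imp_regular[OF holo open_ball inj]) simp
    then have "h z \<noteq> 0" if "z \<in> ball 0 1" for z
      using inj_onD[OF inj, of z 0] that by (auto simp: h_def)
    then obtain k where k: "k holomorphic_on ball 0 1" "\<And>z. z \<in> ball 0 1 \<Longrightarrow> h z = exp (k z)"
      using contractible_imp_holomorphic_log[OF h contractible] by metis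
    let ?l = "\<lambda>a b t. of_real (ln (?\<rho> t)) + \<i> * of_real (?\<theta> a b t) + k (?z a b t)"
    have w: "winding_number (p a b) (\<phi> 0) = (?l a b 1 - ?l a b 0) / (2 * of_real pi * \<i>)" for a b
    proof (rule winding_number_continuous_log[OF pathp])
      have "continuous_on {0..1} (\<lambda>t. k (?z a b t))"
        by (rule continuous_on_compose2[OF holomorphic_on_imp_continuous_on[OF k(1)] ca]) (use inb in auto)
      then show "continuous_on {0..1} (?l a b)"
        by (intro continuous_intros) (use \<rho> in fastforce)+
      fix t :: real assume t: "t \<in> {0..1}"
      have "?z a b t \<noteq> 0" using \<rho>[OF t] by (metis cis_neq_zero less_irrefl mult_eq_0_iff of_real_eq_0_iff)
      then have "\<phi> (?z a b t) = \<phi> 0 + ?z a b t * h (?z a b t)"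
        by (simp add: h_def)
      then have "p a b t = \<phi> 0 + ?z a b t * exp (k (?z a b t))"
        unfolding p_def using k(2)[OF inb[OF t, of a b]] by simp
      moreover have "?z a b t = exp (of_real (ln (?\<rho> t)) + \<i> * of_real (?\<theta> a b t))"
        unfolding exp_add using \<rho>[OF t] by (simp only: cis_conv_exp exp_of_real exp_ln)
      ultimately show "p a b t = \<phi> 0 + exp (?l a b t)"
        by (simp only: exp_add[of "of_real (ln (?\<rho> t)) + \<i> * of_real (?\<theta> a b t)"])
    qed
    have w': "winding_number (p a b) (\<phi> 0) =
        (of_real (ln s) + \<i> * of_real b + k (of_real s * cis b) -
         (of_real (ln r) + \<i> * of_real a + k (of_real r * cis a))) / (2 * of_real pi * \<i>)" for a b
      using w[of a b] by simp
    have per: "cis (b + 2 * pi) = cis b" by (simp add: cis_mult[symmetric])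
    have "winding_number (p a (b + 2 * pi)) (\<phi> 0) - winding_number (p a b) (\<phi> 0) = 1"
      unfolding w' per by (simp add: field_simps)
    then show ?thesis by auto
  qed
qed

text \<open>
  If \<open>y\<close> were outside \<open>K\<close>, points of \<open>G\<close> close to \<open>y\<close> in the directions \<open>e\<close> and
  \<open>e'\<close> could be joined by a short segment off \<open>K\<close> and off the two rays.  Inside the disk they can be
  joined around the centre on either side, crossing only one of the rays each time.  These are the
  detours of \<open>winding_number_detours_agree\<close>, but they differ by a full turn around \<open>\<phi> 0\<close>.
\<close>

lemma rays_separate:
  assumes K: "closed K" "connected K" "K \<subseteq> frontier G"
    and c: "c < c'" "c' < c + 2 * pi"
    and IK: "impression \<phi> {cis c} \<subseteq> K" "impression \<phi> {cis c'} \<subseteq> K"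
    and e: "c < e" "e < c'" "y \<in> impression \<phi> {cis e}"
    and e': "c' < e'" "e' < c + 2 * pi" "y \<in> impression \<phi> {cis e'}"
  shows "y \<in> K"
proof (rule ccontr)
  assume yK: "y \<notin> K"
  have "y \<in> frontier G" using e(3) by (auto intro: boundary_graph_frontier)
  then have yG: "y \<notin> G" using open_G frontier_disjoint_eq by blast
  define W where "W = K \<union> closure (ray c) \<union> closure (ray c')"
  have "closed W" unfolding W_def using K(1) by auto
  moreover have "y \<notin> W"
    unfolding W_def using yK yG closure_ray_subset[of c] closure_ray_subset[of c'] IK ray_subset by blast
  ultimately obtain \<epsilon> where eps: "0 < \<epsilon>" "ball y \<epsilon> \<inter> W = {}"
    by (metis Compl_iff disjoint_eq_subset_Compl open_Compl open_contains_ball)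
  have near: "\<exists>r s. 0 < r \<and> r < 1 \<and> a < s \<and> s < b \<and> \<phi> (of_real r * cis s) \<in> ball y \<epsilon>"
    if ab: "a < f" "f < b" "y \<in> impression \<phi> {cis f}" for a b f
  proof -
    obtain d where d: "0 < d"
      "\<And>v. dist v (cis f) < d \<Longrightarrow> \<exists>r s. 0 < r \<and> a < s \<and> s < b \<and> v = of_real r * cis s"
      using sector_contains_ball[OF ab(1,2)] by metis
    have "(cis f, y) \<in> boundary_graph \<phi>" using ab(3) by simp
    then obtain z where z: "z \<in> ball 0 1" "dist z (cis f) < min d \<epsilon>" "dist (\<phi> z) y < min d \<epsilon>"
      using boundary_graph_approachable[of "cis f" y \<phi> "min d \<epsilon>"] d(1) eps(1) by (metis min_less_iff_conj)
    obtain r s where rs: "0 < r" "a < s" "s < b" "z = of_real r * cis s" using d(2)[of z] z(2) by auto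
    have "r < 1" using z(1) rs by (simp add: norm_mult)
    with rs z show ?thesis by (intro exI[of _ r] exI[of _ s]) (simp add: dist_commute)
  qed
  obtain r1 e1 where 1: "0 < r1" "r1 < 1" "c < e1" "e1 < c'" "\<phi> (of_real r1 * cis e1) \<in> ball y \<epsilon>"
    using near[OF e] by metis
  obtain r2 e2 where 2: "0 < r2" "r2 < 1" "c' < e2" "e2 < c + 2 * pi" "\<phi> (of_real r2 * cis e2) \<in> ball y \<epsilon>"
    using near[OF e'] by metis
  let ?u = "\<phi> (of_real r1 * cis e1)" and ?v = "\<phi> (of_real r2 * cis e2)"
  define p where "p a b = (\<lambda>t::real. \<phi> (of_real (r2 + (r1 - r2) * t) * cis (a + (b - a) * t)))" for a b
  have p_image: "\<exists>\<rho> s. 0 < \<rho> \<and> \<rho> < 1 \<and> min a b \<le> s \<and> s \<le> max a b \<and> x = \<phi> (of_real \<rho> * cis s)"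
    if x: "x \<in> path_image (p a b)" for x a b
  proof -
    obtain t where t: "t \<in> {0..1}" "x = \<phi> (of_real (r2 + (r1 - r2) * t) * cis (a + (b - a) * t))"
      using x unfolding path_image_def p_def by blast
    have "0 \<le> (b - a) * t \<and> (b - a) * t \<le> b - a \<or> 0 \<le> (a - b) * t \<and> (a - b) * t \<le> a - b"
      using t(1) by (cases "a \<le> b") (auto intro: mult_left_le)
    then have "min a b \<le> a + (b - a) * t \<and> a + (b - a) * t \<le> max a b"
      by (auto simp: algebra_simps)
    with t(2) radius_between[OF 2(1,2) 1(1,2) t(1)] show ?thesis by blast
  qed
  have p_ray: "path_image (p a b) \<inter> ray k = {}" if k: "k < min a b" "max a b < k + 2 * pi" for a b k
  proof (rule ccontr)
    assume "path_image (p a b) \<inter> ray k \<noteq> {}"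
    then obtain x where x: "x \<in> path_image (p a b)" "x \<in> ray k" by blast
    obtain \<rho> s where s: "0 < \<rho>" "\<rho> < 1" "min a b \<le> s" "s \<le> max a b" "x = \<phi> (of_real \<rho> * cis s)"
      using p_image[OF x(1)] by blast
    obtain r where "r \<in> {0..<1}" "x = \<phi> (of_real r * cis k)"
      using x(2) unfolding ray_def by blast
    then have r: "r \<in> {0..<1}" "\<phi> (of_real \<rho> * cis s) = \<phi> (of_real r * cis k)" using s(5) by simp_all
    then have "of_real r * cis k = of_real \<rho> * cis s"
      using inj_onD[OF inj r(2)] ray_in[of \<rho> s] ray_in[of r k] s by auto
    then have "k = s" using r(1) s k by (intro rays_disjoint[of r k \<rho> s]) auto
    with s k show False by simp
  qed
  define L where "L = linepath ?u ?v"
  have L: "path L" "pathstart L = ?u" "pathfinish L = ?v" "path_image L \<subseteq> ball y \<epsilon>"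
    unfolding L_def using 1(5) 2(5) by (auto simp: closed_segment_subset)
  have p: "path (p a b)" "pathstart (p e2 b) = ?v" for a b
    unfolding p_def using path_chart_arc[OF 2(1,2) 1(1,2)] by (simp_all add: pathstart_def)
  have per: "cis (e1 + 2 * pi) = cis e1" by (simp add: cis_mult[symmetric])
  have p1: "pathfinish (p e2 e1) = ?u" "pathfinish (p e2 (e1 + 2 * pi)) = ?u"
    by (simp_all add: p_def pathfinish_def per)
  have pG: "path_image (p a b) \<subseteq> G" for a b
    using p_image[of _ a b] ray_in image by (metis image_eqI less_imp_le subsetI)
  have KG: "K \<inter> G = {}" using K(3) open_G frontier_disjoint_eq by blast
  have LW: "path_image L \<inter> K = {}" "path_image L \<inter> ray c = {}" "path_image L \<inter> ray c' = {}"
    using L(4) eps(2) closure_subset unfolding W_def by blast+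
  have "winding_number (p e2 e1) (\<phi> 0) = winding_number (p e2 (e1 + 2 * pi)) (\<phi> 0)"
  proof (rule winding_number_detours_agree[OF L(1-3) p p1(1) p p1(2) K(2) _ connected_ray center_in_ray _ _ connected_ray center_in_ray])
    show "K \<inter> (path_image L \<union> path_image (p e2 e1) \<union> path_image (p e2 (e1 + 2 * pi))) = {}"
      using KG pG LW(1) by blast
    show "closure (ray c) \<inter> K \<noteq> {}" using closure_ray_meets[of c] IK(1) by blast
    show "closure (ray c') \<inter> K \<noteq> {}" using closure_ray_meets[of c'] IK(2) by blast
    show "ray c \<inter> (path_image L \<union> path_image (p e2 e1)) = {}"
      using LW(2) p_ray[of c e2 e1] 1 2 by auto
    show "ray c' \<inter> (path_image L \<union> path_image (p e2 (e1 + 2 * pi))) = {}"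
      using LW(3) p_ray[of c' e2 "e1 + 2 * pi"] 1 2 by auto
    fix k assume "k \<in> K"
    then have "k \<notin> G" using KG by blast
    then show "winding_number (p e2 e1) k = winding_number (p e2 (e1 + 2 * pi)) k"
      unfolding p_def by (rule winding_number_chart_arc_outside[OF 2(1,2) 1(1,2)])
  qed
  then show False
    using winding_number_chart_arc_center[OF 2(1,2) 1(1,2), of e2 e1] unfolding p_def by blast
qed

end

section \<open>Landing of asymptotic paths\<close>

definition clamp_real :: "real \<Rightarrow> real \<Rightarrow> real \<Rightarrow> real" where
  "clamp_real a b x = max a (min b x)"

text \<open>
  Clamping the coordinates moves both paths into the closed rectangle.  It creates no new
  intersections, since in each coordinate one of the two paths stays strictly inside.
\<close>

lemma crossing_paths_in_rectangle:
  fixes p q :: "real \<Rightarrow> complex"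
  assumes p: "path p" "Re (p 0) \<le> a" "b \<le> Re (p 1)" "\<And>t. t \<in> {0..1} \<Longrightarrow> c < Im (p t) \<and> Im (p t) < d"
    and q: "path q" "Im (q 0) \<le> c" "d \<le> Im (q 1)" "\<And>t. t \<in> {0..1} \<Longrightarrow> a < Re (q t) \<and> Re (q t) < b"
  obtains s t where "s \<in> {0..1}" "t \<in> {0..1}" "p s = q t"
proof -
  define v where "v z = (vector [clamp_real a b (Re z), clamp_real c d (Im z)] :: real^2)" for z
  have v: "v z $ 1 = clamp_real a b (Re z)" "v z $ 2 = clamp_real c d (Im z)" for z by (simp_all add: v_def)
  have ab: "a < b" using q(4)[of 0] by auto
  have cd: "c < d" using p(4)[of 0] by auto
  have contv: "continuous_on UNIV v"
  proof -
    have "v = (\<lambda>z. \<chi> i. if i = 1 then clamp_real a b (Re z) else clamp_real c d (Im z))"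
      by (rule ext, simp add: vec_eq_iff forall_2 v)
    moreover have "continuous_on UNIV (\<lambda>z. if i = 1 then clamp_real a b (Re z) else clamp_real c d (Im z))" for i :: 2
      unfolding clamp_real_def by (cases "i = 1") (auto intro!: continuous_intros)
    ultimately show ?thesis by (simp only:) (rule continuous_on_vec_lambda)
  qed
  have pv: "path (v \<circ> p)" "path (v \<circ> q)"
    using p(1) q(1) contv by (auto intro!: path_continuous_image continuous_on_subset[OF contv])
  have box: "v z \<in> cbox (vector [a, c]) (vector [b, d])" for z
    using ab cd by (simp add: mem_box_cart forall_2 v clamp_real_def)
  have im: "path_image (v \<circ> f) \<subseteq> cbox (vector [a, c]) (vector [b, d])" for f
    using box by (auto simp: path_image_def)
  obtain z where "z \<in> path_image (v \<circ> p)" "z \<in> path_image (v \<circ> q)"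
  proof (rule fashoda[OF pv im im])
    show "pathstart (v \<circ> p) $ 1 = (vector [a, c] :: real^2) $ 1" "pathfinish (v \<circ> p) $ 1 = (vector [b, d] :: real^2) $ 1"
      using p(2,3) ab by (simp_all add: pathstart_def pathfinish_def v clamp_real_def)
    show "pathstart (v \<circ> q) $ 2 = (vector [a, c] :: real^2) $ 2" "pathfinish (v \<circ> q) $ 2 = (vector [b, d] :: real^2) $ 2"
      using q(2,3) cd by (simp_all add: pathstart_def pathfinish_def v clamp_real_def)
  qed
  then obtain s t where st: "s \<in> {0..1}" "t \<in> {0..1}" "v (p s) = v (q t)"
    by (auto simp: path_image_def)
  have "clamp_real a b (Re (p s)) = clamp_real a b (Re (q t))" "clamp_real c d (Im (p s)) = clamp_real c d (Im (q t))"
    using st(3) v by metis+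
  then have "Re (p s) = Re (q t)" "Im (p s) = Im (q t)"
    using p(4)[OF st(1)] q(4)[OF st(2)] ab cd by (auto simp: clamp_real_def max_def min_def split: if_splits)
  with st that show thesis by (meson complex_eqI)
qed

text \<open>
  A two-constants estimate.  The path \<open>q\<close>, on which \<open>g\<close> is small, crosses the half strip of
  width \<open>L\<close> below height \<open>Y\<close> and so shields the point at height \<open>Y\<close> from the real axis.
  A harmonic function that is at most one and is nonpositive on the two sides and on the top of the
  box of height \<open>Y + 1\<close> turns this into a bound that improves with \<open>\<epsilon>\<close> at a rate independent
  of the position \<open>c\<close>.
\<close>

lemma half_plane_crossing_bound:
  fixes g :: "complex \<Rightarrow> complex" and q :: "real \<Rightarrow> complex"
  assumes g: "g holomorphic_on {z. 0 < Im z}" and bd: "\<And>z. 0 < Im z \<Longrightarrow> norm (g z) \<le> M"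
    and L: "0 < L" and Y: "0 < Y" and eps: "0 < \<epsilon>" "\<epsilon> \<le> M"
    and q: "path q" "Re (q 0) \<le> c" "c + L \<le> Re (q 1)"
           "\<And>t. t \<in> {0..1} \<Longrightarrow> 0 < Im (q t) \<and> Im (q t) < Y \<and> norm (g (q t)) \<le> \<epsilon>"
  shows "norm (g (Complex (c + L / 2) Y)) * exp (ln (M / \<epsilon>) * (exp (- pi * Y / L) - exp (- pi * (Y + 1) / L))) \<le> M"
proof -
  let ?T = "Y + 1"
  define z0 where "z0 = Complex (c + L / 2) Y"
  define S where "S = {z. c < Re z \<and> Re z < c + L \<and> 0 < Im z \<and> Im z < ?T} - path_image q"
  define V where "V = connected_component_set S z0"
  define \<Lambda> where "\<Lambda> = ln (M / \<epsilon>)"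
  have M: "0 < M" using eps by linarith
  have Lam: "0 \<le> \<Lambda>" "exp \<Lambda> = M / \<epsilon>" unfolding \<Lambda>_def using eps M by auto
  \<comment> \<open>The imaginary part of \<open>B\<close> is the harmonic function of the estimate; on the segment where \<open>Re z\<close> is the
    midpoint of the strip the sine is one.\<close>
  define B where "B z = exp (\<i> * of_real pi * (z - of_real c) / of_real L) - \<i> * of_real (exp (- pi * ?T / L))" for z
  have ImB: "Im (B z) = exp (- pi * Im z / L) * sin (pi * (Re z - c) / L) - exp (- pi * ?T / L)" for z
  proof -
    have "\<i> * of_real pi * (z - of_real c) / of_real L = Complex (- pi * Im z / L) (pi * (Re z - c) / L)"
      using L by (simp add: complex_eq_iff Re_divide_of_real Im_divide_of_real)
    then show ?thesis unfolding B_def by (simp add: Im_exp)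
  qed
  define H where "H z = g z * exp (- \<i> * of_real \<Lambda> * B z)" for z
  have normH: "norm (H z) = norm (g z) * exp (\<Lambda> * Im (B z))" for z
    by (simp add: H_def norm_mult)
  have "closed (path_image q)" using q(1) by (simp add: closed_path_image)
  moreover have "open {z. c < Re z \<and> Re z < c + L \<and> 0 < Im z \<and> Im z < ?T}"
    by (intro open_Collect_conj open_halfspace_Re_gt open_halfspace_Re_lt open_halfspace_Im_gt open_halfspace_Im_lt)
  ultimately have "open S" unfolding S_def by (rule open_Diff[rotated])
  then have openV: "open V" unfolding V_def by (rule open_connected_component)
  have VS: "V \<subseteq> S" unfolding V_def by (rule connected_component_subset)
  have "z0 \<notin> path_image q"
  proof
    assume "z0 \<in> path_image q"
    then obtain t where "t \<in> {0..1}" "z0 = q t" by (auto simp: path_image_def)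
    with q(4)[of t] have "Im z0 < Y" by simp
    then show False by (simp add: z0_def)
  qed
  then have "z0 \<in> S" using L Y by (simp add: S_def z0_def)
  then have z0V: "z0 \<in> V" by (simp add: V_def)
  have "connected V" unfolding V_def by simp
  obtain \<mu> where mu: "0 < \<mu>" "\<And>t. t \<in> {0..1} \<Longrightarrow> \<mu> < Im (q t)"
  proof -
    have "continuous_on {0..1} (\<lambda>t. Im (q t))" using q(1) unfolding path_def by (intro continuous_intros)
    then obtain t0 where "t0 \<in> {0..1}" "\<And>t. t \<in> {0..1} \<Longrightarrow> Im (q t0) \<le> Im (q t)"
      using continuous_attains_inf[of "{0..1::real}" "\<lambda>t. Im (q t)"] by auto
    with q(4) that[of "Im (q t0) / 2"] show thesis by fastforce
  qed
  have Vmu: "\<mu> < Im z" if zV: "z \<in> V" for z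
  proof (rule ccontr)
    assume "\<not> \<mu> < Im z"
    then have zmu: "Im z \<le> \<mu>" by simp
    have "path_connected V" using openV \<open>connected V\<close> by (simp add: connected_open_path_connected)
    then obtain r where r: "path r" "path_image r \<subseteq> V" "pathstart r = z" "pathfinish r = z0"
      using zV z0V unfolding path_connected_def by blast
    have rS: "r t \<in> S" if "t \<in> {0..1}" for t using r(2) VS that unfolding path_image_def by blast
    obtain s t where st: "s \<in> {0..1}" "t \<in> {0..1}" "q s = r t"
    proof (rule crossing_paths_in_rectangle[OF q(1-3) _ r(1)])
      show "\<mu> < Im (q t) \<and> Im (q t) < Y" if "t \<in> {0..1}" for t using mu(2) q(4) that by blast
      show "Im (r 0) \<le> \<mu>" using r(3) zmu by (simp add: pathstart_def)
      show "Y \<le> Im (r 1)" using r(4) by (simp add: pathfinish_def z0_def)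
      show "c < Re (r t) \<and> Re (r t) < c + L" if "t \<in> {0..1}" for t using rS[OF that] by (simp add: S_def)
    qed
    then have "r t \<in> path_image q" unfolding path_image_def by (metis imageI)
    with rS[OF st(2)] show False by (simp add: S_def)
  qed
  have clV: "c \<le> Re z \<and> Re z \<le> c + L \<and> \<mu> \<le> Im z \<and> Im z \<le> ?T" if "z \<in> closure V" for z
  proof -
    have "V \<subseteq> {z. c \<le> Re z \<and> Re z \<le> c + L \<and> \<mu> \<le> Im z \<and> Im z \<le> ?T}"
      using VS Vmu by (force simp: S_def)
    moreover have "closed {z. c \<le> Re z \<and> Re z \<le> c + L \<and> \<mu> \<le> Im z \<and> Im z \<le> ?T}"
      by (intro closed_Collect_conj closed_halfspace_Re_ge closed_halfspace_Re_le closed_halfspace_Im_ge closed_halfspace_Im_le)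
    ultimately show ?thesis using that closure_minimal by blast
  qed
  have frV: "z \<in> path_image q \<or> Re z = c \<or> Re z = c + L \<or> Im z = ?T" if "z \<in> frontier V" for z
  proof (rule ccontr)
    assume neg: "\<not> ?thesis"
    have zc: "z \<in> closure V" "z \<notin> V" using that openV by (auto simp: frontier_def interior_open)
    have "z \<in> S" using clV[OF zc(1)] neg mu(1) by (auto simp: S_def)
    have "frontier V \<subseteq> frontier S"
      unfolding V_def by (rule Path_Connected.frontier_of_connected_component_subset)
    then have "z \<in> frontier S" using that by blast
    then show False using \<open>z \<in> S\<close> \<open>open S\<close> frontier_disjoint_eq by blast
  qed
  have holH: "H holomorphic_on {z. 0 < Im z}"
    unfolding H_def B_def
    by (rule holomorphic_on_mult[OF g]) (use L in \<open>auto intro!: holomorphic_intros\<close>)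
  have clsub: "closure V \<subseteq> {z. 0 < Im z}" using clV mu(1) by force
  have "bounded V"
  proof (rule bounded_subset[of "cbox (Complex c 0) (Complex (c + L) ?T)"])
    show "V \<subseteq> cbox (Complex c 0) (Complex (c + L) ?T)" using VS by (auto simp: S_def in_cbox_complex_iff)
  qed (rule bounded_cbox)
  have ImB1: "Im (B z) \<le> 1" if "0 < Im z" for z
  proof -
    have "exp (- pi * Im z / L) * sin (pi * (Re z - c) / L) \<le> exp (- pi * Im z / L) * 1"
      by (rule mult_left_mono) simp_all
    also have "\<dots> \<le> 1" using that L by simp
    finally have "exp (- pi * Im z / L) * sin (pi * (Re z - c) / L) \<le> 1" .
    then show ?thesis unfolding ImB using exp_gt_zero[of "- pi * ?T / L"] by linarith
  qed
  have "norm (H z0) \<le> M"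
  proof (rule maximum_modulus_frontier[of H V])
    show "H holomorphic_on interior V"
      using holH clsub closure_subset interior_subset by (meson holomorphic_on_subset order_trans)
    show "continuous_on (closure V) H"
      using holomorphic_on_imp_continuous_on[OF holH] clsub continuous_on_subset by blast
    show "z0 \<in> V" by (rule z0V)
    show "bounded V" by fact
    fix z assume z: "z \<in> frontier V"
    then have "z \<in> closure V" by (simp add: frontier_def)
    then have zpos: "0 < Im z" using clsub by blast
    show "norm (H z) \<le> M"
    proof (cases "z \<in> path_image q")
      case True
      then obtain t where "t \<in> {0..1}" "z = q t" by (auto simp: path_image_def)
      then have gz: "norm (g z) \<le> \<epsilon>" using q(4) by blast
      have "exp (\<Lambda> * Im (B z)) \<le> exp (\<Lambda> * 1)"
        unfolding exp_le_cancel_iff using ImB1[OF zpos] Lam(1) by (rule mult_left_mono)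
      then have "norm (g z) * exp (\<Lambda> * Im (B z)) \<le> \<epsilon> * (M / \<epsilon>)"
        using gz Lam(2) eps(1) by (intro mult_mono) auto
      then show ?thesis unfolding normH using eps(1) by simp
    next
      case False
      then have z3: "Re z = c \<or> Re z = c + L \<or> Im z = ?T" using frV[OF z] by blast
      have "Im (B z) \<le> 0"
      proof -
        have "exp (- pi * Im z / L) * sin (pi * (Re z - c) / L) \<le> exp (- pi * ?T / L)"
          using z3
        proof (elim disjE)
          assume "Im z = ?T"
          then show ?thesis by (simp add: mult_le_cancel_left1)
        qed (use L in simp_all)
        then show ?thesis unfolding ImB by simp
      qed
      then have "exp (\<Lambda> * Im (B z)) \<le> 1" using Lam(1) by (simp add: mult_nonneg_nonpos)
      then have "norm (g z) * exp (\<Lambda> * Im (B z)) \<le> M * 1"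
        using bd[OF zpos] M by (intro mult_mono) auto
      then show ?thesis unfolding normH by simp
    qed
  qed
  moreover have "Im (B z0) = exp (- pi * Y / L) - exp (- pi * ?T / L)"
  proof -
    have "sin (pi * (Re z0 - c) / L) = 1" using L by (simp add: z0_def)
    then show ?thesis unfolding ImB by (simp add: z0_def)
  qed
  ultimately show ?thesis unfolding normH by (simp add: z0_def \<Lambda>_def)
qed

lemma convergent_at_right_of_oscillation:
  fixes u :: "real \<Rightarrow> real"
  assumes osc: "\<And>L. 0 < L \<Longrightarrow> \<exists>\<tau>>0. \<forall>s t. 0 < s \<and> s \<le> \<tau> \<and> 0 < t \<and> t \<le> \<tau> \<longrightarrow> \<bar>u s - u t\<bar> < L"
  obtains l where "(u \<longlongrightarrow> l) (at_right 0)"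
proof -
  have "cauchy_filter (filtermap u (at_right 0))"
    unfolding cauchy_filter_metric_filtermap
  proof (intro allI impI)
    fix e :: real assume "0 < e"
    from osc[OF this] obtain \<tau> where \<tau>: "\<tau> > 0"
      "\<forall>s t. 0 < s \<and> s \<le> \<tau> \<and> 0 < t \<and> t \<le> \<tau> \<longrightarrow> \<bar>u s - u t\<bar> < e" by blast
    have "eventually (\<lambda>t. 0 < t \<and> t \<le> \<tau>) (at_right 0)"
      unfolding eventually_at_right_field using \<tau>(1) by (intro exI[of _ \<tau>]) auto
    with \<tau>(2) show "\<exists>P. eventually P (at_right 0) \<and> (\<forall>x y. P x \<and> P y \<longrightarrow> dist (u x) (u y) < e)"
      by (intro exI[of _ "\<lambda>t. 0 < t \<and> t \<le> \<tau>"]) (simp add: dist_real_def)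
  qed
  then obtain l where "filtermap u (at_right 0) \<le> nhds l"
    using cauchy_filter_complete_converges[of "filtermap u (at_right 0)" UNIV] complete_UNIV
    by (auto simp: filtermap_bot_iff)
  then show thesis by (intro that[of l]) (simp add: filterlim_def)
qed

text \<open>
  Koebe's lemma.  If the argument of \<open>p\<close> oscillated, then in the coordinate
  \<open>z = exp (\<i> w)\<close> the path would cross strips of a fixed width \<open>L\<close> arbitrarily close to the real
  axis, where \<open>h\<close> is arbitrarily small.  The previous estimate then forces \<open>h\<close> to be small at
  a point of a fixed circle around \<open>0\<close>; for a small circle this contradicts \<open>h 0 \<noteq> 0\<close>.
\<close>

lemma asymptotic_path_lands:
  fixes h :: "complex \<Rightarrow> complex" and p :: "real \<Rightarrow> complex"
  assumes h: "h holomorphic_on ball 0 1" "\<And>z. z \<in> ball 0 1 \<Longrightarrow> norm (h z) \<le> M" "h 0 \<noteq> 0"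
    and p: "continuous_on {0<..1} p" "\<And>t. t \<in> {0<..1} \<Longrightarrow> p t \<in> ball 0 1"
    and p1: "((\<lambda>t. norm (p t)) \<longlongrightarrow> 1) (at_right 0)"
    and h0: "((\<lambda>t. h (p t)) \<longlongrightarrow> 0) (at_right 0)"
  obtains s where "norm s = 1" "(p \<longlongrightarrow> s) (at_right 0)"
proof -
  have ev: "\<exists>\<tau>>0. \<tau> \<le> r \<and> (\<forall>t. 0 < t \<and> t \<le> \<tau> \<longrightarrow> P t)" if evP: "eventually P (at_right (0::real))" and r: "0 < r" for P r
  proof -
    obtain b where b: "0 < b" "\<And>t. 0 < t \<Longrightarrow> t < b \<Longrightarrow> P t"
      using evP unfolding eventually_at_right_field by blast
    show ?thesis
      using b r by (intro exI[of _ "min r (b / 2)"]) auto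
  qed
  have "\<forall>\<^sub>F t in at_right 0. 0 < norm (p t)" using order_tendstoD(1)[OF p1, of 0] by simp
  then obtain \<tau> where \<tau>: "0 < \<tau>" "\<tau> \<le> 1" "\<And>t. 0 < t \<Longrightarrow> t \<le> \<tau> \<Longrightarrow> p t \<noteq> 0"
    using ev[of "\<lambda>t. 0 < norm (p t)" 1] by auto
  have "contractible {0<..\<tau>}" by (intro convex_imp_contractible convex_real_interval)
  moreover have "continuous_on {0<..\<tau>} p" by (rule continuous_on_subset[OF p(1)]) (use \<tau>(2) in auto)
  ultimately obtain g where g: "continuous_on {0<..\<tau>} g" "\<And>t. t \<in> {0<..\<tau>} \<Longrightarrow> p t = exp (g t)"
    using continuous_logarithm_on_contractible[of "{0<..\<tau>}" p] \<tau>(3) by (metis greaterThanAtMost_iff)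
  define u where "u t = Im (g t)" for t
  have osc: "\<exists>\<tau>'>0. \<forall>s t. 0 < s \<and> s \<le> \<tau>' \<and> 0 < t \<and> t \<le> \<tau>' \<longrightarrow> \<bar>u s - u t\<bar> < L" if L: "0 < L" for L
  proof (rule ccontr)
    assume neg: "\<not> ?thesis"
    have M: "0 < M" using h(2)[of 0] h(3) by (metis centre_in_ball norm_le_zero_iff not_le order_trans zero_less_one)
    have "isCont h 0"
      using continuous_on_interior[OF holomorphic_on_imp_continuous_on[OF h(1)], of 0] by simp
    obtain \<rho> where \<rho>: "0 < \<rho>" "\<And>z. norm z < \<rho> \<Longrightarrow> norm (h z) \<ge> norm (h 0) / 2"
    proof -
      from \<open>isCont h 0\<close> obtain d where d: "0 < d" "\<And>z. dist z 0 < d \<Longrightarrow> dist (h z) (h 0) < norm (h 0) / 2"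
        unfolding continuous_at_eps_delta using h(3) by (metis half_gt_zero zero_less_norm_iff)
      have "norm (h z) \<ge> norm (h 0) / 2" if "norm z < d" for z
      proof -
        have "norm (h z - h 0) < norm (h 0) / 2" using d(2)[of z] that by (simp add: dist_norm)
        then show ?thesis using norm_triangle_ineq2[of "h 0" "h z"] by (simp add: norm_minus_commute)
      qed
      with d(1) show thesis by (rule that)
    qed
    \<comment> \<open>Points at height \<open>Y\<close> are mapped into the disk of radius \<open>\<rho>\<close>.\<close>
    define Y where "Y = max 1 (1 - ln \<rho>)"
    have Y: "0 < Y" "exp (- Y) < \<rho>"
    proof -
      show "0 < Y" by (simp add: Y_def)
      have "- Y < ln \<rho>" by (simp add: Y_def)
      then show "exp (- Y) < \<rho>" using \<rho>(1) by (metis exp_less_cancel_iff exp_ln)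
    qed
    define \<kappa> where "\<kappa> = exp (- pi * Y / L) - exp (- pi * (Y + 1) / L)"
    have \<kappa>: "0 < \<kappa>" unfolding \<kappa>_def using L by (simp add: divide_strict_right_mono)
    \<comment> \<open>With \<open>\<epsilon> = M exp (- N)\<close> the gain in the crossing bound is \<open>exp (N \<kappa>)\<close>, more than
      \<open>4 M / \<bar>h 0\<bar>\<close>.\<close>
    define N where "N = 4 * M / norm (h 0) / \<kappa>"
    have N: "0 \<le> N" unfolding N_def using M \<kappa> by simp
    define \<epsilon> where "\<epsilon> = M * exp (- N)"
    have \<epsilon>: "0 < \<epsilon>" "\<epsilon> \<le> M" "ln (M / \<epsilon>) = N"
      using M N by (auto simp: \<epsilon>_def exp_minus field_simps)
    have "\<forall>\<^sub>F t in at_right 0. norm (h (p t)) < \<epsilon> \<and> exp (- Y) < norm (p t)"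
      using order_tendstoD(2)[OF tendsto_norm_zero[OF h0] \<epsilon>(1)] order_tendstoD(1)[OF p1, of "exp (- Y)"] Y(1)
      by (auto intro: eventually_conj)
    from ev[OF this \<tau>(1)]
    obtain \<tau>' where \<tau>': "0 < \<tau>'" "\<tau>' \<le> \<tau>"
        "\<And>t. 0 < t \<Longrightarrow> t \<le> \<tau>' \<Longrightarrow> norm (h (p t)) < \<epsilon> \<and> exp (- Y) < norm (p t)"
      by blast
    obtain s t where st: "0 < s" "s \<le> \<tau>'" "0 < t" "t \<le> \<tau>'" "L \<le> \<bar>u s - u t\<bar>"
      using neg \<tau>'(1) by (meson not_le)
    obtain a b where ab: "0 < a" "a \<le> \<tau>'" "0 < b" "b \<le> \<tau>'" "u a + L \<le> u b"
    proof (cases "u s \<le> u t")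
      case True
      with st that[of s t] show thesis by auto
    next
      case False
      with st that[of t s] show thesis by auto
    qed
    define q where "q = (\<lambda>r. - \<i> * g (a + r * (b - a)))"
    have seg: "a + r * (b - a) \<in> {0<..\<tau>'}" if "r \<in> {0..1}" for r
    proof -
      have "a + r * (b - a) = (1 - r) * a + r * b" by (simp add: algebra_simps)
      moreover have "(1 - r) * a + r * b \<in> {0<..\<tau>'}"
        using convex_real_interval(6)[of 0 \<tau>'] ab that by (auto simp: convex_def)
      ultimately show ?thesis by simp
    qed
    have segt: "a + r * (b - a) \<in> {0<..\<tau>}" if "r \<in> {0..1}" for r
      using seg[OF that] \<tau>'(2) by auto
    have pathq: "path q" unfolding path_def q_def
      by (intro continuous_intros continuous_on_compose2[OF g(1)]) (use segt in auto)
    let ?G = "\<lambda>w. h (exp (\<i> * w))"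
    have eb: "exp (\<i> * w) \<in> ball 0 1" if "0 < Im w" for w using that by simp
    have Ghol: "?G holomorphic_on {z. 0 < Im z}"
    proof -
      have "(h \<circ> (\<lambda>w. exp (\<i> * w))) holomorphic_on {z. 0 < Im z}"
        by (rule holomorphic_on_compose_gen[OF _ h(1)]) (use eb in \<open>auto intro!: holomorphic_intros\<close>)
      then show ?thesis by (simp add: o_def)
    qed
    have "norm (?G (Complex (u a + L / 2) Y)) * exp (ln (M / \<epsilon>) * (exp (- pi * Y / L) - exp (- pi * (Y + 1) / L))) \<le> M"
    proof (rule half_plane_crossing_bound[OF Ghol _ L Y(1) \<epsilon>(1,2) pathq])
      show "norm (?G z) \<le> M" if "0 < Im z" for z using h(2)[OF eb[OF that]] .
      show "Re (q 0) \<le> u a" by (simp add: q_def u_def)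
      show "u a + L \<le> Re (q 1)" using ab(5) by (simp add: q_def u_def)
      fix r :: real assume r: "r \<in> {0..1}"
      let ?t = "a + r * (b - a)"
      have pt: "p ?t = exp (\<i> * q r)" using g(2)[OF segt[OF r]] by (simp add: q_def)
      have np: "norm (p ?t) = exp (- Im (q r))" unfolding pt by simp
      have "norm (p ?t) < 1" using p(2)[of ?t] segt[OF r] \<tau>(2) by simp
      then have "0 < Im (q r)" unfolding np by simp
      moreover have "Im (q r) < Y" using \<tau>'(3)[of ?t] seg[OF r] unfolding np by simp
      moreover have "norm (?G (q r)) \<le> \<epsilon>" using \<tau>'(3)[of ?t] seg[OF r] pt by simp
      ultimately show "0 < Im (q r) \<and> Im (q r) < Y \<and> norm (?G (q r)) \<le> \<epsilon>" by blast
    qed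
    then have 1: "norm (?G (Complex (u a + L / 2) Y)) * exp (N * \<kappa>) \<le> M"
      unfolding \<epsilon>(3) \<kappa>_def .
    have "norm (?G (Complex (u a + L / 2) Y)) \<ge> norm (h 0) / 2"
      by (rule \<rho>(2)) (use Y(2) in simp)
    then have "norm (h 0) / 2 * exp (N * \<kappa>) \<le> M"
      using 1 by (meson exp_ge_zero mult_right_mono order_trans)
    moreover have "exp (N * \<kappa>) \<ge> 1 + 4 * M / norm (h 0)"
      using exp_ge_add_one_self[of "N * \<kappa>"] \<kappa> by (simp add: N_def)
    then have "norm (h 0) / 2 * exp (N * \<kappa>) \<ge> norm (h 0) / 2 * (1 + 4 * M / norm (h 0))"
      by (intro mult_left_mono) auto
    moreover have "norm (h 0) / 2 * (1 + 4 * M / norm (h 0)) = norm (h 0) / 2 + 2 * M"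
      using h(3) by (simp add: field_simps)
    ultimately show False using M norm_ge_zero[of "h 0"] by linarith
  qed
  obtain l where l: "(u \<longlongrightarrow> l) (at_right 0)"
    using convergent_at_right_of_oscillation[OF osc] by blast
  have "((\<lambda>t. of_real (norm (p t)) * cis (u t)) \<longlongrightarrow> of_real 1 * cis l) (at_right 0)"
  proof (rule tendsto_mult[OF tendsto_of_real[OF p1]])
    have "isCont cis l" using continuous_on_cis[OF continuous_on_id[of UNIV]] by (simp add: continuous_on_eq_continuous_at)
    then show "((\<lambda>t. cis (u t)) \<longlongrightarrow> cis l) (at_right 0)"
      using l by (rule isCont_tendsto_compose)
  qed
  moreover have "\<forall>\<^sub>F t in at_right 0. of_real (norm (p t)) * cis (u t) = p t"
    unfolding eventually_at_right_field
  proof (intro exI conjI allI impI)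
    show "\<tau> > 0" by fact
    fix t assume "0 < t" "t < \<tau>"
    then have pt: "p t = exp (g t)" using g(2) by simp
    show "of_real (norm (p t)) * cis (u t) = p t"
      unfolding u_def pt norm_exp_eq_Re by (rule exp_eq_polar[symmetric])
  qed
  ultimately have "(p \<longlongrightarrow> of_real 1 * cis l) (at_right 0)"
    by (rule Lim_transform_eventually)
  then show thesis by (intro that[of "cis l"]) simp_all
qed

section \<open>Crosscuts\<close>

text \<open>
  Two boundary points on the unit circle are invisible to the maximum principle: the factor
  \<open>\<bar>k s1 z\<bar> powr \<eta> * \<bar>k s2 z\<bar> powr \<eta>\<close> vanishes there, is at most one in the disk, and tends to
  one as \<open>\<eta>\<close> tends to \<open>0\<close>.
\<close>

lemma extended_maximum_two_points:
  fixes f :: "complex \<Rightarrow> complex"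
  assumes V: "open V" "V \<subseteq> ball 0 1" and s: "norm s1 = 1" "norm s2 = 1"
    and clV: "closure V \<subseteq> ball 0 1 \<union> {s1, s2}"
    and f: "f holomorphic_on ball 0 1" "\<And>z. z \<in> ball 0 1 \<Longrightarrow> norm (f z) \<le> C"
    and fr: "\<And>z. z \<in> frontier V \<Longrightarrow> z \<in> ball 0 1 \<Longrightarrow> norm (f z) \<le> 1"
    and z0: "z0 \<in> V"
  shows "norm (f z0) \<le> 1"
proof -
  define k where "k s z = (1 - cnj s * z) / 2" for s z :: complex
  have kball: "0 < Re (k s z) \<and> norm (k s z) \<le> 1" if "norm s = 1" "z \<in> ball 0 1" for s z
  proof -
    have "norm (cnj s * z) < 1" using that by (simp add: norm_mult)
    then have "Re (cnj s * z) < 1" "norm (1 - cnj s * z) \<le> 2"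
      using complex_Re_le_cmod[of "cnj s * z"] norm_triangle_ineq4[of 1 "cnj s * z"] by auto
    then show ?thesis by (simp add: k_def norm_divide)
  qed
  have k0: "k s s = 0" if "norm s = 1" for s
    using that by (simp add: k_def complex_norm_square[symmetric] mult.commute[of "cnj s"])
  have C: "0 \<le> C" using f(2)[of 0] norm_ge_zero order_trans by (metis centre_in_ball zero_less_one)
  have "norm (f z0) * (norm (k s1 z0 * k s2 z0)) powr \<eta> \<le> 1" if eta: "0 < \<eta>" for \<eta>
  proof -
    define P where "P z = k s1 z powr of_real \<eta> * k s2 z powr of_real \<eta>" for z
    define T where "T z = (if z \<in> ball 0 1 then f z * P z else 0)" for z
    have normP: "norm (P z) = norm (k s1 z) powr \<eta> * norm (k s2 z) powr \<eta>" for z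
      by (simp add: P_def norm_mult norm_powr_real_powr')
    have powr1: "norm (k s z) powr \<eta> \<le> 1" if "norm s = 1" "z \<in> ball 0 1" for s z
      using kball[OF that] eta by (intro powr_le1) auto
    have holT: "(\<lambda>z. f z * P z) holomorphic_on ball 0 1"
      unfolding P_def k_def
    proof (intro holomorphic_on_mult f(1) holomorphic_on_powr)
      fix z assume "z \<in> ball (0::complex) 1"
      then show "(1 - cnj s1 * z) / 2 \<notin> \<real>\<^sub>\<le>\<^sub>0" "(1 - cnj s2 * z) / 2 \<notin> \<real>\<^sub>\<le>\<^sub>0"
        using kball[OF s(1), of z] kball[OF s(2), of z] unfolding k_def by (auto simp: complex_nonpos_Reals_iff)
    qed (intro holomorphic_intros; simp)+
    have holT': "T holomorphic_on ball 0 1"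
      by (rule holomorphic_transform[OF holT]) (simp add: T_def)
    have bound: "norm (T z) \<le> C * norm (k s z powr of_real \<eta>)" if "s = s1 \<or> s = s2" for s z
    proof (cases "z \<in> ball 0 1")
      case True
      have "norm (P z) \<le> norm (k s z) powr \<eta>"
        using that powr1[OF s(1) True] powr1[OF s(2) True] unfolding normP
        by (auto simp: mult_left_le mult_left_le_one_le)
      then have "norm (f z) * norm (P z) \<le> C * norm (k s z) powr \<eta>"
        using f(2)[OF True] C by (intro mult_mono) auto
      then show ?thesis using True by (simp add: T_def norm_mult norm_powr_real_powr')
    next
      case False
      then show ?thesis using C by (simp add: T_def)
    qed
    have contT: "continuous_on (closure V) T"
      unfolding continuous_on_eq_continuous_within
    proof
      fix z assume z: "z \<in> closure V"
      show "continuous (at z within closure V) T"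
      proof (cases "z \<in> ball 0 1")
        case True
        have "isCont T z"
          using continuous_on_interior[OF holomorphic_on_imp_continuous_on[OF holT'], of z] True by simp
        then show ?thesis by (rule continuous_at_imp_continuous_at_within)
      next
        case False
        then have zs: "z = s1 \<or> z = s2" using z clV by blast
        have nz: "norm z = 1" using zs s by auto
        have "((\<lambda>x. k z x) \<longlongrightarrow> k z z) (at z within closure V)"
          unfolding k_def by (intro tendsto_intros) simp
        then have "((\<lambda>x. k z x powr of_real \<eta>) \<longlongrightarrow> 0) (at z within closure V)"
          unfolding k0[OF nz] by (rule tendsto_powr_complex_0[OF _ tendsto_const]) (use eta in simp)
        then have "((\<lambda>x. C * norm (k z x powr of_real \<eta>)) \<longlongrightarrow> 0) (at z within closure V)"
          by (intro tendsto_mult_right_zero tendsto_norm_zero)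
        then have "(T \<longlongrightarrow> 0) (at z within closure V)"
          by (rule Lim_null_comparison[rotated]) (use bound[OF zs] in \<open>auto intro: always_eventually\<close>)
        moreover have "T z = 0" using False by (simp add: T_def)
        ultimately show ?thesis by (simp add: continuous_within)
      qed
    qed
    have "norm (T z0) \<le> 1"
    proof (rule maximum_modulus_frontier[of T V])
      show "T holomorphic_on interior V"
        using holT' V interior_subset by (meson holomorphic_on_subset order_trans)
      show "continuous_on (closure V) T" by (rule contT)
      show "bounded V" using V(2) bounded_ball bounded_subset by blast
      show "z0 \<in> V" by (rule z0)
      fix z assume z: "z \<in> frontier V"
      show "norm (T z) \<le> 1"
      proof (cases "z \<in> ball 0 1")
        case True
        have "norm (P z) \<le> 1 * 1"
          unfolding normP using powr1[OF s(1) True] powr1[OF s(2) True] by (intro mult_mono) auto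
        then have "norm (f z) * norm (P z) \<le> 1 * 1" using fr[OF z True] by (intro mult_mono) auto
        then show ?thesis using True by (simp add: T_def norm_mult)
      qed (simp add: T_def)
    qed
    moreover have "z0 \<in> ball 0 1" using z0 V(2) by blast
    ultimately show ?thesis by (simp add: T_def norm_mult normP powr_mult)
  qed
  then have le: "norm (f z0) * (norm (k s1 z0 * k s2 z0)) powr \<eta> \<le> 1" if "0 < \<eta>" for \<eta> using that by blast
  have z0b: "z0 \<in> ball 0 1" using z0 V(2) by blast
  then have pos: "0 < norm (k s1 z0 * k s2 z0)"
    using kball[OF s(1) z0b] kball[OF s(2) z0b] by auto
  have "((\<lambda>\<eta>. norm (f z0) * (norm (k s1 z0 * k s2 z0)) powr \<eta>) \<longlongrightarrow> norm (f z0) * (norm (k s1 z0 * k s2 z0)) powr 0) (at_right 0)"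
    using pos by (intro tendsto_intros) auto
  then have "norm (f z0) * (norm (k s1 z0 * k s2 z0)) powr 0 \<le> 1"
    by (rule tendsto_upperbound) (use le in \<open>auto simp: eventually_at_right_field intro!: exI[of _ 1]\<close>)
  then show ?thesis using pos by simp
qed

text \<open>
  The cut is put on the real axis, so that its two sides are locally the upper and the lower half
  plane.
\<close>

locale real_crosscut =
  fixes G :: "complex set" and a b :: real
  assumes open_G: "open G" and connected_G: "connected G" and ab: "a < b"
    and segment: "\<And>t. a < t \<Longrightarrow> t < b \<Longrightarrow> of_real t \<in> G"
    and ends: "of_real a \<notin> G" "of_real b \<notin> G"
begin

definition crosscut :: "complex set" where "crosscut = of_real ` {a<..<b}"
definition rad :: "real \<Rightarrow> real" where "rad c = infdist (of_real c) (- G)"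
definition mid :: real where "mid = (a + b) / 2"
definition base :: "real \<Rightarrow> complex" where "base \<sigma> = Complex mid (\<sigma> * (rad mid / 2))"
definition side :: "real \<Rightarrow> complex set" where
  "side \<sigma> = connected_component_set (G - crosscut) (base \<sigma>)"

lemma mid: "a < mid" "mid < b" using ab by (simp_all add: mid_def)

lemma rad_pos: "a < c \<Longrightarrow> c < b \<Longrightarrow> 0 < rad c"
  unfolding rad_def using open_G segment ends by (intro infdist_pos_not_in_closed) auto

lemma ball_rad: "dist z (of_real c) < rad c \<Longrightarrow> z \<in> G"
  unfolding rad_def using infdist_le[of z "- G" "of_real c"] by (force simp: dist_commute)

lemma rad_le: "rad c \<le> \<bar>c - a\<bar>" "rad c \<le> \<bar>c - b\<bar>"
  unfolding rad_def using infdist_le[of "of_real a" "- G" "of_real c"] infdist_le[of "of_real b" "- G" "of_real c"] ends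
  by (simp_all add: dist_of_real dist_real_def)

lemma rad_diff: "\<bar>rad c - rad d\<bar> \<le> \<bar>c - d\<bar>"
  unfolding rad_def using infdist_triangle_abs[of "of_real c" "- G" "of_real d"]
  by (simp add: dist_of_real dist_real_def)

lemma crosscut_iff: "z \<in> crosscut \<longleftrightarrow> Im z = 0 \<and> a < Re z \<and> Re z < b"
  unfolding crosscut_def by (force simp: image_iff complex_eq_iff)

lemma closed_real_segment: "closed (of_real ` {r..s} :: complex set)"
  by (intro compact_imp_closed compact_continuous_image continuous_intros) auto

lemma open_slit: "open (G - crosscut)"
proof -
  have "G - crosscut = G - of_real ` {a..b}"
    using ends ab by (auto simp: crosscut_def less_le)
  then show ?thesis using open_G closed_real_segment by (simp add: open_Diff)
qed

lemma open_side: "open (side \<sigma>)"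
  unfolding side_def using open_slit by (rule open_connected_component)

lemma connected_side: "connected (side \<sigma>)"
  unfolding side_def by (rule connected_connected_component)

lemma side_subset: "side \<sigma> \<subseteq> G - crosscut"
  unfolding side_def by (rule connected_component_subset)

text \<open>
  The set of points \<open>c + \<i> \<sigma> s (rad c)\<close> with \<open>c\<close> in the interval and \<open>0 < s < 1\<close> is a continuous image
  of a rectangle, hence connected, and it contains the half disc as well as the base point.
\<close>

lemma half_disc_in_side:
  assumes \<sigma>: "\<sigma> = 1 \<or> \<sigma> = - 1" and c: "a < c" "c < b" and z: "dist z (of_real c) < rad c / 2" "0 < \<sigma> * Im z"
  shows "z \<in> side \<sigma>"
proof -
  define E where "E = (\<lambda>(c, s). Complex c (\<sigma> * (s * rad c))) ` ({a<..<b} \<times> {0<..<1})"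
  have "connected E"
    unfolding E_def
  proof (rule connected_continuous_image)
    have *: "(\<lambda>(c, s). Complex c (\<sigma> * (s * rad c))) = (\<lambda>x. of_real (fst x) + \<i> * of_real (\<sigma> * (snd x * rad (fst x))))"
      by (auto simp: complex_eq_iff)
    show "continuous_on ({a<..<b} \<times> {0<..<(1::real)}) (\<lambda>(c, s). Complex c (\<sigma> * (s * rad c)))"
      unfolding * unfolding rad_def by (intro continuous_intros)
    show "connected ({a<..<b} \<times> {0<..<(1::real)})"
      by (intro connected_Times) auto
  qed
  moreover have "E \<subseteq> G - crosscut"
  proof
    fix w assume "w \<in> E"
    then obtain x where x: "x \<in> {a<..<b} \<times> {0<..<1}" "w = (case x of (c, s) \<Rightarrow> Complex c (\<sigma> * (s * rad c)))"
      unfolding E_def by blast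
    obtain c s where "x = (c, s)" by force
    with x have w: "w = Complex c (\<sigma> * (s * rad c))" "a < c" "c < b" "0 < s" "s < 1"
      by auto
    have r: "0 < rad c" using w rad_pos by blast
    have "w - of_real c = \<i> * of_real (\<sigma> * (s * rad c))" by (simp add: w(1) complex_eq_iff)
    then have "dist w (of_real c) = \<bar>\<sigma> * (s * rad c)\<bar>" by (simp add: dist_norm norm_mult abs_mult)
    also have "\<dots> = s * rad c" using \<sigma> w r by (auto simp: abs_mult)
    also have "\<dots> < 1 * rad c" using r w by (intro mult_strict_right_mono) auto
    finally have "w \<in> G" using ball_rad by simp
    moreover have "Im w \<noteq> 0" using w(1) r \<sigma> w(4) by auto
    ultimately show "w \<in> G - crosscut" by (simp add: crosscut_iff)
  qed
  moreover have "base \<sigma> \<in> E"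
    unfolding E_def base_def using mid by (intro image_eqI[of _ _ "(mid, 1 / 2)"]) auto
  ultimately have "E \<subseteq> side \<sigma>"
    unfolding side_def by (intro connected_component_maximal)
  moreover have "z \<in> E"
  proof -
    have "\<bar>Re z - c\<bar> < rad c / 2" "\<bar>Im z\<bar> < rad c / 2"
      using z(1) abs_Re_le_cmod[of "z - of_real c"] abs_Im_le_cmod[of "z - of_real c"] by (auto simp: dist_norm)
    then have *: "a < Re z" "Re z < b" "\<bar>Im z\<bar> < rad (Re z)"
      using rad_le[of c] c rad_diff[of "Re z" c] by (auto simp: abs_if split: if_splits)
    have im: "Im z = \<sigma> * \<bar>Im z\<bar>" "Im z \<noteq> 0" using \<sigma> z(2) by auto
    have r: "0 < rad (Re z)" using *(3) by linarith
    show ?thesis unfolding E_def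
    proof (rule image_eqI[of _ _ "(Re z, \<bar>Im z\<bar> / rad (Re z))"])
      show "z = (case (Re z, \<bar>Im z\<bar> / rad (Re z)) of (c, s) \<Rightarrow> Complex c (\<sigma> * (s * rad c)))"
        using im r by (simp add: complex_eq_iff)
      show "(Re z, \<bar>Im z\<bar> / rad (Re z)) \<in> {a<..<b} \<times> {0<..<1}"
        using * im(2) r by simp
    qed
  qed
  ultimately show ?thesis by blast
qed

lemma base_in_side: "\<sigma> = 1 \<or> \<sigma> = - 1 \<Longrightarrow> base \<sigma> \<in> side \<sigma>"
proof -
  assume \<sigma>: "\<sigma> = 1 \<or> \<sigma> = - 1"
  have r: "0 < rad mid" using mid rad_pos by blast
  have e: "base \<sigma> - of_real mid = \<i> * of_real (\<sigma> * (rad mid / 2))" by (simp add: base_def complex_eq_iff)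
  have "dist (base \<sigma>) (of_real mid) = \<bar>\<sigma> * (rad mid / 2)\<bar>"
    unfolding dist_norm e norm_mult norm_of_real by simp
  also have "\<dots> < rad mid" using \<sigma> r by auto
  finally have "base \<sigma> \<in> G" using ball_rad by simp
  moreover have "Im (base \<sigma>) \<noteq> 0" using \<sigma> r by (auto simp: base_def)
  ultimately show ?thesis unfolding side_def by (simp add: crosscut_iff)
qed

text \<open>
  By the half discs, the two sides together with the cut form an open set; the rest of \<open>G\<close> is a
  union of components of an open set, hence open too.
\<close>

lemma sides_cover: "G \<subseteq> side 1 \<union> side (- 1) \<union> crosscut"
proof -
  define W where "W = side 1 \<union> side (- 1) \<union> crosscut"
  have "W \<subseteq> G" unfolding W_def using side_subset segment by (auto simp: crosscut_def)
  have "open W"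
    unfolding open_contains_ball
  proof
    fix z assume z: "z \<in> W"
    show "\<exists>e>0. ball z e \<subseteq> W"
    proof (cases "z \<in> crosscut")
      case True
      then obtain c where c: "a < c" "c < b" "z = of_real c" by (auto simp: crosscut_def)
      have "ball z (rad c / 2) \<subseteq> W"
      proof
        fix w assume "w \<in> ball z (rad c / 2)"
        then have w: "dist w (of_real c) < rad c / 2" using c(3) by (simp add: dist_commute)
        consider "0 < Im w" | "Im w < 0" | "Im w = 0" by linarith
        then show "w \<in> W"
        proof cases
          case 1
          then show ?thesis using half_disc_in_side[of 1 c w] c w by (simp add: W_def)
        next
          case 2
          then show ?thesis using half_disc_in_side[of "- 1" c w] c w by (simp add: W_def)
        next
          case 3
          have "\<bar>Re w - c\<bar> < rad c / 2" using w abs_Re_le_cmod[of "w - of_real c"] by (auto simp: dist_norm)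
          then have "a < Re w" "Re w < b" using rad_le[of c] c(1,2) by (auto simp: abs_if split: if_splits)
          then show ?thesis using 3 by (simp add: W_def crosscut_iff)
        qed
      qed
      then show ?thesis using rad_pos[OF c(1,2)] by (intro exI[of _ "rad c / 2"]) simp
    next
      case False
      then have "z \<in> side 1 \<union> side (- 1)" using z by (simp add: W_def)
      moreover have "open (side 1 \<union> side (- 1))" using open_side by blast
      ultimately obtain e where "e > 0" "ball z e \<subseteq> side 1 \<union> side (- 1)" using open_contains_ball by blast
      then show ?thesis unfolding W_def by blast
    qed
  qed
  have "open (G - W)"
    unfolding open_subopen[of "G - W"]
  proof
    fix z assume z: "z \<in> G - W"
    let ?Z = "connected_component_set (G - crosscut) z"
    have zs: "z \<in> G - crosscut" using z by (simp add: W_def)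
    have "?Z \<inter> side \<sigma> = {}" if "z \<notin> side \<sigma>" for \<sigma>
      using that zs unfolding side_def
      by (metis connected_component_disjoint connected_component_refl_eq mem_Collect_eq connected_component_sym)
    then have "?Z \<inter> W = {}" using z connected_component_subset[of "G - crosscut" z] unfolding W_def by blast
    then have "?Z \<subseteq> G - W" using connected_component_subset[of "G - crosscut" z] by blast
    moreover have "open ?Z" using open_slit by (rule open_connected_component)
    moreover have "z \<in> ?Z" using zs by simp
    ultimately show "\<exists>T. open T \<and> z \<in> T \<and> T \<subseteq> G - W" by blast
  qed
  moreover have "W \<inter> G \<noteq> {}"
    using base_in_side[of 1] side_subset[of 1] unfolding W_def by blast
  ultimately have "(G - W) \<inter> G = {}"
    using connected_G \<open>open W\<close> unfolding connected_def by blast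
  then show ?thesis unfolding W_def by blast
qed

text \<open>
  Otherwise a path from one side to the other, through a small disc around \<open>y\<close>, closes up to a loop
  that meets the barrier made of \<open>A\<close> and the cut only once, at the midpoint of the cut.  The two
  halves of a small circle around the midpoint serve as detours.
\<close>

lemma frontier_point_touches_one_side:
  assumes A: "connected A" "closed A" "A \<inter> G = {}" "of_real a \<in> A" "of_real b \<in> A"
    and y: "y \<notin> A" "y \<notin> G" "y \<in> closure (side 1)" "y \<in> closure (side (- 1))"
  shows False
proof -
  define K where "K = (of_real ` {a..b} :: complex set)"
  have "closed K" unfolding K_def by (rule closed_real_segment)
  have "y \<notin> K"
  proof
    assume "y \<in> K"
    then obtain t where t: "y = of_real t" "a \<le> t" "t \<le> b" by (auto simp: K_def)
    then show False using segment[of t] y(1,2) A(4,5) by (cases "t = a \<or> t = b") auto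
  qed
  then have "y \<notin> A \<union> K" "closed (A \<union> K)" using y(1) A(2) \<open>closed K\<close> by auto
  then obtain e where e: "0 < e" "ball y e \<inter> (A \<union> K) = {}"
    by (metis Compl_iff disjoint_eq_subset_Compl open_Compl open_contains_ball)
  define \<delta> where "\<delta> = rad mid / 2"
  have \<delta>: "0 < \<delta>" "\<delta> < rad mid" using rad_pos[OF mid] by (auto simp: \<delta>_def)
  obtain w1 where w1: "w1 \<in> side 1" "w1 \<in> ball y e"
    using y(3) e(1) closure_approachable[of y "side 1"] by (auto simp: dist_commute)
  obtain w2 where w2: "w2 \<in> side (- 1)" "w2 \<in> ball y e"
    using y(4) e(1) closure_approachable[of y "side (- 1)"] by (auto simp: dist_commute)
  have pc: "path_connected (side \<sigma>)" for \<sigma>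
    using open_side connected_side connected_open_path_connected by blast
  obtain g1 where g1: "path g1" "path_image g1 \<subseteq> side 1" "pathstart g1 = base 1" "pathfinish g1 = w1"
    using pc[of 1] base_in_side[of 1] w1(1) unfolding path_connected_def by blast
  obtain g2 where g2: "path g2" "path_image g2 \<subseteq> side (- 1)" "pathstart g2 = w2" "pathfinish g2 = base (- 1)"
    using pc[of "- 1"] base_in_side[of "- 1"] w2(1) unfolding path_connected_def by blast
  define L where "L = linepath w1 w2"
  have L: "path L" "pathstart L = w1" "pathfinish L = w2" "path_image L \<subseteq> ball y e"
    unfolding L_def using w1(2) w2(2) by (auto simp: closed_segment_subset)
  define g where "g = g1 +++ (L +++ g2)"
  have g: "path g" "pathstart g = base 1" "pathfinish g = base (- 1)"
      "path_image g = path_image g1 \<union> (path_image L \<union> path_image g2)"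
    unfolding g_def using L g1 g2 by (simp_all add: path_image_join)
  \<comment> \<open>The right half (\<open>\<tau> = 1\<close>) and the left half (\<open>\<tau> = - 1\<close>) of the circle, both from bottom to top.\<close>
  define c where "c \<tau> = (\<lambda>t::real. of_real mid + of_real \<delta> * cis (- pi / 2 + \<tau> * pi * t))" for \<tau> :: real
  have contc: "continuous_on {0..1} (c \<tau>)" for \<tau>
    unfolding c_def by (intro continuous_intros)
  have c: "path (c \<tau>)" "pathstart (c \<tau>) = base (- 1)" for \<tau>
    using contc by (auto simp: path_def pathstart_def c_def base_def \<delta>_def complex_eq_iff)
  have c1: "pathfinish (c 1) = base 1" "pathfinish (c (- 1)) = base 1"
  proof -
    have "- pi / 2 + 1 * pi * 1 = pi / 2" "- pi / 2 + - 1 * pi * 1 = pi / 2 - 2 * pi" by simp_all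
    moreover have "cis (pi / 2 - 2 * pi) = cis (pi / 2)"
      using cis_divide[of "pi / 2" "2 * pi"] by simp
    ultimately have "cis (- pi / 2 + 1 * pi * 1) = \<i>" "cis (- pi / 2 + - 1 * pi * 1) = \<i>"
      by (simp_all only: cis_pi_half)
    then show "pathfinish (c 1) = base 1" "pathfinish (c (- 1)) = base 1"
      unfolding pathfinish_def c_def by (simp_all add: base_def \<delta>_def complex_eq_iff)
  qed
  have cG: "path_image (c \<tau>) \<subseteq> G" for \<tau>
  proof
    fix w assume "w \<in> path_image (c \<tau>)"
    then obtain t where "w = of_real mid + of_real \<delta> * cis (- pi / 2 + \<tau> * pi * t)"
      by (auto simp: path_image_def c_def)
    then have "dist w (of_real mid) < rad mid" using \<delta> by (simp add: dist_norm norm_mult)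
    then show "w \<in> G" by (rule ball_rad)
  qed
  have coords: "\<exists>t\<in>{0..1}. Re w = mid + \<delta> * (\<tau> * sin (pi * t)) \<and> Im w = - \<delta> * cos (pi * t)"
    if w: "w \<in> path_image (c \<tau>)" and \<tau>: "\<tau> = 1 \<or> \<tau> = - 1" for w \<tau>
  proof -
    obtain t where t: "t \<in> {0..1}" "w = of_real mid + of_real \<delta> * cis (- pi / 2 + \<tau> * pi * t)"
      using w by (auto simp: path_image_def c_def)
    have "cos (- pi / 2 + \<tau> * pi * t) = \<tau> * sin (pi * t)" "sin (- pi / 2 + \<tau> * pi * t) = - cos (pi * t)"
      using \<tau> by (auto simp: cos_add sin_add cos_diff sin_diff minus_divide_left[symmetric])
    with t show ?thesis by (intro bexI[of _ t]) simp_all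
  qed
  have real_point: "0 < \<tau> * (Re w - mid)" if w: "w \<in> path_image (c \<tau>)" and \<tau>: "\<tau> = 1 \<or> \<tau> = - 1" and im: "Im w = 0" for w \<tau>
  proof -
    obtain t where t: "t \<in> {0..1}" "Re w = mid + \<delta> * (\<tau> * sin (pi * t))" "Im w = - \<delta> * cos (pi * t)"
      using coords[OF w \<tau>] by blast
    have "cos (pi * t) = 0" using t(3) im \<delta>(1) by simp
    then have "t \<noteq> 0" "t \<noteq> 1" by auto
    then have "0 < sin (pi * t)" using t(1) by (intro sin_gt_zero) auto
    then show ?thesis using t(2) \<tau> \<delta>(1) by auto
  qed
  define N1 where "N1 = (of_real ` {a<..mid} :: complex set)"
  define N2 where "N2 = (of_real ` {mid..<b} :: complex set)"
  have NK: "N1 \<subseteq> crosscut" "N2 \<subseteq> crosscut" "crosscut \<subseteq> K"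
    using mid by (auto simp: N1_def N2_def crosscut_def K_def)
  have Ng: "crosscut \<inter> path_image g = {}"
  proof -
    have "crosscut \<inter> side \<sigma> = {}" for \<sigma> using side_subset by blast
    moreover have "crosscut \<inter> ball y e = {}" using e(2) NK(3) by blast
    ultimately show ?thesis unfolding g(4) using g1(2) g2(2) L(4) by blast
  qed
  have "winding_number (c 1) (of_real mid) = winding_number (c (- 1)) (of_real mid)"
  proof (rule winding_number_detours_agree[OF g(1-3) c(1) c(2) c1(1) c(1) c(2) c1(2) A(1)])
    show "A \<inter> (path_image g \<union> path_image (c 1) \<union> path_image (c (- 1))) = {}"
      using A(3) cG e(2) g1(2) g2(2) L(4) side_subset unfolding g(4) by blast
    show "connected N1" "connected N2"
      unfolding N1_def N2_def by (auto intro!: connected_continuous_image continuous_intros)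
    show "of_real mid \<in> N1" "of_real mid \<in> N2" using mid by (auto simp: N1_def N2_def)
    have clo: "of_real t \<in> closure (of_real ` T :: complex set)" if "t \<in> closure T" for t :: real and T
    proof -
      have "of_real ` closure T \<subseteq> (closure (of_real ` T) :: complex set)"
        by (rule image_closure_subset) (auto intro!: continuous_intros closure_subset[THEN subsetD])
      then show ?thesis using that by blast
    qed
    have "a \<in> closure {a<..mid}" "b \<in> closure {mid..<b}" using mid by auto
    then have "of_real a \<in> closure N1" "of_real b \<in> closure N2" unfolding N1_def N2_def using clo by blast+
    then show "closure N1 \<inter> A \<noteq> {}" "closure N2 \<inter> A \<noteq> {}" using A(4,5) by blast+
    have "N1 \<inter> path_image (c 1) = {}" using real_point[of _ 1] by (force simp: N1_def)
    then show "N1 \<inter> (path_image g \<union> path_image (c 1)) = {}" using Ng NK(1) by blast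
    have "N2 \<inter> path_image (c (- 1)) = {}" using real_point[of _ "- 1"] by (force simp: N2_def)
    then show "N2 \<inter> (path_image g \<union> path_image (c (- 1))) = {}" using Ng NK(2) by blast
    fix k assume "k \<in> A"
    then have "k \<notin> G" using A(3) by blast
    have nz: "z - k \<noteq> 0" if "z \<in> ball (of_real mid) (rad mid)" for z
      using ball_rad[of z mid] that \<open>k \<notin> G\<close> by (auto simp: dist_commute)
    have "contractible (ball (of_real mid :: complex) (rad mid))" by (intro convex_imp_contractible convex_ball)
    moreover have "continuous_on (ball (of_real mid) (rad mid)) (\<lambda>z. z - k)" by (intro continuous_intros)
    ultimately obtain l where l: "continuous_on (ball (of_real mid) (rad mid)) l"
        "\<And>z. z \<in> ball (of_real mid) (rad mid) \<Longrightarrow> z - k = exp (l z)"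
      using continuous_logarithm_on_contractible[of "ball (of_real mid) (rad mid)" "\<lambda>z. z - k"] nz by blast
    have inb: "c \<tau> t \<in> ball (of_real mid) (rad mid)" for \<tau> t using \<delta> by (simp add: c_def dist_norm norm_mult)
    have "winding_number (c \<tau>) k = (l (c \<tau> 1) - l (c \<tau> 0)) / (2 * of_real pi * \<i>)" for \<tau>
    proof (rule winding_number_continuous_log[OF c(1)])
      show "continuous_on {0..1} (\<lambda>t. l (c \<tau> t))"
        by (rule continuous_on_compose2[OF l(1) contc]) (use inb in auto)
      show "c \<tau> t = k + exp (l (c \<tau> t))" for t using l(2)[OF inb, of \<tau> t] by (simp add: algebra_simps)
    qed
    moreover have "c 1 1 = c (- 1) 1" "c 1 0 = c (- 1) 0"
      using c1 c(2) by (simp_all add: pathfinish_def pathstart_def)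
    ultimately show "winding_number (c 1) k = winding_number (c (- 1)) k" by simp
  qed
  moreover have "winding_number (c \<tau>) (of_real mid) = of_real \<tau> / 2" for \<tau>
  proof -
    let ?l = "\<lambda>t::real. of_real (ln \<delta>) + \<i> * of_real (- pi / 2 + \<tau> * pi * t)"
    have "winding_number (c \<tau>) (of_real mid) = (?l 1 - ?l 0) / (2 * of_real pi * \<i>)"
    proof (rule winding_number_continuous_log[OF c(1)])
      show "continuous_on {0..1} ?l" by (intro continuous_intros)
      fix t :: real
      have "exp (?l t) = of_real \<delta> * cis (- pi / 2 + \<tau> * pi * t)"
        unfolding exp_add cis_conv_exp using \<delta>(1) by (simp only: exp_of_real exp_ln)
      then show "c \<tau> t = of_real mid + exp (?l t)" by (simp add: c_def)
    qed
    then show ?thesis by (simp add: field_simps)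
  qed
  ultimately show False by simp
qed

end

context disk_chart begin

text \<open>
  Koebe's lemma applied to \<open>\<phi> - e\<close>, which does not vanish at the centre.
\<close>

lemma inverse_path_lands:
  assumes e: "e \<notin> G" and w: "continuous_on {0<..1} w" "\<And>t. t \<in> {0<..1} \<Longrightarrow> w t \<in> G"
    and lim: "(w \<longlongrightarrow> e) (at_right (0::real))"
  obtains s where "norm s = 1" "((\<lambda>t. inv_chart (w t)) \<longlongrightarrow> s) (at_right 0)"
proof -
  obtain C where C: "\<And>x. x \<in> G \<Longrightarrow> norm x \<le> C" using bounded unfolding bounded_iff by blast
  have ev: "\<forall>\<^sub>F t in at_right 0. t \<in> {0<..(1::real)}"
    unfolding eventually_at_right_field by (intro exI[of _ 1]) auto
  have lim0: "((\<lambda>t. \<phi> (inv_chart (w t)) - e) \<longlongrightarrow> 0) (at_right 0)"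
  proof (rule Lim_transform_eventually)
    have "((\<lambda>t. w t - e) \<longlongrightarrow> e - e) (at_right 0)" using lim by (intro tendsto_intros)
    then show "((\<lambda>t. w t - e) \<longlongrightarrow> 0) (at_right 0)" by simp
    show "\<forall>\<^sub>F t in at_right 0. w t - e = \<phi> (inv_chart (w t)) - e"
      using ev by eventually_elim (simp add: chart_inv w(2))
  qed
  show thesis
  proof (rule asymptotic_path_lands[of "\<lambda>z. \<phi> z - e" "C + norm e" "\<lambda>t. inv_chart (w t)"])
    show "(\<lambda>z. \<phi> z - e) holomorphic_on ball 0 1" by (intro holomorphic_intros holo)
    show "norm (\<phi> z - e) \<le> C + norm e" if "z \<in> ball 0 1" for z
      using C[of "\<phi> z"] image that norm_triangle_ineq4[of "\<phi> z" e] by fastforce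
    show "\<phi> 0 - e \<noteq> 0" using e image by force
    show "continuous_on {0<..1} (\<lambda>t. inv_chart (w t))"
      by (rule continuous_on_compose2[OF inv_chart_cont w(1)]) (use w(2) in blast)
    show inb: "inv_chart (w t) \<in> ball 0 1" if "t \<in> {0<..1}" for t using inv_chart_in w(2) that by blast
    show "((\<lambda>t. \<phi> (inv_chart (w t)) - e) \<longlongrightarrow> 0) (at_right 0)" by (rule lim0)
    show "((\<lambda>t. norm (inv_chart (w t))) \<longlongrightarrow> 1) (at_right 0)"
    proof (rule order_tendstoI)
      fix r :: real assume "r < 1"
      have "compact (\<phi> ` cball 0 r)"
        by (intro compact_continuous_image continuous_on_subset[OF cont]) (use \<open>r < 1\<close> in auto)
      then have "open (- (\<phi> ` cball 0 r))" by (simp add: compact_imp_closed open_Compl)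
      moreover have "e \<in> - (\<phi> ` cball 0 r)"
      proof -
        have "cball 0 r \<subseteq> ball (0::complex) 1" using \<open>r < 1\<close> by auto
        then show ?thesis using e image by blast
      qed
      ultimately have "\<forall>\<^sub>F t in at_right 0. w t \<in> - (\<phi> ` cball 0 r)"
        using topological_tendstoD[OF lim] by blast
      then show "\<forall>\<^sub>F t in at_right 0. r < norm (inv_chart (w t))"
        using ev
      proof eventually_elim
        case (elim t)
        have "w t = \<phi> (inv_chart (w t))" using chart_inv[OF w(2)[OF elim(2)]] by simp
        then have "inv_chart (w t) \<notin> cball 0 r" using elim(1) by blast
        then show ?case by simp
      qed
    next
      fix r :: real assume "1 < r"
      show "\<forall>\<^sub>F t in at_right 0. norm (inv_chart (w t)) < r"
        using ev
      proof eventually_elim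
        case (elim t)
        then show ?case using inb[of t] \<open>1 < r\<close> by simp
      qed
    qed
  qed (rule that)
qed

text \<open>
  Since \<open>frontier G - A\<close> is connected, one side of the cut accumulates on the frontier of \<open>G\<close>
  only at points of \<open>A\<close>.  It
  remains to see that the preimage \<open>V\<close> of this side contains a one-sided neighbourhood of some
  boundary point \<open>\<zeta>\<close> of the disk.  If it did not, \<open>V\<close> would touch the unit circle only at the
  two points where the preimage of the cut lands.  Then the maximum principle that ignores these
  two points, applied to \<open>exp (- \<i> \<sigma> \<phi>)\<close>, bounds \<open>\<sigma> Im \<phi>\<close> on \<open>V\<close> by its value zero on the
  preimage of the cut, although it is positive at the base point of the side.
\<close>

lemma crosscut_cuts_off_arc:
  assumes ab: "a < b" and seg: "\<And>t. a < t \<Longrightarrow> t < b \<Longrightarrow> of_real t \<in> G"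
    and A: "closed A" "connected A" "A \<subseteq> frontier G" "of_real a \<in> A" "of_real b \<in> A"
    and conn: "connected (frontier G - A)"
  obtains \<zeta> \<epsilon> where "norm \<zeta> = 1" "0 < \<epsilon>"
    "\<And>\<xi>. norm \<xi> = 1 \<Longrightarrow> dist \<xi> \<zeta> < \<epsilon> \<Longrightarrow> impression \<phi> {\<xi>} \<subseteq> A"
proof -
  have XG: "frontier G \<inter> G = {}" using open_G frontier_disjoint_eq by blast
  interpret real_crosscut G a b
    using ab seg A XG by unfold_locales (auto intro: open_G connected_G)
  have AG: "A \<inter> G = {}" using A(3) XG by blast
  have closed_seg: "closed (of_real ` {a..b} :: complex set)"
    by (rule closed_real_segment)
  have seg_sub: "crosscut \<subseteq> of_real ` {a..b}" by (auto simp: crosscut_def)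
  have seg_X: "of_real ` {a..b} \<inter> (frontier G - A) = {}"
  proof -
    have "of_real t \<in> A \<or> of_real t \<in> G" if "t \<in> {a..b}" for t
      using that A(4,5) seg[of t] by (cases "t = a \<or> t = b") auto
    then show ?thesis using XG by blast
  qed
  have cover: "frontier G - A \<subseteq> closure (side 1) \<union> closure (side (- 1))"
  proof
    fix y assume y: "y \<in> frontier G - A"
    then have "y \<in> closure G" by (simp add: frontier_def)
    moreover have "closure G \<subseteq> closure (side 1 \<union> side (- 1) \<union> of_real ` {a..b})"
      using sides_cover seg_sub by (intro closure_mono) blast
    ultimately have "y \<in> closure (side 1) \<union> closure (side (- 1)) \<union> of_real ` {a..b}"
      using closed_seg by (auto simp: closure_Un)
    then show "y \<in> closure (side 1) \<union> closure (side (- 1))" using y seg_X by blast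
  qed
  have disj: "closure (side 1) \<inter> closure (side (- 1)) \<inter> (frontier G - A) = {}"
    using frontier_point_touches_one_side[OF A(2,1) AG A(4,5)] XG by blast
  have "\<exists>\<sigma>. (\<sigma> = 1 \<or> \<sigma> = - 1) \<and> (frontier G - A) \<inter> closure (side \<sigma>) = {}"
    using conn cover disj unfolding connected_closed by (metis Int_commute closed_closure)
  then obtain \<sigma> where \<sigma>: "\<sigma> = 1 \<or> \<sigma> = - 1" "(frontier G - A) \<inter> closure (side \<sigma>) = {}" by blast
  define V where "V = ball 0 1 \<inter> \<phi> -` side \<sigma>"
  have side_G: "side \<sigma> \<subseteq> G" using side_subset by blast
  have openV: "open V" unfolding V_def using continuous_open_preimage[OF cont open_ball open_side] .
  have Vb: "V \<subseteq> ball 0 1" by (simp add: V_def)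
  note arcI = that
  show thesis
  proof (rule ccontr)
    assume neg: "\<not> thesis"
    \<comment> \<open>A one-sided neighbourhood inside \<open>V\<close> would give the required arc of impressions.\<close>
    have no_ball: "\<not> ball \<zeta> \<epsilon> \<inter> ball 0 1 \<subseteq> V" if z: "norm \<zeta> = 1" and e: "0 < \<epsilon>" for \<zeta> \<epsilon>
    proof
      assume sub: "ball \<zeta> \<epsilon> \<inter> ball 0 1 \<subseteq> V"
      have "impression \<phi> {\<xi>} \<subseteq> A" if xi: "norm \<xi> = 1" "dist \<xi> \<zeta> < \<epsilon>" for \<xi>
      proof
        fix x assume "x \<in> impression \<phi> {\<xi>}"
        then have bg: "(\<xi>, x) \<in> boundary_graph \<phi>" by simp
        then have xX: "x \<in> frontier G" using xi(1) by (rule boundary_graph_frontier)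
        have "x \<in> closure (side \<sigma>)"
          unfolding closure_approachable
        proof (intro allI impI)
          fix d :: real assume "0 < d"
          then have "0 < min d (\<epsilon> - dist \<xi> \<zeta>)" using xi(2) by simp
          then obtain z where z: "z \<in> ball 0 1" "dist z \<xi> < min d (\<epsilon> - dist \<xi> \<zeta>)"
              "dist (\<phi> z) x < min d (\<epsilon> - dist \<xi> \<zeta>)"
            using boundary_graph_approachable[OF bg] by blast
          have "dist z \<zeta> < \<epsilon>" using z(2) dist_triangle[of z \<zeta> \<xi>] by simp
          then have "z \<in> V" using sub z(1) by (auto simp: dist_commute)
          then show "\<exists>y\<in>side \<sigma>. dist y x < d" using z(3) unfolding V_def by auto
        qed
        then show "x \<in> A" using \<sigma>(2) xX by blast
      qed
      then show False using neg arcI[OF z e] by blast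
    qed
    have landing: "\<exists>s. norm s = 1 \<and> (\<forall>t. (\<forall>n. a < t n \<and> t n < b) \<longrightarrow> t \<longlonglongrightarrow> e \<longrightarrow>
        (\<lambda>n. inv_chart (of_real (t n))) \<longlonglongrightarrow> s)" if e: "e = a \<and> c = b \<or> e = b \<and> c = a" for e c
    proof -
      let ?w = "\<lambda>u::real. complex_of_real (e + u * (c - e) / 2)"
      have inside: "a < e + u * (c - e) / 2 \<and> e + u * (c - e) / 2 < b" if u: "u \<in> {0<..1}" for u
      proof -
        define v where "v = u * (b - a)"
        have "0 < v" "v \<le> 1 * (b - a)" unfolding v_def using u ab by (simp, intro mult_right_mono) auto
        moreover have "u * (c - e) = v \<and> e = a \<or> u * (c - e) = - v \<and> e = b"
          using e by (auto simp: v_def algebra_simps)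
        ultimately show ?thesis using ab by auto
      qed
      obtain s where s: "norm s = 1" "((\<lambda>u. inv_chart (?w u)) \<longlongrightarrow> s) (at_right 0)"
      proof (rule inverse_path_lands[of "of_real e" ?w])
        show "(?w \<longlongrightarrow> of_real e) (at_right 0)" by (auto intro!: tendsto_eq_intros)
        show "continuous_on {0<..1} ?w" by (intro continuous_intros) auto
        show "?w u \<in> G" if "u \<in> {0<..1}" for u using inside[OF that] by (intro seg) auto
      qed (use ends e in auto)
      have "(\<lambda>n. inv_chart (of_real (t n))) \<longlonglongrightarrow> s" if t: "\<forall>n. a < t n \<and> t n < b" "t \<longlonglongrightarrow> e" for t
      proof -
        have ce: "c - e \<noteq> 0" using e ab by auto
        have "(\<lambda>n. 2 * (t n - e) / (c - e)) \<longlonglongrightarrow> 2 * (e - e) / (c - e)"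
          using t(2) ce by (intro tendsto_intros) auto
        moreover have "0 < 2 * (t n - e) / (c - e)" for n
          using e t(1) ab by (auto simp: zero_less_divide_iff)
        ultimately have "filterlim (\<lambda>n. 2 * (t n - e) / (c - e)) (at_right 0) sequentially"
          by (intro tendsto_imp_filterlim_at_right) auto
        then have "(\<lambda>n. inv_chart (?w (2 * (t n - e) / (c - e)))) \<longlonglongrightarrow> s"
          by (rule filterlim_compose[OF s(2)])
        moreover have "?w (2 * (t n - e) / (c - e)) = of_real (t n)" for n
        proof -
          have "2 * (t n - e) / (c - e) * (c - e) / 2 = t n - e" using ce by simp
          then show ?thesis by (simp only:) simp
        qed
        ultimately show ?thesis by (simp only:)
      qed
      with s(1) show ?thesis by blast
    qed
    obtain s1 where s1: "norm s1 = 1" "\<And>t. \<forall>n. a < t n \<and> t n < b \<Longrightarrow> t \<longlonglongrightarrow> a \<Longrightarrow>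
        (\<lambda>n. inv_chart (of_real (t n))) \<longlonglongrightarrow> s1" using landing[of a b] by blast
    obtain s2 where s2: "norm s2 = 1" "\<And>t. \<forall>n. a < t n \<and> t n < b \<Longrightarrow> t \<longlonglongrightarrow> b \<Longrightarrow>
        (\<lambda>n. inv_chart (of_real (t n))) \<longlonglongrightarrow> s2" using landing[of b a] by blast
    have clV: "closure V \<subseteq> ball 0 1 \<union> {s1, s2}"
    proof (rule ccontr)
      assume "\<not> ?thesis"
      then obtain z where z: "z \<in> closure V" "z \<notin> ball 0 1" "z \<noteq> s1" "z \<noteq> s2" by blast
      have "closure V \<subseteq> cball 0 1" using Vb by (intro closure_minimal) auto
      then have nz: "norm z = 1" using z by auto
      have "\<exists>\<epsilon>>0. ball z \<epsilon> \<inter> inv_chart ` crosscut = {}"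
      proof (rule ccontr)
        assume "\<not> ?thesis"
        then have "\<forall>\<epsilon>>0. ball z \<epsilon> \<inter> inv_chart ` crosscut \<noteq> {}" by blast
        then have "z \<in> closure (inv_chart ` crosscut)"
          unfolding closure_approachable by (metis disjoint_iff mem_ball dist_commute)
        then obtain v where v: "\<forall>n. v n \<in> inv_chart ` crosscut" "v \<longlonglongrightarrow> z"
          unfolding closure_sequential by blast
        then have "\<forall>n. \<exists>t. a < t \<and> t < b \<and> v n = inv_chart (of_real t)"
          unfolding crosscut_def by fastforce
        then obtain t where t: "\<And>n. a < t n" "\<And>n. t n < b" "\<And>n. v n = inv_chart (of_real (t n))" by metis
        have "\<forall>n. t n \<in> {a..b}" using t(1,2) by (meson atLeastAtMost_iff less_imp_le)
        then obtain l r where r: "l \<in> {a..b}" "strict_mono r" "(t \<circ> r) \<longlonglongrightarrow> l"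
          using compact_Icc[of a b] unfolding compact_def by metis
        have vr: "(\<lambda>n. inv_chart (of_real (t (r n)))) \<longlonglongrightarrow> z"
          using LIMSEQ_subseq_LIMSEQ[OF v(2) r(2)] t(3) by (simp add: o_def)
        have tr: "(\<lambda>n. t (r n)) \<longlonglongrightarrow> l" using r(3) by (simp add: o_def)
        consider "a < l" "l < b" | "l = a" | "l = b" using r(1) by fastforce
        then show False
        proof cases
          case 1
          have "(\<lambda>n. inv_chart (of_real (t (r n)))) \<longlonglongrightarrow> inv_chart (of_real l)"
            by (rule continuous_on_tendsto_compose[OF inv_chart_cont])
               (use tr seg 1 t(1,2) in \<open>auto intro!: tendsto_intros\<close>)
          then have "z = inv_chart (of_real l)" using vr LIMSEQ_unique by blast
          then have "z \<in> ball 0 1" using inv_chart_in seg[OF 1] by simp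
          then show False using z(2) by simp
        next
          case 2
          have "(\<lambda>n. inv_chart (of_real (t (r n)))) \<longlonglongrightarrow> s1"
            by (rule s1(2)) (use t tr 2 in auto)
          then show False using vr z(3) LIMSEQ_unique by blast
        next
          case 3
          have "(\<lambda>n. inv_chart (of_real (t (r n)))) \<longlonglongrightarrow> s2"
            by (rule s2(2)) (use t tr 3 in auto)
          then show False using vr z(4) LIMSEQ_unique by blast
        qed
      qed
      then obtain \<epsilon> where eps: "0 < \<epsilon>" "ball z \<epsilon> \<inter> inv_chart ` crosscut = {}" by blast
      let ?B = "ball z \<epsilon> \<inter> ball 0 1"
      obtain v where v: "v \<in> V" "dist v z < \<epsilon>" using z(1) eps(1) closure_approachable by blast
      have "connected (\<phi> ` ?B)"
        by (rule connected_continuous_image[OF continuous_on_subset[OF cont]])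
           (auto intro: convex_connected convex_Int)
      moreover have "\<phi> ` ?B \<subseteq> G - crosscut"
      proof
        fix x assume "x \<in> \<phi> ` ?B"
        then obtain y where y: "y \<in> ball z \<epsilon>" "y \<in> ball 0 1" "x = \<phi> y" by blast
        have "x \<notin> crosscut" using eps(2) y inv_chart[OF y(2)] by (metis IntI empty_iff imageI)
        then show "x \<in> G - crosscut" using y image by blast
      qed
      moreover have "\<phi> v \<in> \<phi> ` ?B" using v Vb by (auto simp: dist_commute)
      moreover have "\<phi> v \<in> side \<sigma>" using v(1) by (simp add: V_def)
      ultimately have "\<phi> ` ?B \<subseteq> side \<sigma>"
        unfolding side_def by (metis connected_component_maximal connected_component_eq)
      then have "?B \<subseteq> V" unfolding V_def by blast
      then show False using no_ball[OF nz eps(1)] by blast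
    qed
    obtain C where C: "\<And>x. x \<in> G \<Longrightarrow> norm x \<le> C" using bounded unfolding bounded_iff by blast
    define f where "f z = exp (- \<i> * of_real \<sigma> * \<phi> z)" for z
    have nf: "norm (f z) = exp (\<sigma> * Im (\<phi> z))" for z by (simp add: f_def)
    let ?z0 = "inv_chart (base \<sigma>)"
    have bG: "base \<sigma> \<in> G" using base_in_side[OF \<sigma>(1)] side_G by blast
    have "norm (f ?z0) \<le> 1"
    proof (rule extended_maximum_two_points[of V s1 s2 f "exp C" ?z0, OF openV Vb s1(1) s2(1) clV])
      show "f holomorphic_on ball 0 1" unfolding f_def by (intro holomorphic_intros holo)
      show "norm (f z) \<le> exp C" if "z \<in> ball 0 1" for z
      proof -
        have "norm (\<phi> z) \<le> C" using C image that by blast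
        then have "\<bar>Im (\<phi> z)\<bar> \<le> C" using abs_Im_le_cmod order_trans by blast
        then show ?thesis unfolding nf using \<sigma>(1) by auto
      qed
      show "?z0 \<in> V" unfolding V_def
        using inv_chart_in[OF bG] chart_inv[OF bG] base_in_side[OF \<sigma>(1)] by simp
      fix z assume z: "z \<in> frontier V" "z \<in> ball 0 1"
      have "\<phi> z \<in> crosscut"
      proof (rule ccontr)
        assume "\<phi> z \<notin> crosscut"
        then have zS: "\<phi> z \<in> G - crosscut" using z(2) image by blast
        let ?Z = "connected_component_set (G - crosscut) (\<phi> z)"
        have "open (ball 0 1 \<inter> \<phi> -` ?Z)"
          by (rule continuous_open_preimage[OF cont open_ball open_connected_component[OF open_slit]])
        moreover have "z \<in> ball 0 1 \<inter> \<phi> -` ?Z" using z(2) zS by simp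
        moreover have "z \<in> closure V" "z \<notin> V" using z(1) openV by (auto simp: frontier_def interior_open)
        ultimately obtain v where v: "v \<in> V" "v \<in> ball 0 1 \<inter> \<phi> -` ?Z"
          by (meson closure_iff_nhds_not_empty disjoint_iff subset_refl)
        have "\<phi> v \<in> side \<sigma>" "\<phi> v \<in> ?Z" using v by (auto simp: V_def)
        then have "?Z = side \<sigma>" unfolding side_def by (metis connected_component_eq)
        then have "\<phi> z \<in> side \<sigma>" using zS by (metis connected_component_refl_eq mem_Collect_eq)
        then show False using \<open>z \<notin> V\<close> z(2) by (simp add: V_def)
      qed
      then show "norm (f z) \<le> 1" unfolding nf by (simp add: crosscut_iff)
    qed
    then have "\<sigma> * Im (base \<sigma>) \<le> 0" unfolding nf chart_inv[OF bG] by simp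
    then show False using \<sigma>(1) rad_pos[OF mid] by (auto simp: base_def)
  qed
qed

end

section \<open>Arcs of impressions\<close>

lemma real_interval_in_open_set:
  fixes H :: "complex set"
  assumes H: "open H" "bounded H" and y: "of_real y \<in> H"
  obtains a b where "a < y" "y < b" "of_real a \<in> frontier H" "of_real b \<in> frontier H"
    "\<And>t. a < t \<Longrightarrow> t < b \<Longrightarrow> of_real t \<in> H"
proof -
  obtain C where C: "\<And>z. z \<in> H \<Longrightarrow> norm z \<le> C" using H(2) unfolding bounded_iff by blast
  define P where "P = {t. of_real t \<notin> H}"
  have contr: "continuous_on UNIV (of_real :: real \<Rightarrow> complex)" by (intro continuous_intros)
  have "open (of_real -` H :: real set)" using open_vimage[OF H(1) contr] .
  moreover have "P = - (of_real -` H)" by (auto simp: P_def)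
  ultimately have "closed P" by (simp add: closed_Compl)
  have far: "s \<in> P" if "\<bar>C\<bar> < \<bar>s\<bar>" for s
    using C[of "of_real s"] that by (auto simp: P_def)
  have P: "- (\<bar>C\<bar> + 1) \<in> P" "\<bar>C\<bar> + 1 \<in> P" by (rule far, simp)+
  have yC: "\<bar>y\<bar> \<le> C" using C[OF y] by simp
  define a where "a = Sup (P \<inter> {..y})"
  define b where "b = Inf (P \<inter> {y..})"
  have a: "a \<in> P \<inter> {..y}" unfolding a_def
    by (rule closed_contains_Sup) (use P yC \<open>closed P\<close> in \<open>auto intro!: exI[of _ "- (\<bar>C\<bar> + 1)"] closed_Int\<close>)
  have b: "b \<in> P \<inter> {y..}" unfolding b_def
    by (rule closed_contains_Inf) (use P yC \<open>closed P\<close> in \<open>auto intro!: exI[of _ "\<bar>C\<bar> + 1"] closed_Int\<close>)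
  have yP: "y \<notin> P" using y by (simp add: P_def)
  have ay: "a < y" "y < b" using a b yP by (auto simp: less_le)
  have inH: "of_real t \<in> H" if "a < t" "t < b" for t
  proof (rule ccontr)
    assume "of_real t \<notin> H"
    then have tP: "t \<in> P" by (simp add: P_def)
    show False
    proof (cases "t \<le> y")
      case True
      then have "t \<le> a" unfolding a_def using tP by (intro cSup_upper) auto
      then show False using that by simp
    next
      case False
      then have "b \<le> t" unfolding b_def using tP by (intro cInf_lower) auto
      then show False using that by simp
    qed
  qed
  have clo: "of_real ` closure {a<..<b} \<subseteq> closure H"
    by (rule image_closure_subset) (use inH in \<open>auto intro!: continuous_intros closure_subset[THEN subsetD]\<close>)
  have "a < b" using ay by simp
  then have "of_real a \<in> closure H" "of_real b \<in> closure H" using clo by auto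
  moreover have "of_real a \<notin> H" "of_real b \<notin> H" using a b by (auto simp: P_def)
  ultimately show thesis using that[OF ay _ _ inH] H(1) by (simp add: frontier_def interior_open)
qed

lemma cis_image_full: "cis ` {c..c + 2 * pi} = sphere 0 1"
proof (intro subset_antisym subsetI)
  fix z :: complex assume "z \<in> sphere 0 1"
  then have z: "z = cis (Arg z)" using rcis_cmod_Arg[of z] by (simp add: rcis_def)
  define f where "f = frac ((Arg z - c) / (2 * pi))"
  have "c + 2 * pi * f = Arg z + 2 * pi * of_int (- \<lfloor>(Arg z - c) / (2 * pi)\<rfloor>)"
    by (simp add: f_def frac_def field_simps)
  then have "cis (c + 2 * pi * f) = cis (Arg z) * cis (2 * pi * of_int (- \<lfloor>(Arg z - c) / (2 * pi)\<rfloor>))"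
    by (simp only: cis_mult)
  also have "cis (2 * pi * of_int (- \<lfloor>(Arg z - c) / (2 * pi)\<rfloor>)) = 1"
    by (rule cis_multiple_2pi) auto
  finally have "z = cis (c + 2 * pi * f)" using z by simp
  moreover have "0 \<le> f" "f \<le> 1" by (auto simp: f_def less_imp_le frac_lt_1)
  then have "c + 2 * pi * f \<in> {c..c + 2 * pi}" by (simp add: mult_left_le)
  ultimately show "z \<in> cis ` {c..c + 2 * pi}" by blast
qed auto

lemma cis_add_2pi: "cis (t + 2 * pi) = cis t"
  by (simp add: cis_mult[symmetric])

context disk_chart begin

definition arc_impression :: "real \<Rightarrow> real \<Rightarrow> complex set" where
  "arc_impression a b = impression \<phi> (cis ` {a..b})"

lemma arc_impression_iff:
  "x \<in> arc_impression a b \<longleftrightarrow> (\<exists>t. a \<le> t \<and> t \<le> b \<and> x \<in> arc_impression t t)"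
  unfolding arc_impression_def by force

lemma arc_impression_mono: "a \<le> a' \<Longrightarrow> b' \<le> b \<Longrightarrow> arc_impression a' b' \<subseteq> arc_impression a b"
  unfolding arc_impression_def by (intro Image_mono image_mono) auto

lemma arc_impression_Un: "a \<le> b \<Longrightarrow> b \<le> c \<Longrightarrow> arc_impression a b \<union> arc_impression b c = arc_impression a c"
  unfolding arc_impression_def Image_Un[symmetric] image_Un[symmetric] by (simp add: ivl_disj_un)

lemma arc_impression_full: "arc_impression a (a + 2 * pi) = frontier G"
  unfolding arc_impression_def cis_image_full by (rule impression_sphere)

lemma arc_impression_subset: "arc_impression a b \<subseteq> frontier G"
  unfolding arc_impression_def by (rule impression_subset) auto

lemma arc_impression_point_shift: "arc_impression (t + 2 * pi) (t + 2 * pi) = arc_impression t t"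
  by (simp add: arc_impression_def cis_add_2pi)

lemma closed_arc_impression: "closed (arc_impression a b)"
  unfolding arc_impression_def
  by (intro closed_impression compact_imp_closed compact_continuous_image continuous_intros) auto

lemma connected_arc_impression: "connected (arc_impression a b)"
  unfolding arc_impression_def
proof (rule connected_impression)
  show "closed (cis ` {a..b})"
    by (intro compact_imp_closed compact_continuous_image continuous_intros) auto
  show "connected (cis ` {a..b})"
    by (intro connected_continuous_image continuous_intros) auto
qed auto

lemma arc_impression_nonempty: "arc_impression t t \<noteq> {}"
  unfolding arc_impression_def using impression_nonempty[of "cis t"] by simp

lemma frontier_nonempty: "frontier G \<noteq> {}"
  using arc_impression_nonempty[of 0] arc_impression_subset[of 0 0] by blast

lemma connected_frontier: "connected (frontier G)"
  using connected_arc_impression[of 0 "0 + 2 * pi"] unfolding arc_impression_full .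

end

text \<open>
  The map sends the circle of radius \<open>r\<close> around \<open>x\<close> to the real line, with \<open>q\<close> going to
  infinity.
\<close>

lemma cayley_real_iff:
  assumes "z \<noteq> q" "q \<noteq> x" "norm (q - x) = r"
  shows "Im (- \<i> * ((q - x) / (z - q) + 1 / 2)) = 0 \<longleftrightarrow> norm (z - x) = r"
proof -
  define v where "v = (z - x) / (q - x)"
  have c: "q - x \<noteq> 0" using assms by simp
  have v1: "v - 1 \<noteq> 0" using assms by (simp add: v_def field_simps)
  have "(q - x) / (z - q) = 1 / (v - 1)" using c v1 assms by (simp add: v_def field_simps)
  then have e1: "Im (- \<i> * ((q - x) / (z - q) + 1 / 2)) = - (Re (1 / (v - 1)) + 1 / 2)" by simp
  have e2: "Re (1 / (v - 1)) = (Re v - 1) / (norm (v - 1))\<^sup>2"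
    unfolding Re_divide cmod_power2 by simp
  have N: "0 < (norm (v - 1))\<^sup>2" using v1 by simp
  have "- ((Re v - 1) / n + 1 / 2) = 0 \<longleftrightarrow> 2 * (1 - Re v) = n" if "0 < n" for n :: real
    using that by (auto simp: field_simps)
  from this[OF N] have *: "Im (- \<i> * ((q - x) / (z - q) + 1 / 2)) = 0 \<longleftrightarrow> 2 * (1 - Re v) = (norm (v - 1))\<^sup>2"
    unfolding e1 e2 .
  have "(norm (v - 1))\<^sup>2 = (norm v)\<^sup>2 - 2 * Re v + 1"
    unfolding cmod_power2 by (simp add: power2_eq_square algebra_simps)
  then have "2 * (1 - Re v) = (norm (v - 1))\<^sup>2 \<longleftrightarrow> (norm v)\<^sup>2 = 1" by auto
  also have "\<dots> \<longleftrightarrow> norm v = 1" by (simp add: power2_eq_1_iff) (use norm_ge_zero[of v] in linarith)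
  also have "\<dots> \<longleftrightarrow> norm (z - x) = r" using assms(3) c by (auto simp: v_def norm_divide)
  finally show ?thesis using * by simp
qed

locale irreducible_chart = disk_chart + irr: irreducible_frontier G w0 b for w0 b
begin

text \<open>
  A small circle around \<open>x\<close> meets \<open>G\<close> and also contains a point \<open>q\<close> outside \<open>closure G\<close>.
  The Moebius map sending \<open>q\<close> to infinity and the circle to the real line makes a component of
  the circle inside \<open>G\<close> a bounded real interval.  The end points of this crosscut lie in
  \<open>A\<close>, so \<open>crosscut_cuts_off_arc\<close> applies to the transformed chart.
\<close>

lemma impressions_in_neighborhood:
  assumes A: "closed A" "connected A" "A \<subseteq> frontier G"
    and x: "x \<in> frontier G" "0 < R" "ball x R \<inter> frontier G \<subseteq> A"
  obtains t where "arc_impression t t \<subseteq> A"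
proof -
  have xw: "x \<noteq> w0" using x(1) irr.w0 irr.frontier_Int by blast
  have xb: "x \<noteq> b" using x(1) irr.b by (auto simp: frontier_def)
  define r where "r = min R (min (dist x w0) (dist x b)) / 2"
  have "0 < dist x w0" "0 < dist x b" using xw xb by simp_all
  then have r: "0 < r" "r < R" "r < dist x w0" "r < dist x b"
    using x(2) unfolding r_def by linarith+
  obtain g where g: "g \<in> G" "g \<in> sphere x r" using irr.small_circle_meets_both_sides(1)[OF x(1) r(1,3,4)] by blast
  obtain q where q: "q \<notin> closure G" "q \<in> sphere x r" using irr.small_circle_meets_both_sides(2)[OF x(1) r(1,3,4)] by blast
  have qx: "q \<noteq> x" "norm (q - x) = r" using q(2) r(1) by (auto simp: dist_norm norm_minus_commute)
  \<comment> \<open>This is the map of \<open>cayley_real_iff\<close>; it is finite and injective on \<open>closure G\<close>.\<close>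
  define Y where "Y z = - \<i> * ((q - x) / (z - q) + 1 / 2)" for z
  have Yinj: "z = w" if "Y z = Y w" "z \<noteq> q" "w \<noteq> q" for z w
  proof -
    have "(q - x) / (z - q) = (q - x) / (w - q)" using that(1) by (simp add: Y_def)
    then have "q - x = 0 \<or> z - q = w - q" by (simp only: divide_cancel_left)
    then show ?thesis using qx(1) by simp
  qed
  have clq: "z \<noteq> q" if "z \<in> closure G" for z using q(1) that by blast
  have Gq: "z \<noteq> q" if "z \<in> G" for z using clq closure_subset that by blast
  have \<phi>q: "\<phi> z - q \<noteq> 0" if "z \<in> ball 0 1" for z
  proof -
    have "\<phi> z \<in> G" using image that by blast
    then show ?thesis using Gq by auto
  qed
  have Ycont: "continuous_on (closure G) Y" unfolding Y_def
    by (intro continuous_intros) (use clq in auto)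
  have compG: "compact (closure G)" using bounded by (simp add: compact_closure)
  have clY: "closure (Y ` G) = Y ` closure G"
  proof
    show "closure (Y ` G) \<subseteq> Y ` closure G"
      using compact_continuous_image[OF Ycont compG] closure_subset
      by (intro closure_minimal compact_imp_closed image_mono) auto
    show "Y ` closure G \<subseteq> closure (Y ` G)"
      by (rule image_closure_subset[OF Ycont]) (auto simp: closure_subset)
  qed
  interpret Y: disk_chart "Y \<circ> \<phi>" "Y ` G"
  proof
    show "Y \<circ> \<phi> holomorphic_on ball 0 1"
      unfolding Y_def o_def
      by (intro holomorphic_intros holo) (use \<phi>q in auto)
    show "bij_betw (Y \<circ> \<phi>) (ball 0 1) (Y ` G)"
      by (rule bij_betw_trans[OF bij]) (use Yinj Gq in \<open>auto simp: bij_betw_def inj_on_def\<close>)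
    show "bounded (Y ` G)"
      using compact_imp_bounded[OF compact_continuous_image[OF Ycont compG]] closure_subset
      by (meson bounded_subset image_mono)
  qed
  have frY: "frontier (Y ` G) = Y ` frontier G"
  proof -
    have "Y ` closure G - Y ` G = Y ` (closure G - G)"
      using Yinj clq closure_subset by blast
    then show ?thesis
      using clY Y.open_G open_G by (simp add: frontier_def interior_open)
  qed
  have frsub: "frontier G \<subseteq> closure G" by (simp add: frontier_def)
  have Ycircle: "Im (Y z) = 0 \<longleftrightarrow> z \<in> sphere x r" if "z \<noteq> q" for z
    unfolding Y_def using cayley_real_iff[OF that qx] by (simp add: dist_norm norm_minus_commute)
  have "Y g = of_real (Re (Y g))" using Ycircle[OF Gq[OF g(1)]] g(2) by (simp add: complex_eq_iff)
  then have "of_real (Re (Y g)) \<in> Y ` G" using g(1) by (metis imageI)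
  then obtain \<alpha> \<beta> where "\<alpha> < Re (Y g)" "Re (Y g) < \<beta>"
      and ab: "of_real \<alpha> \<in> frontier (Y ` G)" "of_real \<beta> \<in> frontier (Y ` G)"
        "\<And>t. \<alpha> < t \<Longrightarrow> t < \<beta> \<Longrightarrow> of_real t \<in> Y ` G"
    by (rule real_interval_in_open_set[OF Y.open_G Y.bounded]) blast
  then have "\<alpha> < \<beta>" by simp
  have endA: "of_real t \<in> Y ` A" if t: "of_real t \<in> frontier (Y ` G)" for t :: real
  proof -
    obtain z where z: "z \<in> frontier G" "of_real t = Y z" using t frY by blast
    have "Im (Y z) = 0" using z(2) by (metis Im_complex_of_real)
    then have "z \<in> sphere x r" using Ycircle clq frsub z(1) by blast
    then have "z \<in> ball x R" using r(2) by simp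
    then show ?thesis using z x(3) by blast
  qed
  have compA: "compact A" using A compact_Int_closed[OF irr.compact_frontier A(1)] by (simp add: Int_absorb1)
  have YcontA: "continuous_on A Y" using Ycont A(3) frsub continuous_on_subset by blast
  have diff: "frontier (Y ` G) - Y ` A = Y ` (frontier G - A)"
    unfolding frY using Yinj clq frsub A(3) by blast
  have conn: "connected (frontier (Y ` G) - Y ` A)"
    unfolding diff
  proof (rule connected_continuous_image)
    show "continuous_on (frontier G - A) Y" using Ycont frsub by (meson Diff_subset continuous_on_subset order_trans)
    show "connected (frontier G - A)" by (rule irr.connected_frontier_Diff[OF A])
  qed
  obtain \<zeta> \<epsilon> where ze: "norm \<zeta> = 1" "0 < \<epsilon>"
      "\<And>\<xi>. norm \<xi> = 1 \<Longrightarrow> dist \<xi> \<zeta> < \<epsilon> \<Longrightarrow> impression (Y \<circ> \<phi>) {\<xi>} \<subseteq> Y ` A"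
  proof (rule Y.crosscut_cuts_off_arc[OF \<open>\<alpha> < \<beta>\<close> ab(3) _ _ _ _ _ conn])
    show "closed (Y ` A)" using compact_continuous_image[OF YcontA compA] compact_imp_closed by blast
    show "connected (Y ` A)" using connected_continuous_image[OF YcontA A(2)] .
    show "Y ` A \<subseteq> frontier (Y ` G)" unfolding frY using A(3) by blast
    show "of_real \<alpha> \<in> Y ` A" "of_real \<beta> \<in> Y ` A" using endA ab by blast+
  qed blast+
  have "impression \<phi> {\<zeta>} \<subseteq> A"
  proof
    fix y assume "y \<in> impression \<phi> {\<zeta>}"
    then have bg: "(\<zeta>, y) \<in> boundary_graph \<phi>" by simp
    obtain z where z: "\<forall>n. z n \<in> ball 0 1" "z \<longlonglongrightarrow> \<zeta>" "(\<lambda>n. \<phi> (z n)) \<longlonglongrightarrow> y"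
      by (rule boundary_graph_sequentialE[OF bg])
    have ycl: "y \<in> closure G" using boundary_graph_domain[OF bg] by simp
    have zcl: "\<phi> (z n) \<in> closure G" for n using z(1) image closure_subset by blast
    have "(\<lambda>n. Y (\<phi> (z n))) \<longlonglongrightarrow> Y y"
      by (rule continuous_on_tendsto_compose[OF Ycont z(3) ycl]) (use zcl in auto)
    then have "(\<zeta>, Y y) \<in> boundary_graph (Y \<circ> \<phi>)"
      unfolding boundary_graph_sequential using z by (intro exI[of _ z]) auto
    then have "Y y \<in> Y ` A" using ze(1,2) ze(3)[of \<zeta>] by auto
    then obtain y' where "y' \<in> A" "Y y = Y y'" by blast
    then show "y \<in> A" using Yinj[of y y'] clq ycl A(3) frsub by blast
  qed
  moreover obtain t where "\<zeta> = cis t" using cis_image_full[of 0] ze(1) by (metis imageE mem_sphere_0)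
  ultimately show thesis using that[of t] by (simp add: arc_impression_def)
qed

text \<open>
  By \<open>rays_separate\<close> the two complementary arcs of impressions have no common point off \<open>K\<close>.  They
  cover the frontier, and the complement of \<open>K\<close> in the frontier is connected.
\<close>

lemma arc_dichotomy:
  assumes K: "closed K" "connected K" "K \<subseteq> frontier G"
    and c: "c < c'" "c' < c + 2 * pi" and IK: "arc_impression c c \<subseteq> K" "arc_impression c' c' \<subseteq> K"
  shows "arc_impression c c' \<subseteq> K \<or> arc_impression c' (c + 2 * pi) \<subseteq> K"
proof -
  let ?P = "arc_impression c c'" and ?Q = "arc_impression c' (c + 2 * pi)"
  have cover: "?P \<union> ?Q = frontier G"
    using arc_impression_Un[of c c' "c + 2 * pi"] c arc_impression_full by simp
  have disj: "?P \<inter> ?Q \<inter> (frontier G - K) = {}"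
  proof (rule ccontr)
    assume "?P \<inter> ?Q \<inter> (frontier G - K) \<noteq> {}"
    then obtain y where y: "y \<in> ?P" "y \<in> ?Q" "y \<notin> K" by blast
    obtain e where e: "c \<le> e" "e \<le> c'" "y \<in> arc_impression e e" using y(1) arc_impression_iff by blast
    obtain e' where e': "c' \<le> e'" "e' \<le> c + 2 * pi" "y \<in> arc_impression e' e'" using y(2) arc_impression_iff by blast
    have "e \<noteq> c" "e \<noteq> c'" "e' \<noteq> c'" "e' \<noteq> c + 2 * pi"
      using IK y(3) e(3) e'(3) arc_impression_point_shift by blast+
    then have "y \<in> K"
      using e e' by (intro rays_separate[OF K c _ _ _ _ _ _ _ , where e = e and e' = e'])
        (use IK in \<open>auto simp: arc_impression_def\<close>)
    with y(3) show False ..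
  qed
  have "connected (frontier G - K)" by (rule irr.connected_frontier_Diff[OF K])
  then have "?P \<inter> (frontier G - K) = {} \<or> ?Q \<inter> (frontier G - K) = {}"
    using disj cover closed_arc_impression[of c c'] closed_arc_impression[of c' "c + 2 * pi"]
    unfolding connected_closed by (metis Diff_subset)
  then show ?thesis using arc_impression_subset by blast
qed

text \<open>
  If the impressions at \<open>c\<close> and \<open>c'\<close> meet, their union \<open>K\<close> is a continuum, and one of the two
  complementary arcs of impressions reduces to \<open>K\<close>.  The frontier is then a union of two proper
  continua that intersect in the connected set \<open>K\<close>.
\<close>

lemma impressions_disjoint:
  assumes proper: "\<And>a b. b < a + 2 * pi \<Longrightarrow> arc_impression a b \<noteq> frontier G"
    and c: "c < c'" "c' < c + 2 * pi"
  shows "arc_impression c c \<inter> arc_impression c' c' = {}"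
proof (rule ccontr)
  assume ne: "arc_impression c c \<inter> arc_impression c' c' \<noteq> {}"
  define K where "K = arc_impression c c \<union> arc_impression c' c'"
  let ?P = "arc_impression c c'" and ?Q = "arc_impression c' (c + 2 * pi)"
  have K: "closed K" "connected K" "K \<subseteq> frontier G"
    unfolding K_def using ne closed_arc_impression connected_arc_impression arc_impression_subset
    by (auto intro!: connected_Un)
  have cover: "?P \<union> ?Q = frontier G"
    using arc_impression_Un[of c c' "c + 2 * pi"] c arc_impression_full by simp
  have "arc_impression c c \<subseteq> ?P" by (rule arc_impression_mono) (use c in simp_all)
  moreover have "arc_impression c' c' \<subseteq> ?P" by (rule arc_impression_mono) (use c in simp_all)
  moreover have "arc_impression c' c' \<subseteq> ?Q" by (rule arc_impression_mono) (use c in simp_all)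
  moreover have "arc_impression c c \<subseteq> ?Q"
    using arc_impression_mono[of c' "c + 2 * pi" "c + 2 * pi" "c + 2 * pi"] c arc_impression_point_shift by simp
  ultimately have "K \<subseteq> ?P \<inter> ?Q" unfolding K_def by blast
  moreover have "?P \<subseteq> K \<or> ?Q \<subseteq> K"
    by (rule arc_dichotomy[OF K c]) (auto simp: K_def)
  ultimately have "?P \<inter> ?Q = K" by blast
  moreover have "\<not> connected (?P \<inter> ?Q)"
  proof (rule irr.Int_not_connected)
    show "?P \<subset> frontier G" using proper[of c' c] c arc_impression_subset by blast
    show "?Q \<subset> frontier G" using proper[of "c + 2 * pi" c'] c arc_impression_subset by (simp add: psubset_eq)
  qed (use cover closed_arc_impression in auto)
  ultimately show False using K(2) by simp
qed

end

section \<open>The dichotomy\<close>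

locale siegel_chart = rotating_chart + irreducible_chart
begin

lemma arc_full_translate:
  "arc_impression r s = frontier G \<Longrightarrow> arc_impression (r + t) (s + t) = frontier G"
  unfolding arc_impression_def by (rule full_arc_translate)

lemma arc_inclusion_translate:
  assumes "\<And>s. u < s \<Longrightarrow> s < v \<Longrightarrow> arc_impression s s \<subseteq> arc_impression l r" "u < s" "s < v"
  shows "arc_impression (s + t) (s + t) \<subseteq> arc_impression (l + t) (r + t)"
  using inclusion_translate[of u v l r s t] assms by (simp add: arc_impression_def)

text \<open>
  The dichotomy fills in one of the two arcs between \<open>a\<close> and \<open>a + e\<close>, so the impressions just beyond
  one end of the short arc already lie in the impression of the short arc.  By rotation this
  holds at every position, so the impressions of the successive arcs of length \<open>\<delta>\<close> form a
  monotone chain.  Finitely many of them cover the frontier, and the largest one is the whole of it.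
\<close>

lemma no_far_inclusion:
  assumes \<delta>: "0 < \<delta>" and e: "2 * \<delta> \<le> e" "e \<le> 2 * pi - 3 * \<delta>"
    and proper: "\<And>t. arc_impression (t - \<delta>) t \<noteq> frontier G"
    and sub: "arc_impression (a + e) (a + e) \<subseteq> arc_impression (a - \<delta>) a"
  shows False
proof -
  let ?K = "arc_impression (a - \<delta>) a" and ?N = "\<lambda>t. arc_impression (t - \<delta>) t"
  obtain n :: nat where n: "2 * pi \<le> real n * \<delta>"
    using reals_Archimedean3[OF \<delta>] by (meson less_imp_le)
  have "arc_impression a (a + e) \<subseteq> ?K \<or> arc_impression (a + e) (a + 2 * pi) \<subseteq> ?K"
  proof (rule arc_dichotomy[OF closed_arc_impression connected_arc_impression arc_impression_subset _ _ _ sub])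
    show "a < a + e" "a + e < a + 2 * pi" using \<delta> e by simp_all
    show "arc_impression a a \<subseteq> ?K" by (rule arc_impression_mono) (use \<delta> in simp_all)
  qed
  then have "(\<forall>t. ?N (t + \<delta>) \<subseteq> ?N t) \<or> (\<forall>t. ?N t \<subseteq> ?N (t + \<delta>))"
  proof
    assume K: "arc_impression a (a + e) \<subseteq> ?K"
    have "arc_impression r r \<subseteq> ?N t" if r: "t \<le> r" "r \<le> t + \<delta>" for r t
    proof (cases "r = t")
      case True
      then show ?thesis using \<delta> by (simp add: arc_impression_mono)
    next
      case False
      have "arc_impression ((a + r - t) + (t - a)) ((a + r - t) + (t - a))
          \<subseteq> arc_impression ((a - \<delta>) + (t - a)) (a + (t - a))"
      proof (rule arc_inclusion_translate[of a "a + 2 * \<delta>"])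
        fix s assume "a < s" "s < a + 2 * \<delta>"
        then have "arc_impression s s \<subseteq> arc_impression a (a + e)" using e by (intro arc_impression_mono) auto
        then show "arc_impression s s \<subseteq> ?K" using K by blast
      qed (use r False \<delta> in auto)
      then show ?thesis by (simp add: algebra_simps)
    qed
    then have "?N (t + \<delta>) \<subseteq> ?N t" for t
      unfolding subset_iff arc_impression_iff[of _ "t + \<delta> - \<delta>"] by auto
    then show ?thesis by blast
  next
    assume K: "arc_impression (a + e) (a + 2 * pi) \<subseteq> ?K"
    have "arc_impression r r \<subseteq> ?N (t + \<delta>)" if r: "t - \<delta> \<le> r" "r \<le> t" for r t
    proof -
      have "arc_impression ((a + r - t - \<delta>) + (t + \<delta> - a)) ((a + r - t - \<delta>) + (t + \<delta> - a))
          \<subseteq> arc_impression ((a - \<delta>) + (t + \<delta> - a)) (a + (t + \<delta> - a))"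
      proof (rule arc_inclusion_translate[of "a - 3 * \<delta>" a])
        fix s assume s: "a - 3 * \<delta> < s" "s < a"
        have "arc_impression (s + 2 * pi) (s + 2 * pi) \<subseteq> arc_impression (a + e) (a + 2 * pi)"
          using e s by (intro arc_impression_mono) auto
        then show "arc_impression s s \<subseteq> ?K" using K arc_impression_point_shift by blast
      qed (use r \<delta> in auto)
      then show ?thesis by (simp add: algebra_simps)
    qed
    then have "?N t \<subseteq> ?N (t + \<delta>)" for t
      unfolding subset_iff arc_impression_iff[of _ "t - \<delta>"] by auto
    then show ?thesis by blast
  qed
  moreover have cover: "\<exists>j\<le>n. y \<in> ?N (real j * \<delta>)" if y: "y \<in> frontier G" for y
  proof -
    obtain r where r: "0 \<le> r" "r \<le> 2 * pi" "y \<in> arc_impression r r"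
      using y arc_impression_full[of 0] arc_impression_iff[of y 0 "0 + 2 * pi"] by auto
    define j where "j = nat \<lceil>r / \<delta>\<rceil>"
    have "r / \<delta> \<le> real j" "real j < r / \<delta> + 1"
      using r(1) \<delta> unfolding j_def by (simp_all add: real_nat_ceiling_ge) linarith
    then have j: "r \<le> real j * \<delta>" "real j * \<delta> < r + \<delta>"
      using \<delta> by (simp_all add: field_simps)
    have "r / \<delta> \<le> real n" using r(2) n \<delta> by (simp add: field_simps)
    then have "j \<le> n" unfolding j_def by (simp add: ceiling_le_iff nat_le_iff)
    moreover have "y \<in> ?N (real j * \<delta>)"
      unfolding arc_impression_iff[of y "real j * \<delta> - \<delta>"] using j r(3) by (intro exI[of _ r]) auto
    ultimately show ?thesis by blast
  qed
  moreover have Suc: "real (Suc j) * \<delta> = real j * \<delta> + \<delta>" for j by (simp add: algebra_simps)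
  ultimately show False
  proof (elim disjE)
    assume "\<forall>t. ?N (t + \<delta>) \<subseteq> ?N t"
    then have "?N (real (Suc j) * \<delta>) \<subseteq> ?N (real j * \<delta>)" for j
      unfolding Suc by blast
    then have "?N (real j * \<delta>) \<subseteq> ?N (real 0 * \<delta>)" for j
      using lift_Suc_antimono_le[of "\<lambda>j. ?N (real j * \<delta>)" 0 j] by simp
    then have "frontier G \<subseteq> ?N (real 0 * \<delta>)" using cover by blast
    then show False using proper arc_impression_subset by blast
  next
    assume "\<forall>t. ?N t \<subseteq> ?N (t + \<delta>)"
    then have "?N (real j * \<delta>) \<subseteq> ?N (real (Suc j) * \<delta>)" for j
      unfolding Suc by blast
    then have "?N (real j * \<delta>) \<subseteq> ?N (real n * \<delta>)" if "j \<le> n" for j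
      using lift_Suc_mono_le[of "\<lambda>j. ?N (real j * \<delta>)" j n] that by simp
    then have "frontier G \<subseteq> ?N (real n * \<delta>)" using cover by blast
    then show False using proper arc_impression_subset by blast
  qed
qed

text \<open>
  Let \<open>L\<close> be the least length of an arc whose impression is the whole frontier.  It is positive,
  because \<open>A\<close> contains an impression, so that no single impression is the whole frontier.  If \<open>L < 2 * pi\<close>, the part
  \<open>A1\<close> of the frontier that an arc of length \<open>L - \<delta>\<close> fails to cover is contained in the
  impressions of two arcs of length \<open>\<delta>\<close>, one at each end.  It also contains an impression, whose
  position is far from one of these two short arcs, and \<open>no_far_inclusion\<close> applies.
\<close>

lemma arc_impressions_proper:
  assumes AB: "closed A" "connected A" "A \<subset> frontier G" "closed B" "B \<subset> frontier G" "A \<union> B = frontier G"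
    and ab: "b' < a' + 2 * pi"
  shows "arc_impression a' b' \<noteq> frontier G"
proof
  assume full: "arc_impression a' b' = frontier G"
  have neighborhood: "\<exists>R>0. ball x R \<inter> frontier G \<subseteq> S" if xT: "x \<notin> T" "closed T" and cover: "frontier G \<subseteq> S \<union> T" for x S T
  proof -
    obtain R where "R > 0" "ball x R \<subseteq> - T" using xT by (meson Compl_iff open_Compl open_contains_ball)
    then show ?thesis using cover by blast
  qed
  obtain x where x: "x \<in> frontier G" "x \<notin> B" using AB(5) by blast
  obtain R where "R > 0" "ball x R \<inter> frontier G \<subseteq> A" using neighborhood[OF x(2) AB(4), of A] AB(6) by blast
  then obtain e0 where "arc_impression e0 e0 \<subseteq> A"
    using impressions_in_neighborhood[OF AB(1,2) psubset_imp_subset[OF AB(3)] x(1)] by blast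
  then have e0: "arc_impression e0 e0 \<noteq> frontier G" using AB(3) by blast
  define S where "S = {l \<in> {0..2 * pi}. arc_impression 0 l = frontier G}"
  have translate: "arc_impression a (a + l) = frontier G" if "l \<in> S" for a l
    using arc_full_translate[of 0 l a] that by (simp add: S_def add.commute)
  have "a' \<le> b'"
  proof (rule ccontr)
    assume "\<not> a' \<le> b'"
    then have "arc_impression a' b' = {}" by (simp add: arc_impression_def)
    then show False using full frontier_nonempty by simp
  qed
  then have bS: "b' - a' \<in> S"
    using arc_full_translate[OF full, of "- a'"] ab by (simp add: S_def)
  have "closed S"
    unfolding closed_sequential_limits
  proof (intro allI impI)
    fix l :: "nat \<Rightarrow> real" and l' assume l: "(\<forall>n. l n \<in> S) \<and> l \<longlonglongrightarrow> l'"
    have "l' \<in> {0..2 * pi}"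
    proof (rule closed_sequentially[of "{0..2 * pi}" l l'])
      show "l n \<in> {0..2 * pi}" for n using l by (simp add: S_def)
    qed (use l in auto)
    moreover have "frontier G \<subseteq> arc_impression 0 l'"
      unfolding arc_impression_def
    proof
      fix y assume "y \<in> frontier G"
      then have "y \<in> impression \<phi> (cis ` {0..l n})" for n using l by (auto simp: S_def arc_impression_def)
      then show "y \<in> impression \<phi> (cis ` {0..l'})"
        by (rule impression_arc_limit) (use l in auto)
    qed
    ultimately show "l' \<in> S" using arc_impression_subset by (auto simp: S_def)
  qed
  define L where "L = Inf S"
  have LS: "L \<in> S" unfolding L_def
    by (rule closed_contains_Inf) (use bS \<open>closed S\<close> in \<open>auto simp: S_def intro!: bdd_belowI[of _ 0]\<close>)
  have Lmin: "l \<notin> S" if "l < L" for l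
  proof
    assume "l \<in> S"
    moreover have "bdd_below S" by (rule bdd_belowI[of _ 0]) (simp add: S_def)
    ultimately have "L \<le> l" unfolding L_def by (rule cInf_lower)
    with that show False by simp
  qed
  have "L \<le> b' - a'" using bS Lmin by (meson not_le)
  then have L2: "L < 2 * pi" using ab by simp
  have "0 \<notin> S" using translate[of 0 e0] e0 by auto
  then have L0: "0 < L" using LS by (cases "L = 0") (auto simp: S_def)
  \<comment> \<open>With this \<open>\<delta>\<close> the enlarged arcs from \<open>- 3 \<delta>\<close> to \<open>2 \<delta>\<close> and from \<open>L - 3 \<delta>\<close> to \<open>L + 2 \<delta>\<close> are disjoint
    on the circle, so every angle is far from one of them.\<close>
  define \<delta> where "\<delta> = min L (2 * pi - L) / 6"
  have \<delta>: "0 < \<delta>" "6 * \<delta> \<le> L" "6 * \<delta> \<le> 2 * pi - L" using L0 L2 by (auto simp: \<delta>_def)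
  have proper: "arc_impression t (t + l) \<noteq> frontier G" if l: "0 \<le> l" "l < L" for t l
  proof
    assume "arc_impression t (t + l) = frontier G"
    then have "arc_impression (t + - t) (t + l + - t) = frontier G" by (rule arc_full_translate)
    then have "l \<in> S" using l L2 by (simp add: S_def)
    then show False using Lmin l by blast
  qed
  define B1 where "B1 = arc_impression 0 (L - \<delta>)"
  define A1 where "A1 = closure (frontier G - B1)"
  have B1: "closed B1" "B1 \<subseteq> frontier G" "B1 \<noteq> frontier G"
    using closed_arc_impression arc_impression_subset proper[of "L - \<delta>" 0] \<delta> by (auto simp: B1_def)
  have A1: "closed A1" "connected A1" "A1 \<subseteq> frontier G"
    unfolding A1_def
    using irr.connected_frontier_Diff[of B1] B1(1,2) connected_arc_impression
    by (auto simp: B1_def connected_imp_connected_closure intro: closure_minimal[THEN subsetD])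
  have A1a: "A1 \<subseteq> arc_impression (a - \<delta>) a" if "a = 0 \<or> a = L" for a
    unfolding A1_def
  proof (rule closure_minimal[OF _ closed_arc_impression])
    show "frontier G - B1 \<subseteq> arc_impression (a - \<delta>) a"
      using that
    proof
      assume a: "a = 0"
      have "arc_impression (- \<delta>) 0 \<union> arc_impression 0 (L - \<delta>) = frontier G"
        using arc_impression_Un[of "- \<delta>" 0 "L - \<delta>"] translate[OF LS, of "- \<delta>"] \<delta> by (simp add: algebra_simps)
      then show ?thesis unfolding B1_def a by auto
    next
      assume a: "a = L"
      have "arc_impression 0 (L - \<delta>) \<union> arc_impression (L - \<delta>) L = frontier G"
        using arc_impression_Un[of 0 "L - \<delta>" L] translate[OF LS, of 0] \<delta> by simp
      then show ?thesis unfolding B1_def a by auto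
    qed
  qed
  obtain x1 where x1: "x1 \<in> frontier G" "x1 \<notin> B1" using B1(2,3) by blast
  have "frontier G \<subseteq> A1 \<union> B1" unfolding A1_def using closure_subset[of "frontier G - B1"] by blast
  then obtain R1 where "R1 > 0" "ball x1 R1 \<inter> frontier G \<subseteq> A1" using neighborhood[OF x1(2) B1(1)] by blast
  then obtain e1 where e1: "arc_impression e1 e1 \<subseteq> A1"
    using impressions_in_neighborhood[OF A1 x1(1)] by blast
  have "cis e1 \<in> cis ` {- 3 * \<delta>..- 3 * \<delta> + 2 * pi}" unfolding cis_image_full by simp
  then obtain e where e: "- 3 * \<delta> \<le> e" "e \<le> 2 * pi - 3 * \<delta>" "cis e1 = cis e" by auto
  have eA: "arc_impression e e \<subseteq> A1" using e1 e(3) by (simp add: arc_impression_def)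
  have p\<delta>: "arc_impression (t - \<delta>) t \<noteq> frontier G" for t
    using proper[of \<delta> "t - \<delta>"] \<delta> by simp
  show False
  proof (cases "2 * \<delta> \<le> e")
    case True
    show False
      by (rule no_far_inclusion[OF \<delta>(1) True e(2) p\<delta>, of 0]) (use eA A1a[of 0] in auto)
  next
    case False
    have "arc_impression (L + (e + 2 * pi - L)) (L + (e + 2 * pi - L)) \<subseteq> A1"
      using eA arc_impression_point_shift[of e] by simp
    then have s: "arc_impression (L + (e + 2 * pi - L)) (L + (e + 2 * pi - L)) \<subseteq> arc_impression (L - \<delta>) L"
      using A1a[of L] by blast
    show False
      by (rule no_far_inclusion[OF \<delta>(1) _ _ p\<delta> s]) (use False e \<delta> in linarith)+
  qed
qed

text \<open>
  Disjointness of the impressions makes the boundary graph the graph of a function of \<open>x\<close>, which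
  is continuous because the graph is compact.
\<close>

lemma inverse_extends_if_decomposable:
  assumes AB: "closed A" "connected A" "A \<subset> frontier G" "closed B" "B \<subset> frontier G" "A \<union> B = frontier G"
  shows "inverse_extends_to_boundary \<phi> G"
proof -
  have disj: "arc_impression c c \<inter> arc_impression c' c' = {}" if "c < c'" "c' < c + 2 * pi" for c c'
    by (rule impressions_disjoint[OF arc_impressions_proper[OF AB] that])
  have uniq: "\<zeta> = \<zeta>'" if z: "(\<zeta>, x) \<in> boundary_graph \<phi>" "(\<zeta>', x) \<in> boundary_graph \<phi>" for \<zeta> \<zeta>' x
  proof (cases "x \<in> G")
    case True
    then have "\<zeta> \<in> ball 0 1" "\<zeta>' \<in> ball 0 1" using boundary_graph_interior(1) z by blast+
    moreover from this have "\<phi> \<zeta> = \<phi> \<zeta>'" using boundary_graph_interior(2) z by metis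
    ultimately show ?thesis using inj_onD[OF inj] by blast
  next
    case False
    have "\<zeta> \<in> cball 0 1" "\<zeta> \<notin> ball 0 1" "\<zeta>' \<in> cball 0 1" "\<zeta>' \<notin> ball 0 1"
      using False boundary_graph_interior(1) boundary_graph_domain z by blast+
    then have s: "\<zeta> \<in> sphere 0 1" "\<zeta>' \<in> sphere 0 1" by auto
    obtain c where c: "\<zeta> = cis c" using s(1) cis_image_full[of 0] by blast
    obtain c' where c': "c \<le> c'" "c' \<le> c + 2 * pi" "\<zeta>' = cis c'"
    proof -
      have "\<zeta>' \<in> cis ` {c..c + 2 * pi}" using s(2) unfolding cis_image_full .
      then show thesis using that by auto
    qed
    have "x \<in> arc_impression c c \<inter> arc_impression c' c'"
      using z c c'(3) by (simp add: arc_impression_def)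
    then have "c' = c \<or> c' = c + 2 * pi" using disj[of c c'] c'(1,2) by fastforce
    then show ?thesis using c c'(3) by (auto simp: cis_add_2pi)
  qed
  have ex: "\<exists>\<zeta>. (\<zeta>, x) \<in> boundary_graph \<phi>" if x: "x \<in> closure G" for x
    using x unfolding boundary_graph_projections(2)[symmetric] by auto
  define \<Psi> where "\<Psi> x = (THE \<zeta>. (\<zeta>, x) \<in> boundary_graph \<phi>)" for x
  have \<Psi>: "(\<Psi> x, x) \<in> boundary_graph \<phi>" if "x \<in> closure G" for x
    unfolding \<Psi>_def using ex[OF that] uniq by (metis (no_types, lifting) theI)
  have graph: "(\<lambda>x. (x, \<Psi> x)) ` closure G = prod.swap ` boundary_graph \<phi>"
  proof (intro subset_antisym subsetI)
    fix p assume "p \<in> prod.swap ` boundary_graph \<phi>"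
    then obtain \<zeta> x where p: "p = (x, \<zeta>)" "(\<zeta>, x) \<in> boundary_graph \<phi>" by auto
    have "x \<in> closure G" using boundary_graph_domain[OF p(2)] by simp
    then show "p \<in> (\<lambda>x. (x, \<Psi> x)) ` closure G" using p uniq[OF p(2) \<Psi>] by auto
  next
    fix p assume "p \<in> (\<lambda>x. (x, \<Psi> x)) ` closure G"
    then show "p \<in> prod.swap ` boundary_graph \<phi>" using \<Psi> by force
  qed
  have "continuous_on (closure G) \<Psi>"
  proof (rule continuous_from_closed_graph[of "cball 0 1"])
    show "\<Psi> \<in> closure G \<rightarrow> cball 0 1" using \<Psi> boundary_graph_domain by blast
    have "compact (prod.swap ` boundary_graph \<phi>)"
      by (rule compact_continuous_image[OF _ compact_boundary_graph]) (intro continuous_on_swap)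
    then show "closed ((\<lambda>x. (x, \<Psi> x)) ` closure G)" unfolding graph by (rule compact_imp_closed)
  qed simp
  moreover have "\<Psi> \<in> closure G \<rightarrow> cball 0 1" using \<Psi> boundary_graph_domain by blast
  moreover have "\<Psi> w = inv_into (ball 0 1) \<phi> w" if w: "w \<in> G" for w
  proof -
    have "w \<in> closure G" using w closure_subset by blast
    from \<Psi>[OF this] have "\<Psi> w \<in> ball 0 1" "w = \<phi> (\<Psi> w)"
      using boundary_graph_interior w by blast+
    then show ?thesis using inv_chart[of "\<Psi> w"] by (simp add: inv_chart_def)
  qed
  moreover have "\<Psi> \<in> frontier G \<rightarrow> sphere 0 1"
  proof
    fix x assume x: "x \<in> frontier G"
    then have xcl: "x \<in> closure G" "x \<notin> G" using open_G by (auto simp: frontier_def interior_open)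
    have "\<Psi> x \<in> cball 0 1" "\<Psi> x \<notin> ball 0 1"
      using boundary_graph_domain[OF \<Psi>[OF xcl(1)]] boundary_graph_interior(1)[OF \<Psi>[OF xcl(1)]] xcl(2) by blast+
    then show "\<Psi> x \<in> sphere 0 1" by simp
  qed
  ultimately show ?thesis unfolding inverse_extends_to_boundary_def by blast
qed

end

text \<open>
  The extension takes the value \<open>cis t\<close> on the impression at \<open>cis t\<close>, so the impressions of two
  complementary half circles are proper subcontinua.
\<close>

lemma (in disk_chart) not_indecomposable_if_inverse_extends:
  assumes "inverse_extends_to_boundary \<phi> G"
  shows "\<not> indecomposable_continuum (frontier G)"
proof -
  obtain \<Psi> where \<Psi>: "continuous_on (closure G) \<Psi>" "\<And>w. w \<in> G \<Longrightarrow> \<Psi> w = inv_chart w"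
    using assms unfolding inverse_extends_to_boundary_def inv_chart_def by blast
  have val: "\<Psi> x = cis t" if x: "x \<in> arc_impression t t" for x t
  proof -
    have bg: "(cis t, x) \<in> boundary_graph \<phi>" using x by (simp add: arc_impression_def)
    obtain z where z: "\<forall>n. z n \<in> ball 0 1" "z \<longlonglongrightarrow> cis t" "(\<lambda>n. \<phi> (z n)) \<longlonglongrightarrow> x"
      by (rule boundary_graph_sequentialE[OF bg])
    have xcl: "x \<in> closure G" using boundary_graph_domain[OF bg] by simp
    have zG: "\<phi> (z n) \<in> G" for n using z(1) image by blast
    have "(\<lambda>n. \<Psi> (\<phi> (z n))) \<longlonglongrightarrow> \<Psi> x"
      by (rule continuous_on_tendsto_compose[OF \<Psi>(1) z(3) xcl]) (use zG closure_subset in \<open>auto intro!: always_eventually\<close>)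
    moreover have "\<Psi> (\<phi> (z n)) = z n" for n using \<Psi>(2)[OF zG] inv_chart z(1) by simp
    ultimately have "z \<longlonglongrightarrow> \<Psi> x" by simp
    then show ?thesis using z(2) by (rule LIMSEQ_unique)
  qed
  let ?A = "arc_impression 0 pi" and ?B = "arc_impression pi (0 + 2 * pi)"
  have "?A \<noteq> frontier G"
  proof
    assume A: "?A = frontier G"
    obtain x where x: "x \<in> arc_impression (- pi / 2) (- pi / 2)" using arc_impression_nonempty by blast
    then have "x \<in> ?A" using A arc_impression_subset by blast
    then obtain t where t: "0 \<le> t" "t \<le> pi" "x \<in> arc_impression t t" using arc_impression_iff by blast
    have "cis t = cis (- pi / 2)" using val x t(3) by metis
    then have "Im (cis t) = Im (cis (- pi / 2))" by simp
    then have "sin t = - 1" by (simp add: minus_divide_left[symmetric])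
    then show False using sin_ge_zero[OF t(1,2)] by simp
  qed
  moreover have "?B \<noteq> frontier G"
  proof
    assume B: "?B = frontier G"
    obtain x where x: "x \<in> arc_impression (pi / 2) (pi / 2)" using arc_impression_nonempty by blast
    then have "x \<in> ?B" using B arc_impression_subset by blast
    then obtain t where t: "pi \<le> t" "t \<le> 2 * pi" "x \<in> arc_impression t t"
      using arc_impression_iff[of x pi "0 + 2 * pi"] by auto
    have "cis t = cis (pi / 2)" using val x t(3) by metis
    then have "Im (cis t) = Im (cis (pi / 2))" by simp
    then have "sin t = 1" by simp
    moreover have "sin t \<le> 0" using sin_ge_zero[of "t - pi"] t(1,2) by (simp add: sin_diff)
    ultimately show False by simp
  qed
  moreover have "frontier G = ?A \<union> ?B"
    using arc_impression_Un[of 0 pi "0 + 2 * pi"] arc_impression_full[of 0] by simp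
  moreover have "closedin (top_of_set (frontier G)) ?A" "closedin (top_of_set (frontier G)) ?B"
    by (rule closed_subset[OF arc_impression_subset closed_arc_impression])+
  ultimately show ?thesis
    unfolding indecomposable_continuum_def using connected_arc_impression by blast
qed

theorem theorem1p1:
  fixes G :: "complex set" and F \<phi> :: "complex \<Rightarrow> complex" and \<theta> :: real and w\<^sub>0 :: complex
  assumes "irreducible_local_siegel_disk G F \<theta> w\<^sub>0"
    and "conjugation_map \<phi> G F \<theta>"
  shows "(inverse_extends_to_boundary \<phi> G \<or> indecomposable_continuum (frontier G)) \<and>
         \<not> (inverse_extends_to_boundary \<phi> G \<and> indecomposable_continuum (frontier G))"
proof -
  have siegel: "bounded_local_siegel_disk G F \<theta>" "siegel_point G F w\<^sub>0"
    and irred: "\<And>C. closed C \<Longrightarrow> C \<subset> frontier G \<Longrightarrow> \<not> separates_from_infinity C w\<^sub>0"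
    using assms(1) unfolding irreducible_local_siegel_disk_def by blast+
  have G: "bounded G" "open G" "connected G" "\<theta> \<notin> \<rat>"
    using siegel(1) unfolding bounded_local_siegel_disk_def simply_connected_domain_def by blast+
  obtain Fc where Fc: "continuous_on (closure G) Fc" "\<And>z. z \<in> G \<Longrightarrow> Fc z = F z"
    using siegel(1) unfolding bounded_local_siegel_disk_def by blast
  have w0: "w\<^sub>0 \<in> G" using siegel(2) unfolding siegel_point_def by blast
  interpret disk_chart \<phi> G
    using assms(2) G(1) unfolding conjugation_map_def conformal_iso_def by unfold_locales auto
  obtain R where R: "0 < R" "G \<subseteq> cball 0 R"
    using G(1) unfolding bounded_pos by (auto simp: subset_iff)
  have clR: "closure G \<subseteq> cball 0 R" using R(2) by (intro closure_minimal) auto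
  define b where "b = complex_of_real (R + 1)"
  have nb: "R < norm b" using R(1) by (simp add: b_def del: of_real_add)
  \<comment> \<open>The dynamics on the frontier is that of the continuous extension \<open>Fc\<close>, not of \<open>F\<close>.\<close>
  interpret siegel_chart \<phi> G Fc \<theta> w\<^sub>0 b
  proof unfold_locales
    show "Fc (\<phi> z) = \<phi> (cis (2 * pi * \<theta>) * z)" if "z \<in> ball 0 1" for z
    proof -
      have "\<phi> z \<in> G" using image that by blast
      then show ?thesis using Fc(2) assms(2) that unfolding conjugation_map_def by simp
    qed
    show "b \<notin> closure G" using clR nb by auto
    show "connected_component (- C) w\<^sub>0 b" if C: "closed C" "C \<subset> frontier G" for C
    proof (rule connected_component_of_not_separates_from_infinity[OF C(1) _ _ nb irred[OF C]])
      show "C \<subseteq> cball 0 R" using C(2) clR by (auto simp: frontier_def)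
      show "w\<^sub>0 \<notin> C" using C(2) w0 open_G frontier_disjoint_eq by blast
    qed
  qed (use G Fc(1) w0 in auto)
  have "inverse_extends_to_boundary \<phi> G" if nind: "\<not> indecomposable_continuum (frontier G)"
  proof -
    have "compact (frontier G)" by (rule irr.compact_frontier)
    then obtain A B where AB: "closedin (top_of_set (frontier G)) A" "connected A" "A \<noteq> frontier G"
        "closedin (top_of_set (frontier G)) B" "connected B" "B \<noteq> frontier G" "frontier G = A \<union> B"
      using nind connected_frontier unfolding indecomposable_continuum_def by blast
    have "closed A" "closed B" using AB(1,4) closedin_closed_trans frontier_closed by blast+
    then show ?thesis
      using AB by (intro inverse_extends_if_decomposable[of A B]) auto
  qed
  then show ?thesis using not_indecomposable_if_inverse_extends by blast
qed

end
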